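(* Let $\mathfrak g=\mathfrak q\times\mathfrak s$ be an elementary solvable pre-symplectic Lie algebra with associated symplectic Lie algebra $\mathfrak s$, let $G,Q,S$ be the associated connected simply connected Lie groups, and assume that $Q\times S\to G$, $(q,s)\mapsto qs$, is a global diffeomorphism. Let $({\bf H}^S,\star^S)$ be an associative algebra of functions on $S$ such that ${\bf H}^S\subset\mathrm{Fun}(S)$ is an invariant subspace with respect to the left regular representation of $S$ on $\mathrm{Fun}(S)$ and $\star^S$ is an $S$-left-invariant product on ${\bf H}^S$. Then the function space $${\bf H}:=\{u\in\mathrm{Fun}(G)\ |\ \forall q\in Q:\ u(q,\cdot)\in{\bf H}^S\}$$ is an invariant subspace of $\mathrm{Fun}(G)$ with respect to the left regular representation of $G$, and the formula $$u\star v(q,s):=(u(q,\cdot)\star^Sv(q,\cdot))(s)$$ defines a $G$-left-invariant associative product on ${\bf H}$.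
   Context: A symplectic Lie algebra $(\mathfrak s,\omega)$ (a real Lie algebra with a nondegenerate Chevalley 2-cocycle $\omega$) is elementary solvable if $\mathfrak s$ is a split extension $0\to\mathfrak d\to\mathfrak s\to\mathfrak a\to0$ of Abelian Lie algebras and $\omega$ is exact. An elementary solvable pre-symplectic Lie algebra is a split Abelian extension $0\to\mathfrak q\to\mathfrak g\to\mathfrak s\to0$ ($\mathfrak q$ an Abelian ideal, $\mathfrak s$ realized as a complementary subalgebra of $\mathfrak g$) of an elementary solvable symplectic Lie algebra $(\mathfrak s,\omega)$, equipped with the Poisson structure $\mathbf w_e((q_1^*,s_1^* ),(q_2^*,s_2^* )):=\omega({}^\sharp s_1^*,{}^\sharp s_2^* )$, where $q_i^*\in\mathfrak q^\star$, $s_i^*\in\mathfrak s^\star$ and $\sharp:\mathfrak s^\star\to\mathfrak s$ is the musical isomorphism given by $\omega$. $Q$ and $S$ are regarded as the subgroups of $G$ with Lie algebras $\mathfrak q$ and $\mathfrak s$; functions on $G$ are written $u(q,s)=u(qs)$. $\mathrm{Fun}(X)$ is the space of complex-valued functions on $X$. The left regular representation is given by $(L_g^\star u)(x)=u(gx)$, and a product $\star$ on an invariant function space is left-invariant if $(L_g^\star u)\star(L_g^\star v)=L_g^\star(u\star v)$ for all group elements $g$. *)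

theory Defs
  imports "HOL-Analysis.Analysis" "HOL-Algebra.Group"
begin

section \<open>Finite-dimensional real Lie algebras\<close>

text \<open>
  A finite-dimensional real Lie algebra is a linear subspace of some Euclidean space together with
  a bracket on it; the inner product of the ambient space plays no role.  Working with subspaces
  rather than with types allows the zero-dimensional case and makes ideals, subalgebras and the
  Lie algebra itself objects of the same kind.
\<close>

definition linear_within :: "'a::real_vector set \<Rightarrow> ('a \<Rightarrow> 'b::real_vector) \<Rightarrow> bool" where
  "linear_within V f \<longleftrightarrow>
     (\<forall>x\<in>V. \<forall>y\<in>V. f (x + y) = f x + f y) \<and> (\<forall>c. \<forall>x\<in>V. f (c *\<^sub>R x) = c *\<^sub>R f x)"

definition bilinear_within :: "'a::real_vector set \<Rightarrow> ('a \<Rightarrow> 'a \<Rightarrow> 'b::real_vector) \<Rightarrow> bool" where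
  "bilinear_within V b \<longleftrightarrow>
     (\<forall>x\<in>V. linear_within V (b x)) \<and> (\<forall>y\<in>V. linear_within V (\<lambda>x. b x y))"

definition lie_algebra :: "('a::euclidean_space \<Rightarrow> 'a \<Rightarrow> 'a) \<Rightarrow> 'a set \<Rightarrow> bool" where
  "lie_algebra br \<gg> \<longleftrightarrow>
     subspace \<gg> \<and> (\<forall>x\<in>\<gg>. \<forall>y\<in>\<gg>. br x y \<in> \<gg>) \<and> bilinear_within \<gg> br \<and>
     (\<forall>x\<in>\<gg>. br x x = 0) \<and>
     (\<forall>x\<in>\<gg>. \<forall>y\<in>\<gg>. \<forall>z\<in>\<gg>. br x (br y z) + br y (br z x) + br z (br x y) = 0)"

definition abelian_lie :: "('a::euclidean_space \<Rightarrow> 'a \<Rightarrow> 'a) \<Rightarrow> 'a set \<Rightarrow> bool" where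
  "abelian_lie br \<hh> \<longleftrightarrow> (\<forall>x\<in>\<hh>. \<forall>y\<in>\<hh>. br x y = 0)"

definition lie_subalgebra :: "('a::euclidean_space \<Rightarrow> 'a \<Rightarrow> 'a) \<Rightarrow> 'a set \<Rightarrow> 'a set \<Rightarrow> bool" where
  "lie_subalgebra br \<gg> \<hh> \<longleftrightarrow> subspace \<hh> \<and> \<hh> \<subseteq> \<gg> \<and> (\<forall>x\<in>\<hh>. \<forall>y\<in>\<hh>. br x y \<in> \<hh>)"

definition lie_ideal :: "('a::euclidean_space \<Rightarrow> 'a \<Rightarrow> 'a) \<Rightarrow> 'a set \<Rightarrow> 'a set \<Rightarrow> bool" where
  "lie_ideal br \<gg> \<nn> \<longleftrightarrow> subspace \<nn> \<and> \<nn> \<subseteq> \<gg> \<and> (\<forall>x\<in>\<gg>. \<forall>y\<in>\<nn>. br x y \<in> \<nn>)"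

text \<open>
  Split extension \<open>0 \<rightarrow> \<nn> \<rightarrow> \<gg> \<rightarrow> \<hh> \<rightarrow> 0\<close>, with the quotient realized by the splitting
  as a complementary subalgebra \<open>\<hh>\<close> of \<open>\<gg>\<close>.
\<close>

definition split_extension ::
    "('a::euclidean_space \<Rightarrow> 'a \<Rightarrow> 'a) \<Rightarrow> 'a set \<Rightarrow> 'a set \<Rightarrow> 'a set \<Rightarrow> bool" where
  "split_extension br \<nn> \<gg> \<hh> \<longleftrightarrow>
     lie_ideal br \<gg> \<nn> \<and> lie_subalgebra br \<gg> \<hh> \<and>
     \<nn> \<inter> \<hh> = {0} \<and> (\<forall>x\<in>\<gg>. \<exists>y\<in>\<nn>. \<exists>z\<in>\<hh>. x = y + z)"


section \<open>Elementary solvable symplectic and pre-symplectic Lie algebras\<close>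

definition chevalley_2_cocycle ::
    "('a::euclidean_space \<Rightarrow> 'a \<Rightarrow> 'a) \<Rightarrow> 'a set \<Rightarrow> ('a \<Rightarrow> 'a \<Rightarrow> real) \<Rightarrow> bool" where
  "chevalley_2_cocycle br \<ss> \<omega> \<longleftrightarrow>
     bilinear_within \<ss> \<omega> \<and> (\<forall>x\<in>\<ss>. \<omega> x x = 0) \<and>
     (\<forall>x\<in>\<ss>. \<forall>y\<in>\<ss>. \<forall>z\<in>\<ss>. \<omega> (br x y) z + \<omega> (br y z) x + \<omega> (br z x) y = 0)"

definition nondegenerate_on :: "'a::euclidean_space set \<Rightarrow> ('a \<Rightarrow> 'a \<Rightarrow> real) \<Rightarrow> bool" where
  "nondegenerate_on \<ss> \<omega> \<longleftrightarrow> (\<forall>x\<in>\<ss>. (\<forall>y\<in>\<ss>. \<omega> x y = 0) \<longrightarrow> x = 0)"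

text \<open>The Chevalley coboundary of \<open>\<xi>\<close> is \<open>\<xi> [x, y]\<close> up to a sign that can be absorbed in \<open>\<xi>\<close>.\<close>

definition exact_2_form ::
    "('a::euclidean_space \<Rightarrow> 'a \<Rightarrow> 'a) \<Rightarrow> 'a set \<Rightarrow> ('a \<Rightarrow> 'a \<Rightarrow> real) \<Rightarrow> bool" where
  "exact_2_form br \<ss> \<omega> \<longleftrightarrow>
     (\<exists>\<xi>::'a \<Rightarrow> real. linear_within \<ss> \<xi> \<and> (\<forall>x\<in>\<ss>. \<forall>y\<in>\<ss>. \<omega> x y = \<xi> (br x y)))"

definition symplectic_lie_algebra ::
    "('a::euclidean_space \<Rightarrow> 'a \<Rightarrow> 'a) \<Rightarrow> 'a set \<Rightarrow> ('a \<Rightarrow> 'a \<Rightarrow> real) \<Rightarrow> bool" where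
  "symplectic_lie_algebra br \<ss> \<omega> \<longleftrightarrow>
     lie_algebra br \<ss> \<and> chevalley_2_cocycle br \<ss> \<omega> \<and> nondegenerate_on \<ss> \<omega>"

definition elementary_solvable_symplectic ::
    "('a::euclidean_space \<Rightarrow> 'a \<Rightarrow> 'a) \<Rightarrow> 'a set \<Rightarrow> ('a \<Rightarrow> 'a \<Rightarrow> real) \<Rightarrow> bool" where
  "elementary_solvable_symplectic br \<ss> \<omega> \<longleftrightarrow>
     symplectic_lie_algebra br \<ss> \<omega> \<and>
     (\<exists>\<dd> \<aa>. split_extension br \<dd> \<ss> \<aa> \<and> abelian_lie br \<dd> \<and> abelian_lie br \<aa>) \<and>
     exact_2_form br \<ss> \<omega>"

definition dual_within :: "'a::euclidean_space set \<Rightarrow> ('a \<Rightarrow> real) set" where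
  "dual_within V = {\<xi>. linear_within V \<xi>}"

text \<open>
  The opposite convention \<open>\<omega> y x = \<xi> y\<close> changes the sign of the musical isomorphism,
  which does not affect the Poisson structure below.
\<close>

definition musical_sharp ::
    "'a::euclidean_space set \<Rightarrow> ('a \<Rightarrow> 'a \<Rightarrow> real) \<Rightarrow> ('a \<Rightarrow> real) \<Rightarrow> 'a" where
  "musical_sharp \<ss> \<omega> \<xi> = (THE x. x \<in> \<ss> \<and> (\<forall>y\<in>\<ss>. \<omega> x y = \<xi> y))"

text \<open>
  The Poisson structure \<open>\<w>\<close> is a form on the dual of \<open>\<gg>\<close>, identified with
  pairs of a functional on \<open>\<qq>\<close> and a functional on \<open>\<ss>\<close>.
\<close>

definition elementary_solvable_presymplectic ::
    "('a::euclidean_space \<Rightarrow> 'a \<Rightarrow> 'a) \<Rightarrow> 'a set \<Rightarrow> 'a set \<Rightarrow> 'a set \<Rightarrow> ('a \<Rightarrow> 'a \<Rightarrow> real) \<Rightarrow>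
     (('a \<Rightarrow> real) \<times> ('a \<Rightarrow> real) \<Rightarrow> ('a \<Rightarrow> real) \<times> ('a \<Rightarrow> real) \<Rightarrow> real) \<Rightarrow> bool" where
  "elementary_solvable_presymplectic br \<gg> \<qq> \<ss> \<omega> \<w> \<longleftrightarrow>
     lie_algebra br \<gg> \<and> split_extension br \<qq> \<gg> \<ss> \<and> abelian_lie br \<qq> \<and>
     elementary_solvable_symplectic br \<ss> \<omega> \<and>
     (\<forall>q1\<in>dual_within \<qq>. \<forall>s1\<in>dual_within \<ss>. \<forall>q2\<in>dual_within \<qq>. \<forall>s2\<in>dual_within \<ss>.
        \<w> (q1, s1) (q2, s2) = \<omega> (musical_sharp \<ss> \<omega> s1) (musical_sharp \<ss> \<omega> s2))"


section \<open>Smooth manifolds\<close>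

text \<open>
  Manifolds are modelled on a linear subspace \<open>V\<close> of a Euclidean space (possibly \<open>{0}\<close>), so smoothness
  is needed for functions on a relatively open subset \<open>U\<close> of \<open>V\<close>.  A derivative within \<open>U\<close>
  is then determined exactly in the directions of \<open>V\<close>; a function is \<open>C\<^sup>k\<^sup>+\<^sup>1\<close> iff it is differentiable
  and its derivative in every direction of \<open>V\<close> is \<open>C\<^sup>k\<close>.
\<close>

primrec Ck_on :: "nat \<Rightarrow> 'e::euclidean_space set \<Rightarrow> 'e set \<Rightarrow> ('e \<Rightarrow> 'f::real_normed_vector) \<Rightarrow> bool" where
  "Ck_on 0 V U f \<longleftrightarrow> continuous_on U f"
| "Ck_on (Suc k) V U f \<longleftrightarrow>
     (\<exists>f'. (\<forall>x\<in>U. (f has_derivative f' x) (at x within U)) \<and>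
           (\<forall>v\<in>V. Ck_on k V U (\<lambda>x. f' x v)))"

definition smooth_on :: "'e::euclidean_space set \<Rightarrow> 'e set \<Rightarrow> ('e \<Rightarrow> 'f::real_normed_vector) \<Rightarrow> bool" where
  "smooth_on V U f \<longleftrightarrow> (\<forall>k. Ck_on k V U f)"

record ('p, 'e) mfd =
  mtop :: "'p topology"
  model :: "'e set"
  atlas :: "('p set \<times> ('p \<Rightarrow> 'e)) set"

definition second_countable_space :: "'p topology \<Rightarrow> bool" where
  "second_countable_space T \<longleftrightarrow>
     (\<exists>\<B>. countable \<B> \<and> (\<forall>B\<in>\<B>. openin T B) \<and>
          (\<forall>W x. openin T W \<and> x \<in> W \<longrightarrow> (\<exists>B\<in>\<B>. x \<in> B \<and> B \<subseteq> W)))"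

definition smooth_manifold :: "('p, 'e::euclidean_space) mfd \<Rightarrow> bool" where
  "smooth_manifold M \<longleftrightarrow>
     Hausdorff_space (mtop M) \<and> second_countable_space (mtop M) \<and> subspace (model M) \<and>
     (\<Union>(U, \<phi>)\<in>atlas M. U) = topspace (mtop M) \<and>
     (\<forall>(U, \<phi>)\<in>atlas M. openin (mtop M) U \<and> openin (top_of_set (model M)) (\<phi> ` U) \<and>
        homeomorphic_map (subtopology (mtop M) U) (top_of_set (\<phi> ` U)) \<phi>) \<and>
     (\<forall>(U, \<phi>)\<in>atlas M. \<forall>(U', \<psi>)\<in>atlas M.
        smooth_on (model M) (\<phi> ` (U \<inter> U')) (\<psi> \<circ> inv_into U \<phi>))"

definition smooth_map_on ::
    "('p, 'e::euclidean_space) mfd \<Rightarrow> ('r, 'f::euclidean_space) mfd \<Rightarrow> 'p set \<Rightarrow> ('p \<Rightarrow> 'r) \<Rightarrow> bool" where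
  "smooth_map_on M N W f \<longleftrightarrow>
     openin (mtop M) W \<and> continuous_map (subtopology (mtop M) W) (mtop N) f \<and>
     (\<forall>(U, \<phi>)\<in>atlas M. \<forall>(U', \<psi>)\<in>atlas N.
        smooth_on (model M) (\<phi> ` (U \<inter> W \<inter> f -` U')) (\<psi> \<circ> f \<circ> inv_into U \<phi>))"

abbreviation smooth_map ::
    "('p, 'e::euclidean_space) mfd \<Rightarrow> ('r, 'f::euclidean_space) mfd \<Rightarrow> ('p \<Rightarrow> 'r) \<Rightarrow> bool" where
  "smooth_map M N f \<equiv> smooth_map_on M N (topspace (mtop M)) f"

definition diffeomorphism ::
    "('p, 'e::euclidean_space) mfd \<Rightarrow> ('r, 'f::euclidean_space) mfd \<Rightarrow> ('p \<Rightarrow> 'r) \<Rightarrow> bool" where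
  "diffeomorphism M N f \<longleftrightarrow>
     smooth_map M N f \<and> bij_betw f (topspace (mtop M)) (topspace (mtop N)) \<and>
     smooth_map N M (inv_into (topspace (mtop M)) f)"

definition prod_mfd ::
    "('p, 'e::euclidean_space) mfd \<Rightarrow> ('r, 'f::euclidean_space) mfd \<Rightarrow> ('p \<times> 'r, 'e \<times> 'f) mfd" where
  "prod_mfd M N =
     \<lparr>mtop = prod_topology (mtop M) (mtop N), model = model M \<times> model N,
      atlas = {(U \<times> U', map_prod \<phi> \<psi>) |U \<phi> U' \<psi>. (U, \<phi>) \<in> atlas M \<and> (U', \<psi>) \<in> atlas N}\<rparr>"

definition real_line :: "(real, real) mfd" where
  "real_line = \<lparr>mtop = euclideanreal, model = UNIV, atlas = {(UNIV, id)}\<rparr>"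

definition simply_connected_space :: "'p topology \<Rightarrow> bool" where
  "simply_connected_space T \<longleftrightarrow>
     path_connected_space T \<and>
     (\<forall>p. pathin T p \<and> p 0 = p 1 \<longrightarrow>
        homotopic_with (\<lambda>h. h 0 = h 1) (top_of_set {0..1}) T p (\<lambda>_. p 0))"

text \<open>
  A tangent vector at \<open>p\<close> is the directional derivative \<open>f \<mapsto> (f \<circ> c)'(0)\<close> along a smooth curve \<open>c\<close>
  with \<open>c 0 = p\<close>, acting on the real functions \<open>f\<close> that are smooth near \<open>p\<close>.  It is set to
  zero on all other functions, so that equality of tangent vectors is equality of HOL functions and
  the vector space operations are pointwise.
\<close>

definition smooth_near :: "('p, 'e::euclidean_space) mfd \<Rightarrow> 'p \<Rightarrow> ('p \<Rightarrow> real) \<Rightarrow> bool" where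
  "smooth_near M p f \<longleftrightarrow> (\<exists>W. p \<in> W \<and> smooth_map_on M real_line W f)"

definition velocity :: "('p, 'e::euclidean_space) mfd \<Rightarrow> (real \<Rightarrow> 'p) \<Rightarrow> ('p \<Rightarrow> real) \<Rightarrow> real" where
  "velocity M c f = (if smooth_near M (c 0) f then deriv (\<lambda>t. f (c t)) 0 else 0)"

definition tangent_space :: "('p, 'e::euclidean_space) mfd \<Rightarrow> 'p \<Rightarrow> (('p \<Rightarrow> real) \<Rightarrow> real) set" where
  "tangent_space M p =
     {velocity M c |c. c 0 = p \<and> (\<exists>\<epsilon>>0. smooth_map_on real_line M {-\<epsilon><..<\<epsilon>} c)}"

definition pushforward ::
    "('r, 'f::euclidean_space) mfd \<Rightarrow> ('p \<Rightarrow> 'r) \<Rightarrow> 'p \<Rightarrow> (('p \<Rightarrow> real) \<Rightarrow> real) \<Rightarrow> ('r \<Rightarrow> real) \<Rightarrow> real" where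
  "pushforward N F p v f = (if smooth_near N (F p) f then v (f \<circ> F) else 0)"

definition immersion ::
    "('p, 'e::euclidean_space) mfd \<Rightarrow> ('r, 'f::euclidean_space) mfd \<Rightarrow> ('p \<Rightarrow> 'r) \<Rightarrow> bool" where
  "immersion M N F \<longleftrightarrow>
     smooth_map M N F \<and> (\<forall>p\<in>topspace (mtop M). inj_on (pushforward N F p) (tangent_space M p))"


section \<open>Lie groups\<close>

definition lie_group :: "'g monoid \<Rightarrow> ('g, 'e::euclidean_space) mfd \<Rightarrow> bool" where
  "lie_group G M \<longleftrightarrow>
     group G \<and> smooth_manifold M \<and> topspace (mtop M) = carrier G \<and>
     smooth_map (prod_mfd M M) M (\<lambda>(x, y). x \<otimes>\<^bsub>G\<^esub> y) \<and>
     smooth_map M M (\<lambda>x. inv\<^bsub>G\<^esub> x)"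

text \<open>
  A tangent vector \<open>v\<close> at the identity extends to the left-invariant vector field
  \<open>f \<mapsto> (x \<mapsto> v (y \<mapsto> f (x y)))\<close>; the bracket is the commutator of these fields, evaluated at the identity.
\<close>

definition left_inv_field ::
    "'g monoid \<Rightarrow> (('g \<Rightarrow> real) \<Rightarrow> real) \<Rightarrow> ('g \<Rightarrow> real) \<Rightarrow> 'g \<Rightarrow> real" where
  "left_inv_field G v f = (\<lambda>x. v (\<lambda>y. f (x \<otimes>\<^bsub>G\<^esub> y)))"

definition lie_group_bracket ::
    "'g monoid \<Rightarrow> ('g, 'e::euclidean_space) mfd \<Rightarrow>
     (('g \<Rightarrow> real) \<Rightarrow> real) \<Rightarrow> (('g \<Rightarrow> real) \<Rightarrow> real) \<Rightarrow> ('g \<Rightarrow> real) \<Rightarrow> real" where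
  "lie_group_bracket G M v w f =
     (if smooth_near M \<one>\<^bsub>G\<^esub> f
      then v (left_inv_field G w f) - w (left_inv_field G v f) else 0)"

text \<open>\<open>\<theta>\<close> is an isomorphism of the Lie algebra \<open>\<gg>\<close> with the Lie algebra of the Lie group.\<close>

definition lie_algebra_of_group ::
    "('a::euclidean_space \<Rightarrow> 'a \<Rightarrow> 'a) \<Rightarrow> 'a set \<Rightarrow> 'g monoid \<Rightarrow> ('g, 'e::euclidean_space) mfd \<Rightarrow>
     ('a \<Rightarrow> ('g \<Rightarrow> real) \<Rightarrow> real) \<Rightarrow> bool" where
  "lie_algebra_of_group br \<gg> G M \<theta> \<longleftrightarrow>
     bij_betw \<theta> \<gg> (tangent_space M \<one>\<^bsub>G\<^esub>) \<and>
     (\<forall>f. linear_within \<gg> (\<lambda>x. \<theta> x f)) \<and>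
     (\<forall>x\<in>\<gg>. \<forall>y\<in>\<gg>. \<theta> (br x y) = lie_group_bracket G M (\<theta> x) (\<theta> y))"

text \<open>
  The (immersed) Lie subgroup \<open>H\<close> of \<open>G\<close>, with its own manifold structure \<open>N\<close>, has Lie algebra
  \<open>\<hh> \<subseteq> \<gg>\<close>: the differential of the inclusion at the identity has image \<open>\<theta> \<hh>\<close>.
\<close>

definition lie_subgroup ::
    "'g monoid \<Rightarrow> ('g, 'e::euclidean_space) mfd \<Rightarrow> 'g set \<Rightarrow> ('g, 'f::euclidean_space) mfd \<Rightarrow> bool" where
  "lie_subgroup G M H N \<longleftrightarrow>
     subgroup H G \<and> lie_group (G\<lparr>carrier := H\<rparr>) N \<and> immersion N M (\<lambda>x. x)"

definition has_lie_algebra ::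
    "'g monoid \<Rightarrow> ('g, 'e::euclidean_space) mfd \<Rightarrow> ('a \<Rightarrow> ('g \<Rightarrow> real) \<Rightarrow> real) \<Rightarrow>
     ('g, 'f::euclidean_space) mfd \<Rightarrow> 'a set \<Rightarrow> bool" where
  "has_lie_algebra G M \<theta> N \<hh> \<longleftrightarrow>
     pushforward M (\<lambda>x. x) \<one>\<^bsub>G\<^esub> ` tangent_space N \<one>\<^bsub>G\<^esub> = \<theta> ` \<hh>"


section \<open>Function algebras on groups\<close>

text \<open>Functions on a subset \<open>X\<close> of a type are taken to be \<open>undefined\<close> outside \<open>X\<close>.\<close>

definition Fun_space :: "'x set \<Rightarrow> ('x \<Rightarrow> complex) set" where
  "Fun_space X = X \<rightarrow>\<^sub>E UNIV"

definition fadd :: "'x set \<Rightarrow> ('x \<Rightarrow> complex) \<Rightarrow> ('x \<Rightarrow> complex) \<Rightarrow> 'x \<Rightarrow> complex" where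
  "fadd X u v = (\<lambda>x\<in>X. u x + v x)"

definition fscale :: "'x set \<Rightarrow> complex \<Rightarrow> ('x \<Rightarrow> complex) \<Rightarrow> 'x \<Rightarrow> complex" where
  "fscale X c u = (\<lambda>x\<in>X. c * u x)"

definition fun_subspace :: "'x set \<Rightarrow> ('x \<Rightarrow> complex) set \<Rightarrow> bool" where
  "fun_subspace X H \<longleftrightarrow>
     H \<subseteq> Fun_space X \<and> (\<lambda>x\<in>X. 0) \<in> H \<and>
     (\<forall>u\<in>H. \<forall>v\<in>H. fadd X u v \<in> H) \<and> (\<forall>c. \<forall>u\<in>H. fscale X c u \<in> H)"

definition associative_algebra_on ::
    "'x set \<Rightarrow> ('x \<Rightarrow> complex) set \<Rightarrow> (('x \<Rightarrow> complex) \<Rightarrow> ('x \<Rightarrow> complex) \<Rightarrow> 'x \<Rightarrow> complex) \<Rightarrow> bool" where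
  "associative_algebra_on X H star \<longleftrightarrow>
     fun_subspace X H \<and>
     (\<forall>u\<in>H. \<forall>v\<in>H. star u v \<in> H) \<and>
     (\<forall>u\<in>H. \<forall>v\<in>H. \<forall>w\<in>H. star (fadd X u v) w = fadd X (star u w) (star v w) \<and>
        star w (fadd X u v) = fadd X (star w u) (star w v)) \<and>
     (\<forall>c. \<forall>u\<in>H. \<forall>v\<in>H. star (fscale X c u) v = fscale X c (star u v) \<and>
        star u (fscale X c v) = fscale X c (star u v)) \<and>
     (\<forall>u\<in>H. \<forall>v\<in>H. \<forall>w\<in>H. star (star u v) w = star u (star v w))"

definition left_translate :: "'g monoid \<Rightarrow> 'g \<Rightarrow> ('g \<Rightarrow> complex) \<Rightarrow> 'g \<Rightarrow> complex" where
  "left_translate G g u = (\<lambda>x\<in>carrier G. u (g \<otimes>\<^bsub>G\<^esub> x))"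

definition left_regular_invariant :: "'g monoid \<Rightarrow> ('g \<Rightarrow> complex) set \<Rightarrow> bool" where
  "left_regular_invariant G H \<longleftrightarrow>
     fun_subspace (carrier G) H \<and> (\<forall>g\<in>carrier G. \<forall>u\<in>H. left_translate G g u \<in> H)"

definition left_invariant_product ::
    "'g monoid \<Rightarrow> ('g \<Rightarrow> complex) set \<Rightarrow> (('g \<Rightarrow> complex) \<Rightarrow> ('g \<Rightarrow> complex) \<Rightarrow> 'g \<Rightarrow> complex) \<Rightarrow> bool" where
  "left_invariant_product G H star \<longleftrightarrow>
     (\<forall>g\<in>carrier G. \<forall>u\<in>H. \<forall>v\<in>H.
        star (left_translate G g u) (left_translate G g v) = left_translate G g (star u v))"

text \<open>The function \<open>u (q, \<cdot>)\<close> on \<open>S\<close>, where \<open>u (q, s) = u (q s)\<close>.\<close>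

definition slice :: "'g monoid \<Rightarrow> 'g set \<Rightarrow> ('g \<Rightarrow> complex) \<Rightarrow> 'g \<Rightarrow> 'g \<Rightarrow> complex" where
  "slice G S u q = (\<lambda>s\<in>S. u (q \<otimes>\<^bsub>G\<^esub> s))"

definition extended_space ::
    "'g monoid \<Rightarrow> 'g set \<Rightarrow> 'g set \<Rightarrow> ('g \<Rightarrow> complex) set \<Rightarrow> ('g \<Rightarrow> complex) set" where
  "extended_space G Q S HS = {u \<in> Fun_space (carrier G). \<forall>q\<in>Q. slice G S u q \<in> HS}"

definition extended_star ::
    "'g monoid \<Rightarrow> 'g set \<Rightarrow> 'g set \<Rightarrow> (('g \<Rightarrow> complex) \<Rightarrow> ('g \<Rightarrow> complex) \<Rightarrow> 'g \<Rightarrow> complex) \<Rightarrow>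
     ('g \<Rightarrow> complex) \<Rightarrow> ('g \<Rightarrow> complex) \<Rightarrow> 'g \<Rightarrow> complex" where
  "extended_star G Q S starS u v =
     (\<lambda>x\<in>carrier G. let (q, s) = the_inv_into (Q \<times> S) (\<lambda>(q, s). q \<otimes>\<^bsub>G\<^esub> s) x
        in starS (slice G S u q) (slice G S v q) s)"

end

theory Submission
  imports Defs
begin

text \<open>
  Write an element of \<open>G\<close> as \<open>q\<^sub>0 s\<^sub>0\<close> with \<open>q\<^sub>0 \<in> Q\<close> and \<open>s\<^sub>0 \<in> S\<close>.  Since
  \<open>q\<^sub>0 s\<^sub>0 q s = q\<^sub>0 (s\<^sub>0 q s\<^sub>0\<^sup>-\<^sup>1) s\<^sub>0 s\<close>, the translate of \<open>u\<close> by \<open>q\<^sub>0 s\<^sub>0\<close> has as its slice at \<open>q\<close> the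
  \<open>s\<^sub>0\<close>-translate of the slice of \<open>u\<close> at \<open>q\<^sub>0 (s\<^sub>0 q s\<^sub>0\<^sup>-\<^sup>1)\<close> (\<open>slice_left_translate\<close>).  Hence everything
  that is claimed on \<open>G\<close> can be read off slice by slice from the corresponding property on \<open>S\<close>,
  as soon as \<open>s Q s\<^sup>-\<^sup>1 \<subseteq> Q\<close> for all \<open>s \<in> S\<close>.

  That \<open>S\<close> normalizes \<open>Q\<close> is the infinitesimal fact that \<open>\<qq>\<close> is an ideal, integrated to the groups.
  The integration uses neither the exponential map nor the adjoint representation.  Let \<open>\<pi>\<close> be the projection of
  \<open>G = Q S\<close> to \<open>S\<close>, which identifies \<open>S\<close> with the space of cosets \<open>Q g\<close>; the group \<open>G\<close> acts on \<open>S\<close> from the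
  right by \<open>s \<cdot> g = \<pi> (s g)\<close>.  In a chart of \<open>S\<close> at the identity every \<open>X \<in> \<gg>\<close> induces a vector field \<open>V\<^sub>X\<close>,
  and the commutator of left-invariant fields on \<open>G\<close> becomes
  \<open>V\<^bsub>[Y,X]\<^esub> = DV\<^sub>X (V\<^sub>Y) - DV\<^sub>Y (V\<^sub>X)\<close> (\<open>field_bracket\<close>).

  For \<open>X \<in> \<qq>\<close> the field \<open>V\<^sub>X\<close> vanishes at the identity, because \<open>Q\<close> fixes the trivial coset
  (\<open>field_zero_at_base\<close>).  The fields of \<open>\<ss>\<close> span all directions, so along a segment of velocity \<open>v = V\<^sub>Y\<close>
  the bracket formula reads \<open>DV\<^sub>X (v) = V\<^bsub>[Y,X]\<^esub> + DV\<^sub>Y (V\<^sub>X)\<close> with \<open>[Y,X] \<in> \<qq>\<close>: a homogeneous linear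
  system for the fields of \<open>\<qq>\<close>.  Gronwall's inequality shows that they vanish near the identity
  (\<open>action_fields_vanish_on_segment\<close>, \<open>field_vanishes_near_base\<close>).  Consequently \<open>\<pi> (s q) = s\<close>, that is
  \<open>s q s\<^sup>-\<^sup>1 \<in> Q\<close>, for \<open>s\<close> and \<open>q\<close> close to the identity (\<open>conjugation_near_identity\<close>).  Connected groups are
  generated by any neighbourhood of the identity, which removes the restriction on \<open>s\<close> and \<open>q\<close>
  (\<open>conjugation_preserves_Q\<close>).
\<close>

section \<open>Higher differentiability on open subsets of a linear subspace\<close>

lemma subspace_orthonormal_expansion:
  fixes V :: "'a::euclidean_space set"
  assumes "subspace V"
  obtains B where "finite B" "B \<subseteq> V" "\<And>b. b \<in> B \<Longrightarrow> norm b = 1"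
    "\<And>x. x \<in> V \<Longrightarrow> (\<Sum>b\<in>B. (x \<bullet> b) *\<^sub>R b) = x"
proof -
  obtain B where B: "B \<subseteq> V" "pairwise orthogonal B" "\<And>x. x \<in> B \<Longrightarrow> norm x = 1"
      "independent B" "card B = dim V" "span B = V"
    using orthonormal_basis_subspace[OF assms] by metis
  then have "finite B" using independent_imp_finite by blast
  then show ?thesis
    using that[of B] B orthonormal_basis_expand[of B] by auto
qed

lemma line_in_openin:
  fixes V :: "'e::euclidean_space set"
  assumes "subspace V" "openin (top_of_set V) U" "x \<in> U" "v \<in> V"
  shows "\<forall>\<^sub>F t in nhds (0::real). x + t *\<^sub>R v \<in> U"
proof -
  obtain T where T: "open T" "U = V \<inter> T" using assms(2) openin_open by blast
  have "continuous_on UNIV (\<lambda>t::real. x + t *\<^sub>R v)" by (intro continuous_intros)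
  then have "open ((\<lambda>t::real. x + t *\<^sub>R v) -` T)" using T(1) by (simp add: open_vimage)
  moreover have "0 \<in> ((\<lambda>t::real. x + t *\<^sub>R v) -` T)" using assms T by auto
  ultimately have "\<forall>\<^sub>F t in nhds (0::real). x + t *\<^sub>R v \<in> T"
    by (auto simp: eventually_nhds)
  moreover have "x + t *\<^sub>R v \<in> V" for t
    using assms T by (auto intro!: subspace_add subspace_scale)
  ultimately show ?thesis using T by auto
qed

lemma derivative_along_line:
  fixes V :: "'e::euclidean_space set" and f :: "'e \<Rightarrow> 'f::real_normed_vector"
  assumes "subspace V" "openin (top_of_set V) U" "x \<in> U" "v \<in> V"
    and f: "(f has_derivative f') (at x within U)"
  shows "((\<lambda>t. f (x + t *\<^sub>R v)) has_vector_derivative f' v) (at 0)"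
proof -
  obtain T where T: "open T" "0 \<in> T" "\<And>t::real. t \<in> T \<Longrightarrow> x + t *\<^sub>R v \<in> U"
    using line_in_openin[OF assms(1-4)] by (auto simp: eventually_nhds)
  have 1: "((\<lambda>t::real. x + t *\<^sub>R v) has_derivative (\<lambda>t. t *\<^sub>R v)) (at 0 within T)"
    by (auto intro!: derivative_eq_intros)
  have "((\<lambda>t. f (x + t *\<^sub>R v)) has_derivative (\<lambda>t. f' (t *\<^sub>R v))) (at 0 within T)"
    using has_derivative_in_compose[OF 1, of f f'] f T(3)
    by (simp add: has_derivative_subset image_subset_iff)
  then have "((\<lambda>t. f (x + t *\<^sub>R v)) has_derivative (\<lambda>t. f' (t *\<^sub>R v))) (at 0)"
    using at_within_open[OF T(2,1)] by simp
  moreover have "f' (t *\<^sub>R v) = t *\<^sub>R f' v" for t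
    using has_derivative_bounded_linear[OF f] by (simp add: linear_simps)
  ultimately show ?thesis by (simp add: has_vector_derivative_def)
qed

text \<open>
  A derivative within a relatively open subset of \<open>V\<close> is determined on \<open>V\<close>, although it is a linear
  map on the whole ambient space.
\<close>

lemma directional_derivative_unique:
  fixes V :: "'e::euclidean_space set" and f :: "'e \<Rightarrow> 'f::real_normed_vector"
  assumes "subspace V" "openin (top_of_set V) U" "openin (top_of_set V) U'" "x \<in> U" "x \<in> U'" "v \<in> V"
    and "(f has_derivative f') (at x within U)" "(f has_derivative f'') (at x within U')"
  shows "f' v = f'' v"
  by (rule vector_derivative_unique_at[OF derivative_along_line[OF assms(1,2,4,6,7)]
        derivative_along_line[OF assms(1,3,5,6,8)]])

lemma vector_derivative_in_subspace:
  fixes W :: "'f::euclidean_space set"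
  assumes "subspace W" "(h has_vector_derivative d) (at (0::real))" "\<forall>\<^sub>F t in nhds 0. h t \<in> W"
  shows "d \<in> W"
proof (rule Lim_in_closed_set[of W])
  show "closed W" using assms(1) by (rule closed_subspace)
  have h0: "h 0 \<in> W" using eventually_nhds_x_imp_x[OF assms(3)] .
  have "\<forall>\<^sub>F t in at 0. h t \<in> W" using assms(3) by (simp add: eventually_nhds_conv_at)
  then show "\<forall>\<^sub>F t in at 0. (h t - h 0) /\<^sub>R t \<in> W"
    by (rule eventually_mono) (use assms(1) h0 in \<open>auto intro!: subspace_scale subspace_diff\<close>)
  have "(\<lambda>t. norm (h t - h 0 - t *\<^sub>R d) / \<bar>t\<bar>) \<midarrow>0\<rightarrow> 0"
    using assms(2) by (simp add: has_vector_derivative_def has_derivative_iff_norm)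
  moreover have "norm (h t - h 0 - t *\<^sub>R d) / \<bar>t\<bar> = norm ((h t - h 0) /\<^sub>R t - d)" if "t \<noteq> 0" for t
  proof -
    have "(h t - h 0) /\<^sub>R t - d = (h t - h 0 - t *\<^sub>R d) /\<^sub>R t"
      using that by (simp add: scaleR_diff_right)
    then show ?thesis by (simp add: divide_inverse_commute)
  qed
  ultimately have "(\<lambda>t. norm ((h t - h 0) /\<^sub>R t - d)) \<midarrow>0\<rightarrow> 0"
    by (simp cong: LIM_cong)
  then show "((\<lambda>t. (h t - h 0) /\<^sub>R t) \<longlongrightarrow> d) (at 0)"
    by (simp add: LIM_zero_cancel tendsto_norm_zero_iff)
qed simp

text \<open>
  The values of the derivative in the directions of \<open>V\<close> are limits of difference quotients, which
  lie in the closed set \<open>W\<close>.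
\<close>

lemma derivative_in_subspace:
  fixes V :: "'e::euclidean_space set" and W :: "'f::euclidean_space set"
  assumes "subspace V" "openin (top_of_set V) U" "x \<in> U" "v \<in> V"
    and "(f has_derivative f') (at x within U)" "subspace W" "f ` U \<subseteq> W"
  shows "f' v \<in> W"
proof (rule vector_derivative_in_subspace[OF assms(6) derivative_along_line[OF assms(1-5)]])
  show "\<forall>\<^sub>F t in nhds 0. f (x + t *\<^sub>R v) \<in> W"
    using line_in_openin[OF assms(1-4)] by (rule eventually_mono) (use assms(7) in auto)
qed

lemma Ck_on_subset: "Ck_on k V U f \<Longrightarrow> U' \<subseteq> U \<Longrightarrow> Ck_on k V U' f"
proof (induction k arbitrary: f)
  case 0
  then show ?case using continuous_on_subset by auto
next
  case (Suc k)
  then obtain f' where "\<forall>x\<in>U. (f has_derivative f' x) (at x within U)" "\<forall>v\<in>V. Ck_on k V U (\<lambda>x. f' x v)"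
    by auto
  then show ?case using Suc.IH Suc.prems(2)
    by (auto intro!: exI[of _ f'] intro: has_derivative_subset)
qed

lemma Ck_on_cong:
  assumes "Ck_on k V U f" "\<And>x. x \<in> U \<Longrightarrow> g x = f x"
  shows "Ck_on k V U g"
proof (cases k)
  case 0
  then show ?thesis using assms continuous_on_cong by (metis Ck_on.simps(1))
next
  case (Suc n)
  then obtain f' where f': "\<forall>x\<in>U. (f has_derivative f' x) (at x within U)" "\<forall>v\<in>V. Ck_on n V U (\<lambda>x. f' x v)"
    using assms by auto
  have "(g has_derivative f' x) (at x within U)" if "x \<in> U" for x
    by (rule has_derivative_transform[OF that, where f=f]) (use assms(2) that f' in auto)
  then show ?thesis using f' Suc by auto
qed

lemma Ck_on_mono_order: "Ck_on (Suc k) V U f \<Longrightarrow> Ck_on k V U f"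
proof (induction k arbitrary: f)
  case 0
  then show ?case
    by (auto simp: continuous_on_eq_continuous_within intro: has_derivative_continuous)
next
  case (Suc k)
  from Suc.prems obtain f' where "\<forall>x\<in>U. (f has_derivative f' x) (at x within U)"
      "\<forall>v\<in>V. Ck_on (Suc k) V U (\<lambda>x. f' x v)"
    by (subst (asm) Ck_on.simps(2)) blast
  then show ?case using Suc.IH by auto
qed

lemma Ck_on_const: "Ck_on k V U (\<lambda>x. c)"
proof (induction k arbitrary: c)
  case (Suc k)
  then show ?case by (auto intro!: exI[of _ "\<lambda>x v. 0"])
qed (auto)

lemma Ck_on_add: "Ck_on k V U f \<Longrightarrow> Ck_on k V U g \<Longrightarrow> Ck_on k V U (\<lambda>x. f x + g x)"
proof (induction k arbitrary: f g)
  case 0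
  then show ?case by (auto intro!: continuous_intros)
next
  case (Suc k)
  from Suc.prems obtain f' g' where "\<forall>x\<in>U. (f has_derivative f' x) (at x within U)" "\<forall>v\<in>V. Ck_on k V U (\<lambda>x. f' x v)"
    "\<forall>x\<in>U. (g has_derivative g' x) (at x within U)" "\<forall>v\<in>V. Ck_on k V U (\<lambda>x. g' x v)"
    by (auto simp: Ck_on.simps(2))
  then show ?case using Suc.IH
    by (auto intro!: exI[of _ "\<lambda>x v. f' x v + g' x v"] has_derivative_add)
qed

lemma Ck_on_sum: "(\<And>i. i \<in> I \<Longrightarrow> Ck_on k V U (f i)) \<Longrightarrow> Ck_on k V U (\<lambda>x. \<Sum>i\<in>I. f i x)"
  by (induction I rule: infinite_finite_induct) (auto intro: Ck_on_add Ck_on_const)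

lemma Ck_on_scaleR:
  fixes f :: "'e::euclidean_space \<Rightarrow> real"
  shows "Ck_on k V U f \<Longrightarrow> Ck_on k V U g \<Longrightarrow> Ck_on k V U (\<lambda>x. f x *\<^sub>R g x)"
proof (induction k arbitrary: f g)
  case 0
  then show ?case by (auto intro!: continuous_intros)
next
  case (Suc k)
  from Suc.prems obtain f' g' where "\<forall>x\<in>U. (f has_derivative f' x) (at x within U)" "\<forall>v\<in>V. Ck_on k V U (\<lambda>x. f' x v)"
    "\<forall>x\<in>U. (g has_derivative g' x) (at x within U)" "\<forall>v\<in>V. Ck_on k V U (\<lambda>x. g' x v)"
    by (auto simp: Ck_on.simps(2))
  moreover have "Ck_on k V U f" "Ck_on k V U g" using Suc.prems Ck_on_mono_order by blast+
  ultimately show ?case using Suc.IH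
    by (auto intro!: exI[of _ "\<lambda>x v. f x *\<^sub>R g' x v + f' x v *\<^sub>R g x"] has_derivative_scaleR Ck_on_add)
qed

lemma Ck_on_linear_after:
  assumes "bounded_linear L"
  shows "Ck_on k V U f \<Longrightarrow> Ck_on k V U (\<lambda>x. L (f x))"
proof (induction k arbitrary: f)
  case 0
  then show ?case using bounded_linear.continuous_on[OF assms] by auto
next
  case (Suc k)
  then obtain f' where "\<forall>x\<in>U. (f has_derivative f' x) (at x within U)" "\<forall>v\<in>V. Ck_on k V U (\<lambda>x. f' x v)"
    by auto
  then show ?case using Suc.IH
    by (auto intro!: exI[of _ "\<lambda>x v. L (f' x v)"] bounded_linear.has_derivative[OF assms])
qed

lemma Ck_on_Pair: "Ck_on k V U f \<Longrightarrow> Ck_on k V U g \<Longrightarrow> Ck_on k V U (\<lambda>x. (f x, g x))"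
proof (induction k arbitrary: f g)
  case 0
  then show ?case by (auto intro!: continuous_intros)
next
  case (Suc k)
  from Suc.prems obtain f' g' where "\<forall>x\<in>U. (f has_derivative f' x) (at x within U)" "\<forall>v\<in>V. Ck_on k V U (\<lambda>x. f' x v)"
    "\<forall>x\<in>U. (g has_derivative g' x) (at x within U)" "\<forall>v\<in>V. Ck_on k V U (\<lambda>x. g' x v)"
    by (auto simp: Ck_on.simps(2))
  then show ?case using Suc.IH
    by (auto intro!: exI[of _ "\<lambda>x v. (f' x v, g' x v)"] has_derivative_Pair)
qed

lemma Ck_on_id: "Ck_on k V U (\<lambda>x. x)"
proof (cases k)
  case (Suc n)
  then show ?thesis by (auto intro!: exI[of _ "\<lambda>x v. v"] Ck_on_const)
qed auto

text \<open>
  The chain rule gives the derivative \<open>g' (f x) (f' x v)\<close>, in which the argument of \<open>g'\<close> varies with \<open>x\<close>.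
  Since \<open>f' x v\<close> lies in \<open>W\<close>, it is a combination of fixed vectors of an orthonormal basis of \<open>W\<close> with
  \<open>C\<^sup>k\<close> coefficients, and the induction hypothesis applies to \<open>g'\<close> in each of these fixed directions.
\<close>

lemma Ck_on_compose:
  fixes f :: "'e::euclidean_space \<Rightarrow> 'f::euclidean_space" and g :: "'f \<Rightarrow> 'g::real_normed_vector"
  assumes V: "subspace V" "openin (top_of_set V) U" and W: "subspace W" "U' \<subseteq> W" "f ` U \<subseteq> U'"
  shows "Ck_on k W U' g \<Longrightarrow> Ck_on k V U f \<Longrightarrow> Ck_on k V U (\<lambda>x. g (f x))"
proof (induction k arbitrary: g)
  case 0
  then show ?case using W continuous_on_compose2 by (metis Ck_on.simps(1))
next
  case (Suc k)
  obtain f' where f': "\<And>x. x\<in>U \<Longrightarrow> (f has_derivative f' x) (at x within U)"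
      "\<And>v. v\<in>V \<Longrightarrow> Ck_on k V U (\<lambda>x. f' x v)"
    using Suc.prems(2) by (auto simp: Ck_on.simps(2))
  obtain g' where g': "\<And>x. x\<in>U' \<Longrightarrow> (g has_derivative g' x) (at x within U')"
      "\<And>v. v\<in>W \<Longrightarrow> Ck_on k W U' (\<lambda>x. g' x v)"
    using Suc.prems(1) by (auto simp: Ck_on.simps(2))
  obtain B where B: "finite B" "B \<subseteq> W" "\<And>x. x \<in> W \<Longrightarrow> (\<Sum>b\<in>B. (x \<bullet> b) *\<^sub>R b) = x"
    using subspace_orthonormal_expansion[OF W(1)] by metis
  have fk: "Ck_on k V U f" using Suc.prems(2) by (rule Ck_on_mono_order)
  have der: "((\<lambda>x. g (f x)) has_derivative (\<lambda>v. g' (f x) (f' x v))) (at x within U)" if "x \<in> U" for x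
    using has_derivative_in_compose2[of U' g g', OF g'(1) W(3) that f'(1)[OF that]] .
  have "Ck_on k V U (\<lambda>x. g' (f x) (f' x v))" if v: "v \<in> V" for v
  proof (rule Ck_on_cong)
    show "Ck_on k V U (\<lambda>x. \<Sum>b\<in>B. (f' x v \<bullet> b) *\<^sub>R g' (f x) b)"
    proof (intro Ck_on_sum Ck_on_scaleR)
      fix b assume b: "b \<in> B"
      show "Ck_on k V U (\<lambda>x. f' x v \<bullet> b)"
        using Ck_on_linear_after[OF bounded_linear_inner_left f'(2)[OF v]] .
      show "Ck_on k V U (\<lambda>x. g' (f x) b)"
        using Suc.IH[OF g'(2) fk] b B(2) by blast
    qed
    fix x assume x: "x \<in> U"
    have "f' x v \<in> W"
      using derivative_in_subspace[OF V x v f'(1)[OF x] W(1)] W by blast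
    then have e: "f' x v = (\<Sum>b\<in>B. (f' x v \<bullet> b) *\<^sub>R b)"
      using B(3) by simp
    have lin: "linear (g' (f x))"
      using g'(1)[of "f x"] W(3) x has_derivative_linear by blast
    have "g' (f x) (f' x v) = g' (f x) (\<Sum>b\<in>B. (f' x v \<bullet> b) *\<^sub>R b)" using e by simp
    also have "\<dots> = (\<Sum>b\<in>B. (f' x v \<bullet> b) *\<^sub>R g' (f x) b)"
      by (simp add: linear_sum[OF lin] linear_scale[OF lin])
    finally show "g' (f x) (f' x v) = (\<Sum>b\<in>B. (f' x v \<bullet> b) *\<^sub>R g' (f x) b)" .
  qed
  then show ?case using der
    by (auto intro!: exI[of _ "\<lambda>x v. g' (f x) (f' x v)"])
qed

lemma smooth_on_subset: "smooth_on V U f \<Longrightarrow> U' \<subseteq> U \<Longrightarrow> smooth_on V U' f"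
  unfolding smooth_on_def using Ck_on_subset by blast

lemma smooth_on_cong: "smooth_on V U f \<Longrightarrow> (\<And>x. x \<in> U \<Longrightarrow> g x = f x) \<Longrightarrow> smooth_on V U g"
  unfolding smooth_on_def using Ck_on_cong by blast

lemma smooth_on_compose:
  fixes f :: "'e::euclidean_space \<Rightarrow> 'f::euclidean_space" and g :: "'f \<Rightarrow> 'g::real_normed_vector"
  assumes "subspace V" "openin (top_of_set V) U" "subspace W" "U' \<subseteq> W" "f ` U \<subseteq> U'"
    "smooth_on W U' g" "smooth_on V U f"
  shows "smooth_on V U (\<lambda>x. g (f x))"
  using assms Ck_on_compose[OF assms(1-5)] unfolding smooth_on_def by blast

lemma smooth_on_continuous: "smooth_on V U f \<Longrightarrow> continuous_on U f"
  unfolding smooth_on_def by (metis Ck_on.simps(1))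

text \<open>The derivatives provided by the successive orders of differentiability may differ, but
  only in directions transverse to the model space.\<close>

lemma smooth_on_derivative:
  fixes f :: "'e::euclidean_space \<Rightarrow> 'f::real_normed_vector"
  assumes "subspace V" "openin (top_of_set V) U" "smooth_on V U f"
  obtains f' where "\<And>x. x \<in> U \<Longrightarrow> (f has_derivative f' x) (at x within U)"
    "\<And>v. v \<in> V \<Longrightarrow> smooth_on V U (\<lambda>x. f' x v)"
proof -
  have "Ck_on (Suc 0) V U f" using assms(3) smooth_on_def by blast
  then obtain f' where f': "\<And>x. x \<in> U \<Longrightarrow> (f has_derivative f' x) (at x within U)"
    by auto
  have "Ck_on k V U (\<lambda>x. f' x v)" if v: "v \<in> V" for v k
  proof -
    have "Ck_on (Suc k) V U f" using assms(3) smooth_on_def by blast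
    then obtain f2 where f2: "\<And>x. x \<in> U \<Longrightarrow> (f has_derivative f2 x) (at x within U)"
        "Ck_on k V U (\<lambda>x. f2 x v)"
      using v by auto
    show ?thesis
      using directional_derivative_unique[OF assms(1,2,2)] f2 f' v
      by (intro Ck_on_cong[OF f2(2)]) blast
  qed
  then show ?thesis using that f' unfolding smooth_on_def by blast
qed

section \<open>Germs of smooth functions\<close>

text \<open>
  Smoothness of the germ of \<open>f\<close> at \<open>p\<close>.  Working with germs makes it possible to compose maps
  without tracking the domains on which each of them is expressed in charts.
\<close>

definition smooth_at :: "'e::euclidean_space set \<Rightarrow> 'e \<Rightarrow> ('e \<Rightarrow> 'f::real_normed_vector) \<Rightarrow> bool" where
  "smooth_at E p f \<longleftrightarrow> (\<exists>U. openin (top_of_set E) U \<and> p \<in> U \<and> smooth_on E U f)"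

lemma eventually_nhdsin_top_of_set:
  "p \<in> E \<Longrightarrow> eventually P (nhdsin (top_of_set E) p) \<longleftrightarrow>
     (\<exists>U. openin (top_of_set E) U \<and> p \<in> U \<and> (\<forall>x\<in>U. P x))"
  by (simp add: eventually_nhdsin)

lemma smooth_at_obtain_open:
  assumes "smooth_at E p f" "eventually P (nhdsin (top_of_set E) p)"
  obtains U where "openin (top_of_set E) U" "p \<in> U" "smooth_on E U f" "\<And>x. x \<in> U \<Longrightarrow> P x"
proof -
  obtain U where U: "openin (top_of_set E) U" "p \<in> U" "smooth_on E U f"
    using assms(1) smooth_at_def by blast
  then have "p \<in> E" using openin_imp_subset by blast
  then obtain U' where "openin (top_of_set E) U'" "p \<in> U'" "\<And>x. x \<in> U' \<Longrightarrow> P x"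
    using assms(2) eventually_nhdsin_top_of_set by metis
  then show ?thesis
    using U that[of "U \<inter> U'"] smooth_on_subset[of E U f "U \<inter> U'"] by (simp add: openin_Int)
qed

lemma smooth_at_mem: "smooth_at E p f \<Longrightarrow> p \<in> E"
  unfolding smooth_at_def using openin_imp_subset by blast

lemma smooth_at_cong:
  assumes "smooth_at E p f" "\<forall>\<^sub>F x in nhdsin (top_of_set E) p. g x = f x"
  shows "smooth_at E p g"
  using smooth_at_obtain_open[OF assms] smooth_on_cong unfolding smooth_at_def by metis

lemma smooth_at_eventually:
  fixes f :: "'e::euclidean_space \<Rightarrow> 'f::euclidean_space"
  assumes "smooth_at E p f" "\<forall>\<^sub>F x in nhdsin (top_of_set E) p. f x \<in> F"
    "\<forall>\<^sub>F y in nhdsin (top_of_set F) (f p). P y"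
  shows "\<forall>\<^sub>F x in nhdsin (top_of_set E) p. P (f x)"
proof -
  obtain U where U: "openin (top_of_set E) U" "p \<in> U" "smooth_on E U f" "\<And>x. x \<in> U \<Longrightarrow> f x \<in> F"
    using smooth_at_obtain_open[OF assms(1,2)] by metis
  then obtain O' where O: "openin (top_of_set F) O'" "f p \<in> O'" "\<And>x. x \<in> O' \<Longrightarrow> P x"
    using assms(3) by (auto simp: eventually_nhdsin_top_of_set)
  have "openin (top_of_set U) (U \<inter> f -` O')"
    using smooth_on_continuous[OF U(3)] O(1) U(4)
    by (metis continuous_openin_preimage image_subset_iff Pi_I')
  then have "openin (top_of_set E) (U \<inter> f -` O')"
    using U(1) openin_trans by blast
  then show ?thesis using U(2) O(2,3) smooth_at_mem[OF assms(1)]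
    by (auto simp: eventually_nhdsin_top_of_set intro!: exI[of _ "U \<inter> f -` O'"])
qed

lemma smooth_at_compose:
  fixes f :: "'e::euclidean_space \<Rightarrow> 'f::euclidean_space" and g :: "'f \<Rightarrow> 'g::real_normed_vector"
  assumes "subspace E" "subspace F" "smooth_at E p f" "smooth_at F (f p) g"
    "\<forall>\<^sub>F x in nhdsin (top_of_set E) p. f x \<in> F"
  shows "smooth_at E p (\<lambda>x. g (f x))"
proof -
  obtain O' where O: "openin (top_of_set F) O'" "f p \<in> O'" "smooth_on F O' g"
    using assms(4) smooth_at_def by blast
  then have "\<forall>\<^sub>F y in nhdsin (top_of_set F) (f p). y \<in> O'"
    using smooth_at_mem[OF assms(4)] eventually_nhdsin_top_of_set by metis
  then have "\<forall>\<^sub>F x in nhdsin (top_of_set E) p. f x \<in> O'"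
    using smooth_at_eventually[OF assms(3,5)] by blast
  then obtain U where U: "openin (top_of_set E) U" "p \<in> U" "smooth_on E U f" "\<And>x. x \<in> U \<Longrightarrow> f x \<in> O'"
    using smooth_at_obtain_open[OF assms(3)] by metis
  have "smooth_on E U (\<lambda>x. g (f x))"
    using smooth_on_compose[OF assms(1) U(1) assms(2) openin_imp_subset[OF O(1)] _ O(3) U(3)] U(4) by blast
  then show ?thesis unfolding smooth_at_def using U by blast
qed

lemma smooth_at_Pair:
  assumes "smooth_at E p f" "smooth_at E p g"
  shows "smooth_at E p (\<lambda>x. (f x, g x))"
proof -
  obtain U where U: "openin (top_of_set E) U" "p \<in> U" "smooth_on E U f"
    using assms(1) smooth_at_def by blast
  obtain U' where U': "openin (top_of_set E) U'" "p \<in> U'" "smooth_on E U' g"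
    using assms(2) smooth_at_def by blast
  have "smooth_on E (U \<inter> U') (\<lambda>x. (f x, g x))"
    using smooth_on_subset[OF U(3), of "U \<inter> U'"] smooth_on_subset[OF U'(3), of "U \<inter> U'"]
    by (simp add: smooth_on_def Ck_on_Pair)
  moreover have "openin (top_of_set E) (U \<inter> U')" using U(1) U'(1) by (rule openin_Int)
  ultimately show ?thesis using U(2) U'(2) unfolding smooth_at_def by blast
qed

lemma smooth_at_linear:
  assumes "bounded_linear L" "p \<in> E"
  shows "smooth_at E p L"
proof -
  have "smooth_on E E L"
    unfolding smooth_on_def using Ck_on_linear_after[OF assms(1) Ck_on_id] by blast
  then show ?thesis using assms(2) unfolding smooth_at_def by (intro exI[of _ E]) simp
qed

section \<open>Charts\<close>

record ('p, 'e) chart =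
  ctop :: "'p topology"
  cmodel :: "'e set"
  cdom :: "'p set"
  cmap :: "'p \<Rightarrow> 'e"

definition cinv :: "('p, 'e) chart \<Rightarrow> 'e \<Rightarrow> 'p" where
  "cinv C = inv_into (cdom C) (cmap C)"

text \<open>
  A homeomorphism from an open set onto a relatively open subset of the model space, stated through
  images and preimages of open sets, which is the form in which it is inherited by products.
\<close>

definition is_chart :: "('p, 'e::euclidean_space) chart \<Rightarrow> bool" where
  "is_chart C \<longleftrightarrow> subspace (cmodel C) \<and> openin (ctop C) (cdom C) \<and> inj_on (cmap C) (cdom C) \<and>
     (\<forall>W. openin (ctop C) W \<and> W \<subseteq> cdom C \<longrightarrow> openin (top_of_set (cmodel C)) (cmap C ` W)) \<and>
     (\<forall>V. openin (top_of_set (cmodel C)) V \<longrightarrow> openin (ctop C) {p \<in> cdom C. cmap C p \<in> V})"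

lemma cinv_cmap [simp]: "is_chart C \<Longrightarrow> p \<in> cdom C \<Longrightarrow> cinv C (cmap C p) = p"
  by (simp add: is_chart_def cinv_def)

lemma cmap_cinv: "z \<in> cmap C ` cdom C \<Longrightarrow> cmap C (cinv C z) = z"
  by (simp add: cinv_def f_inv_into_f)

lemma cinv_in: "z \<in> cmap C ` cdom C \<Longrightarrow> cinv C z \<in> cdom C"
  by (simp add: cinv_def inv_into_into)

lemma chart_subspace: "is_chart C \<Longrightarrow> subspace (cmodel C)"
  by (simp add: is_chart_def)

lemma chart_image_open: "is_chart C \<Longrightarrow> openin (top_of_set (cmodel C)) (cmap C ` cdom C)"
  by (simp add: is_chart_def)

lemma cmap_in: "is_chart C \<Longrightarrow> p \<in> cdom C \<Longrightarrow> cmap C p \<in> cmodel C"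
  using openin_imp_subset[OF chart_image_open] by blast

lemma chart_dom_top: "is_chart C \<Longrightarrow> cdom C \<subseteq> topspace (ctop C)"
  unfolding is_chart_def by (simp add: openin_subset)

text \<open>A chart at \<open>p\<close> transports the neighbourhoods of \<open>p\<close> to those of its image.\<close>

lemma eventually_chart:
  assumes C: "is_chart C" and p: "p \<in> cdom C"
  shows "eventually P (nhdsin (ctop C) p) \<longleftrightarrow>
         (\<forall>\<^sub>F z in nhdsin (top_of_set (cmodel C)) (cmap C p). z \<in> cmap C ` cdom C \<and> P (cinv C z))"
    (is "_ \<longleftrightarrow> eventually ?Q _")
proof
  have pt: "p \<in> topspace (ctop C)" using chart_dom_top[OF C] p by blast
  have zt: "cmap C p \<in> cmodel C" using cmap_in[OF C p] .
  {
    assume "eventually P (nhdsin (ctop C) p)"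
    then obtain W where W: "openin (ctop C) W" "p \<in> W" "\<And>x. x \<in> W \<Longrightarrow> P x"
      using pt by (auto simp: eventually_nhdsin)
    have "openin (top_of_set (cmodel C)) (cmap C ` (cdom C \<inter> W))"
      using C W(1) by (simp add: is_chart_def openin_Int)
    moreover have "?Q z" if "z \<in> cmap C ` (cdom C \<inter> W)" for z
      using that W(3) C by auto
    ultimately show "eventually ?Q (nhdsin (top_of_set (cmodel C)) (cmap C p))"
      unfolding eventually_nhdsin_top_of_set[OF zt] using p W(2) by blast
  next
    assume "eventually ?Q (nhdsin (top_of_set (cmodel C)) (cmap C p))"
    then obtain V where V: "openin (top_of_set (cmodel C)) V" "cmap C p \<in> V" "\<And>z. z \<in> V \<Longrightarrow> ?Q z"
      unfolding eventually_nhdsin_top_of_set[OF zt] by blast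
    have "openin (ctop C) {p \<in> cdom C. cmap C p \<in> V}" using C V(1) by (simp add: is_chart_def)
    moreover have "P x" if "x \<in> {p \<in> cdom C. cmap C p \<in> V}" for x
      using V(3)[of "cmap C x"] that C by auto
    ultimately show "eventually P (nhdsin (ctop C) p)"
      unfolding eventually_nhdsin using p V(2) by (intro disjI2 exI) auto
  }
qed

lemma eventually_chart_image:
  assumes C: "is_chart C" and p: "p \<in> cdom C"
  shows "\<forall>\<^sub>F z in nhdsin (top_of_set (cmodel C)) (cmap C p). z \<in> cmap C ` cdom C"
  using eventually_chart[OF C p, of "\<lambda>_. True"] by simp

definition prodc :: "('p, 'e) chart \<Rightarrow> ('q, 'f) chart \<Rightarrow> ('p \<times> 'q, 'e \<times> 'f) chart" where
  "prodc A B = \<lparr>ctop = prod_topology (ctop A) (ctop B), cmodel = cmodel A \<times> cmodel B,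
     cdom = cdom A \<times> cdom B, cmap = map_prod (cmap A) (cmap B)\<rparr>"

lemma prodc_simps [simp]:
  "ctop (prodc A B) = prod_topology (ctop A) (ctop B)" "cmodel (prodc A B) = cmodel A \<times> cmodel B"
  "cdom (prodc A B) = cdom A \<times> cdom B" "cmap (prodc A B) = map_prod (cmap A) (cmap B)"
  by (simp_all add: prodc_def)

lemma top_of_set_Times: "top_of_set (A \<times> B) = prod_topology (top_of_set A) (top_of_set B)"
  by (simp add: subtopology_Times[symmetric] euclidean_product_topology)

lemma is_chart_prodc:
  assumes A: "is_chart A" and B: "is_chart B"
  shows "is_chart (prodc A B)"
  unfolding is_chart_def prodc_simps
proof (intro conjI allI impI)
  show "subspace (cmodel A \<times> cmodel B)" using A B by (simp add: chart_subspace subspace_Times)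
  show "openin (prod_topology (ctop A) (ctop B)) (cdom A \<times> cdom B)"
    using A B by (simp add: openin_prod_Times_iff is_chart_def)
  show "inj_on (map_prod (cmap A) (cmap B)) (cdom A \<times> cdom B)"
    using A B by (simp add: map_prod_inj_on is_chart_def)
next
  fix W assume W: "openin (prod_topology (ctop A) (ctop B)) W \<and> W \<subseteq> cdom A \<times> cdom B"
  show "openin (top_of_set (cmodel A \<times> cmodel B)) (map_prod (cmap A) (cmap B) ` W)"
    unfolding top_of_set_Times openin_prod_topology_alt
  proof (intro allI impI)
    fix x y assume "(x, y) \<in> map_prod (cmap A) (cmap B) ` W"
    then obtain a b where ab: "(a, b) \<in> W" "x = cmap A a" "y = cmap B b" by auto
    then obtain U V where UV: "openin (ctop A) U" "openin (ctop B) V" "a \<in> U" "b \<in> V" "U \<times> V \<subseteq> W"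
      using W openin_prod_topology_alt by metis
    have "U \<subseteq> cdom A" "V \<subseteq> cdom B" using UV W by blast+
    then have "openin (top_of_set (cmodel A)) (cmap A ` U)" "openin (top_of_set (cmodel B)) (cmap B ` V)"
      using A B UV by (simp_all add: is_chart_def)
    moreover have "cmap A ` U \<times> cmap B ` V \<subseteq> map_prod (cmap A) (cmap B) ` W"
      using UV(5) by (auto simp flip: map_prod_surj_on[OF refl refl])
    ultimately show "\<exists>U V. openin (top_of_set (cmodel A)) U \<and> openin (top_of_set (cmodel B)) V \<and>
        x \<in> U \<and> y \<in> V \<and> U \<times> V \<subseteq> map_prod (cmap A) (cmap B) ` W"
      using ab UV by blast
  qed
next
  fix W assume W: "openin (top_of_set (cmodel A \<times> cmodel B)) W"
  show "openin (prod_topology (ctop A) (ctop B)) {p \<in> cdom A \<times> cdom B. map_prod (cmap A) (cmap B) p \<in> W}"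
    unfolding openin_prod_topology_alt
  proof (intro allI impI)
    fix a b assume ab: "(a, b) \<in> {p \<in> cdom A \<times> cdom B. map_prod (cmap A) (cmap B) p \<in> W}"
    then have "(cmap A a, cmap B b) \<in> W" by simp
    then obtain U V where UV: "openin (top_of_set (cmodel A)) U" "openin (top_of_set (cmodel B)) V"
        "cmap A a \<in> U" "cmap B b \<in> V" "U \<times> V \<subseteq> W"
      using W unfolding top_of_set_Times openin_prod_topology_alt by metis
    have "openin (ctop A) {p \<in> cdom A. cmap A p \<in> U}" "openin (ctop B) {p \<in> cdom B. cmap B p \<in> V}"
      using A B UV by (simp_all add: is_chart_def)
    then show "\<exists>U V. openin (ctop A) U \<and> openin (ctop B) V \<and> a \<in> U \<and> b \<in> V \<and>
        U \<times> V \<subseteq> {p \<in> cdom A \<times> cdom B. map_prod (cmap A) (cmap B) p \<in> W}"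
      using ab UV by (intro exI conjI) (assumption, assumption, auto)
  qed
qed

lemma cinv_prodc:
  assumes "is_chart A" "is_chart B" "z \<in> cmap A ` cdom A" "z' \<in> cmap B ` cdom B"
  shows "cinv (prodc A B) (z, z') = (cinv A z, cinv B z')"
proof -
  have "cinv (prodc A B) (cmap (prodc A B) (cinv A z, cinv B z')) = (cinv A z, cinv B z')"
    by (rule cinv_cmap[OF is_chart_prodc]) (use assms cinv_in in auto)
  then show ?thesis using assms by (simp add: cmap_cinv)
qed

section \<open>Smooth germs\<close>

text \<open>
  The germ at \<open>p\<close> of a map that is continuous at \<open>p\<close> and smooth when expressed in the two given charts.
  Continuity at \<open>p\<close> guarantees that the expression in charts is meaningful near \<open>p\<close>.
\<close>

definition smooth_germ ::
  "('p, 'e::euclidean_space) chart \<Rightarrow> ('q, 'f::euclidean_space) chart \<Rightarrow> 'p \<Rightarrow> ('p \<Rightarrow> 'q) \<Rightarrow> bool" where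
  "smooth_germ A B p f \<longleftrightarrow> is_chart A \<and> is_chart B \<and> p \<in> cdom A \<and> f p \<in> cdom B \<and>
     (\<forall>P. eventually P (nhdsin (ctop B) (f p)) \<longrightarrow> (\<forall>\<^sub>F x in nhdsin (ctop A) p. P (f x))) \<and>
     smooth_at (cmodel A) (cmap A p) (\<lambda>z. cmap B (f (cinv A z)))"

lemma smooth_germD:
  assumes "smooth_germ A B p f"
  shows "is_chart A" "is_chart B" "p \<in> cdom A" "f p \<in> cdom B"
     "\<And>P. eventually P (nhdsin (ctop B) (f p)) \<Longrightarrow> (\<forall>\<^sub>F x in nhdsin (ctop A) p. P (f x))"
     "smooth_at (cmodel A) (cmap A p) (\<lambda>z. cmap B (f (cinv A z)))"
     "\<forall>\<^sub>F x in nhdsin (ctop A) p. f x \<in> cdom B"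
     "\<forall>\<^sub>F z in nhdsin (top_of_set (cmodel A)) (cmap A p). z \<in> cmap A ` cdom A \<and> f (cinv A z) \<in> cdom B"
     "\<forall>\<^sub>F z in nhdsin (top_of_set (cmodel A)) (cmap A p). cmap B (f (cinv A z)) \<in> cmodel B"
proof -
  show *: "is_chart A" "is_chart B" "p \<in> cdom A" "f p \<in> cdom B"
     "\<And>P. eventually P (nhdsin (ctop B) (f p)) \<Longrightarrow> (\<forall>\<^sub>F x in nhdsin (ctop A) p. P (f x))"
     "smooth_at (cmodel A) (cmap A p) (\<lambda>z. cmap B (f (cinv A z)))"
    using assms unfolding smooth_germ_def by blast+
  have "openin (ctop B) (cdom B)" using *(2) by (simp add: is_chart_def)
  then have "\<forall>\<^sub>F x in nhdsin (ctop B) (f p). x \<in> cdom B"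
    using *(4) eventually_nhdsin by fastforce
  then show 1: "\<forall>\<^sub>F x in nhdsin (ctop A) p. f x \<in> cdom B" by (rule *(5))
  show 2: "\<forall>\<^sub>F z in nhdsin (top_of_set (cmodel A)) (cmap A p). z \<in> cmap A ` cdom A \<and> f (cinv A z) \<in> cdom B"
    using 1 unfolding eventually_chart[OF *(1,3)] .
  show "\<forall>\<^sub>F z in nhdsin (top_of_set (cmodel A)) (cmap A p). cmap B (f (cinv A z)) \<in> cmodel B"
    using 2 by (rule eventually_mono) (use cmap_in[OF *(2)] in simp)
qed

text \<open>
  Near \<open>p\<close> the values of \<open>f\<close> stay in the domain of \<open>B\<close>, so that inserting the chart of \<open>B\<close> and its
  inverse between \<open>f\<close> and \<open>g\<close> does not change the germ.
\<close>

lemma smooth_germ_compose: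
  assumes f: "smooth_germ A B p f" and g: "smooth_germ B C (f p) g"
  shows "smooth_germ A C p (\<lambda>x. g (f x))"
  unfolding smooth_germ_def
proof (intro conjI allI impI)
  show "is_chart A" "is_chart C" "p \<in> cdom A" "g (f p) \<in> cdom C"
    using smooth_germD(1-4)[OF f] smooth_germD(1-4)[OF g] by auto
  show "\<forall>\<^sub>F x in nhdsin (ctop A) p. P (g (f x))" if "eventually P (nhdsin (ctop C) (g (f p)))" for P
    using that smooth_germD(5)[OF f] smooth_germD(5)[OF g] by blast
  show "smooth_at (cmodel A) (cmap A p) (\<lambda>z. cmap C (g (f (cinv A z))))"
  proof (rule smooth_at_cong)
    have "cmap B (f (cinv A (cmap A p))) = cmap B (f p)"
      using smooth_germD(1-4)[OF f] by simp
    then show "smooth_at (cmodel A) (cmap A p) (\<lambda>z. cmap C (g (cinv B (cmap B (f (cinv A z))))))"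
      using smooth_at_compose[OF chart_subspace chart_subspace smooth_germD(6)[OF f] _ smooth_germD(9)[OF f],
          of "\<lambda>z. cmap C (g (cinv B z))"] smooth_germD(1-4)[OF f] smooth_germD(1-4,6)[OF g]
      by simp
    show "\<forall>\<^sub>F z in nhdsin (top_of_set (cmodel A)) (cmap A p).
       cmap C (g (f (cinv A z))) = cmap C (g (cinv B (cmap B (f (cinv A z)))))"
      using smooth_germD(8)[OF f] by (rule eventually_mono) (use smooth_germD(2)[OF f] in simp)
  qed
qed

lemma smooth_germ_Pair:
  assumes f: "smooth_germ A B p f" and g: "smooth_germ A C p g"
  shows "smooth_germ A (prodc B C) p (\<lambda>x. (f x, g x))"
  unfolding smooth_germ_def
proof (intro conjI allI impI)
  show "is_chart A" "is_chart (prodc B C)" "p \<in> cdom A" "(f p, g p) \<in> cdom (prodc B C)"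
    using smooth_germD(1-4)[OF f] smooth_germD(1-4)[OF g] by (simp_all add: is_chart_prodc)
  have t: "f p \<in> topspace (ctop B)" "g p \<in> topspace (ctop C)"
    using chart_dom_top[OF smooth_germD(2)[OF f]] smooth_germD(4)[OF f]
      chart_dom_top[OF smooth_germD(2)[OF g]] smooth_germD(4)[OF g] by auto
  show "\<forall>\<^sub>F x in nhdsin (ctop A) p. P (f x, g x)"
    if ev: "eventually P (nhdsin (ctop (prodc B C)) (f p, g p))" for P
  proof -
    have "(f p, g p) \<in> topspace (prod_topology (ctop B) (ctop C))" using t by simp
    then obtain W where W: "openin (prod_topology (ctop B) (ctop C)) W" "(f p, g p) \<in> W" "\<forall>x\<in>W. P x"
      using ev[unfolded eventually_nhdsin prodc_simps] by (elim disjE exE conjE) (simp, rule that)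
    obtain U V where UV: "openin (ctop B) U" "openin (ctop C) V" "f p \<in> U" "g p \<in> V" "U \<times> V \<subseteq> W"
      using W(1,2) unfolding openin_prod_topology_alt by metis
    have "\<forall>\<^sub>F y in nhdsin (ctop B) (f p). y \<in> U" "\<forall>\<^sub>F y in nhdsin (ctop C) (g p). y \<in> V"
      using UV eventually_nhdsin by fastforce+
    then have "\<forall>\<^sub>F x in nhdsin (ctop A) p. f x \<in> U" "\<forall>\<^sub>F x in nhdsin (ctop A) p. g x \<in> V"
      using smooth_germD(5)[OF f] smooth_germD(5)[OF g] by blast+
    then show ?thesis
      by eventually_elim (use UV(5) W(3) in blast)
  qed
  show "smooth_at (cmodel A) (cmap A p) (\<lambda>z. cmap (prodc B C) (f (cinv A z), g (cinv A z)))"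
    using smooth_at_Pair[OF smooth_germD(6)[OF f] smooth_germD(6)[OF g]] by simp
qed

lemma smooth_germ_fst:
  assumes "is_chart A" "is_chart B" "p \<in> cdom A" "q \<in> cdom B"
  shows "smooth_germ (prodc A B) A (p, q) fst"
  unfolding smooth_germ_def
proof (intro conjI allI impI)
  show "is_chart (prodc A B)" "is_chart A" "(p, q) \<in> cdom (prodc A B)" "fst (p, q) \<in> cdom A"
    using assms by (simp_all add: is_chart_prodc)
  note pq = this
  show "\<forall>\<^sub>F x in nhdsin (ctop (prodc A B)) (p, q). P (fst x)"
    if P: "eventually P (nhdsin (ctop A) (fst (p, q)))" for P
  proof -
    obtain W where W: "openin (ctop A) W" "p \<in> W" "\<And>x. x \<in> W \<Longrightarrow> P x"
      using P assms chart_dom_top by (force simp: eventually_nhdsin)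
    then have "openin (ctop (prodc A B)) (W \<times> cdom B)"
      using assms by (simp add: openin_prod_Times_iff is_chart_def)
    then show ?thesis using W assms(4)
      by (auto simp: eventually_nhdsin intro!: disjI2 exI[of _ "W \<times> cdom B"])
  qed
  show "smooth_at (cmodel (prodc A B)) (cmap (prodc A B) (p, q)) (\<lambda>z. cmap A (fst (cinv (prodc A B) z)))"
  proof (rule smooth_at_cong)
    show "smooth_at (cmodel (prodc A B)) (cmap (prodc A B) (p, q)) fst"
      using cmap_in[OF assms(1,3)] cmap_in[OF assms(2,4)] by (intro smooth_at_linear bounded_linear_fst) auto
    show "\<forall>\<^sub>F z in nhdsin (top_of_set (cmodel (prodc A B))) (cmap (prodc A B) (p, q)).
        cmap A (fst (cinv (prodc A B) z)) = fst z"
      using eventually_chart_image[OF pq(1,3)]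
      by (rule eventually_mono) (use assms in \<open>auto simp: cinv_prodc\<close>)
  qed
qed

lemma smooth_germ_snd:
  assumes "is_chart A" "is_chart B" "p \<in> cdom A" "q \<in> cdom B"
  shows "smooth_germ (prodc A B) B (p, q) snd"
  unfolding smooth_germ_def
proof (intro conjI allI impI)
  show "is_chart (prodc A B)" "is_chart B" "(p, q) \<in> cdom (prodc A B)" "snd (p, q) \<in> cdom B"
    using assms by (simp_all add: is_chart_prodc)
  note pq = this
  show "\<forall>\<^sub>F x in nhdsin (ctop (prodc A B)) (p, q). P (snd x)"
    if P: "eventually P (nhdsin (ctop B) (snd (p, q)))" for P
  proof -
    obtain W where W: "openin (ctop B) W" "q \<in> W" "\<And>x. x \<in> W \<Longrightarrow> P x"
      using P assms chart_dom_top by (force simp: eventually_nhdsin)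
    then have "openin (ctop (prodc A B)) (cdom A \<times> W)"
      using assms by (simp add: openin_prod_Times_iff is_chart_def)
    then show ?thesis using W assms(3)
      by (auto simp: eventually_nhdsin intro!: disjI2 exI[of _ "cdom A \<times> W"])
  qed
  show "smooth_at (cmodel (prodc A B)) (cmap (prodc A B) (p, q)) (\<lambda>z. cmap B (snd (cinv (prodc A B) z)))"
  proof (rule smooth_at_cong)
    show "smooth_at (cmodel (prodc A B)) (cmap (prodc A B) (p, q)) snd"
      using cmap_in[OF assms(1,3)] cmap_in[OF assms(2,4)] by (intro smooth_at_linear bounded_linear_snd) auto
    show "\<forall>\<^sub>F z in nhdsin (top_of_set (cmodel (prodc A B))) (cmap (prodc A B) (p, q)).
        cmap B (snd (cinv (prodc A B) z)) = snd z"
      using eventually_chart_image[OF pq(1,3)]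
      by (rule eventually_mono) (use assms in \<open>auto simp: cinv_prodc\<close>)
  qed
qed

section \<open>Manifolds in the charts of their atlas\<close>

definition mchart :: "('p, 'e::euclidean_space) mfd \<Rightarrow> 'p set \<Rightarrow> ('p \<Rightarrow> 'e) \<Rightarrow> ('p, 'e) chart" where
  "mchart M U \<phi> = \<lparr>ctop = mtop M, cmodel = model M, cdom = U, cmap = \<phi>\<rparr>"

lemma mchart_simps [simp]:
  "ctop (mchart M U \<phi>) = mtop M" "cmodel (mchart M U \<phi>) = model M"
  "cdom (mchart M U \<phi>) = U" "cmap (mchart M U \<phi>) = \<phi>" "cinv (mchart M U \<phi>) = inv_into U \<phi>"
  by (simp_all add: mchart_def cinv_def)

lemma eventually_nhdsinD:
  "eventually P (nhdsin T p) \<Longrightarrow> p \<in> topspace T \<Longrightarrow> \<exists>W. openin T W \<and> p \<in> W \<and> (\<forall>x\<in>W. P x)"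
  by (simp add: eventually_nhdsin)

lemma smooth_at_linear_after:
  assumes f: "smooth_at E p f" and L: "bounded_linear L"
  shows "smooth_at E p (\<lambda>z. L (f z))"
proof -
  obtain V where V: "openin (top_of_set E) V" "p \<in> V" "smooth_on E V f"
    using f smooth_at_def by blast
  have "smooth_on E V (\<lambda>z. L (f z))"
    unfolding smooth_on_def
  proof
    fix k
    show "Ck_on k E V (\<lambda>z. L (f z))"
      using Ck_on_linear_after[OF L, of k E V f] V(3) by (simp add: smooth_on_def)
  qed
  then show ?thesis using V smooth_at_def by blast
qed

lemma is_chart_mchart:
  assumes "smooth_manifold M" "(U, \<phi>) \<in> atlas M"
  shows "is_chart (mchart M U \<phi>)"
proof -
  let ?T = "mtop M"
  have E: "subspace (model M)" and U: "openin ?T U"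
    and im: "openin (top_of_set (model M)) (\<phi> ` U)"
    and h: "homeomorphic_map (subtopology ?T U) (top_of_set (\<phi> ` U)) \<phi>"
    using assms unfolding smooth_manifold_def by auto
  have ts: "topspace (subtopology ?T U) = U"
    using openin_subset[OF U] by (simp add: inf_absorb2)
  show ?thesis
    unfolding is_chart_def mchart_simps
  proof (intro conjI allI impI)
    show "inj_on \<phi> U" using homeomorphic_imp_injective_map[OF h] ts by simp
    fix W assume W: "openin ?T W \<and> W \<subseteq> U"
    then have "openin (subtopology ?T U) W" using U by (simp add: openin_open_subtopology)
    then have "openin (top_of_set (\<phi> ` U)) (\<phi> ` W)"
      using homeomorphic_imp_open_map[OF h] by (simp add: open_map_def)
    then show "openin (top_of_set (model M)) (\<phi> ` W)" using im openin_trans by blast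
  next
    fix V assume V: "openin (top_of_set (model M)) V"
    obtain T where T: "open T" "V = model M \<inter> T" using V openin_open by blast
    then have "\<phi> ` U \<inter> V = \<phi> ` U \<inter> T" using openin_imp_subset[OF im] by blast
    then have "openin (top_of_set (\<phi> ` U)) (\<phi> ` U \<inter> V)"
      using T(1) by (simp add: openin_open_Int)
    then have "openin (subtopology ?T U) {x \<in> U. \<phi> x \<in> \<phi> ` U \<inter> V}"
      by (rule openin_continuous_map_preimage[OF homeomorphic_imp_continuous_map[OF h], unfolded ts])
    moreover have "{x \<in> U. \<phi> x \<in> \<phi> ` U \<inter> V} = {x \<in> U. \<phi> x \<in> V}" by auto
    ultimately show "openin ?T {x \<in> U. \<phi> x \<in> V}"
      using U by (simp add: openin_open_subtopology)
  qed (use E U in auto)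
qed

lemma manifold_chart_at:
  assumes "smooth_manifold M" "p \<in> topspace (mtop M)"
  obtains U \<phi> where "(U, \<phi>) \<in> atlas M" "p \<in> U"
proof -
  have "p \<in> (\<Union>(U, \<phi>)\<in>atlas M. U)" using assms unfolding smooth_manifold_def by simp
  then show ?thesis using that by auto
qed

lemma smooth_map_on_domain_open:
  assumes "smooth_map_on M N W f" "openin (mtop M) U" "openin (mtop N) U'"
  shows "openin (mtop M) (U \<inter> W \<inter> f -` U')"
proof -
  have W: "openin (mtop M) W" and c: "continuous_map (subtopology (mtop M) W) (mtop N) f"
    using assms(1) by (auto simp: smooth_map_on_def)
  have "openin (subtopology (mtop M) W) {x \<in> W. f x \<in> U'}"
    using openin_continuous_map_preimage[OF c assms(3)] openin_subset[OF W] by (simp add: inf_absorb2)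
  then have "openin (mtop M) {x \<in> W. f x \<in> U'}" using W openin_open_subtopology by blast
  then have "openin (mtop M) (U \<inter> {x \<in> W. f x \<in> U'})" using assms(2) by blast
  moreover have "U \<inter> {x \<in> W. f x \<in> U'} = U \<inter> W \<inter> f -` U'" by auto
  ultimately show ?thesis by simp
qed

lemma smooth_map_on_germ:
  assumes f: "smooth_map_on M N W f" and "(U, \<phi>) \<in> atlas M" "(U', \<psi>) \<in> atlas N"
    and A: "is_chart (mchart M U \<phi>)" and B: "is_chart (mchart N U' \<psi>)"
    and p: "p \<in> U" "p \<in> W" "f p \<in> U'"
  shows "smooth_germ (mchart M U \<phi>) (mchart N U' \<psi>) p f"
  unfolding smooth_germ_def
proof (intro conjI allI impI)
  have U: "openin (mtop M) U" "openin (mtop N) U'" using A B by (auto simp: is_chart_def)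
  show "\<forall>\<^sub>F x in nhdsin (ctop (mchart M U \<phi>)) p. P (f x)"
    if ev: "eventually P (nhdsin (ctop (mchart N U' \<psi>)) (f p))" for P
  proof -
    have "f p \<in> topspace (mtop N)" using openin_subset[OF U(2)] p by auto
    then obtain V where V: "openin (mtop N) V" "f p \<in> V" "\<forall>y\<in>V. P y"
      using eventually_nhdsinD[OF ev] by (simp, blast)
    then have "openin (mtop M) (U \<inter> W \<inter> f -` V)" "p \<in> U \<inter> W \<inter> f -` V"
        "\<forall>x\<in>U \<inter> W \<inter> f -` V. P (f x)"
      using smooth_map_on_domain_open[OF f U(1) V(1)] p by auto
    then show ?thesis unfolding eventually_nhdsin mchart_simps by blast
  qed
  have "openin (top_of_set (model M)) (\<phi> ` (U \<inter> W \<inter> f -` U'))"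
    using A smooth_map_on_domain_open[OF f U] by (auto simp: is_chart_def)
  moreover have "smooth_on (model M) (\<phi> ` (U \<inter> W \<inter> f -` U')) (\<psi> \<circ> f \<circ> inv_into U \<phi>)"
    using f assms(2,3) unfolding smooth_map_on_def by auto
  ultimately show "smooth_at (cmodel (mchart M U \<phi>)) (cmap (mchart M U \<phi>) p)
     (\<lambda>z. cmap (mchart N U' \<psi>) (f (cinv (mchart M U \<phi>) z)))"
    unfolding smooth_at_def mchart_simps using p by (auto simp: o_def)
qed (use assms in auto)

lemma is_chart_real_line: "is_chart (mchart real_line UNIV id)"
  by (simp add: is_chart_def real_line_def)

lemma prod_mfd_chart:
  assumes "(U, \<phi>) \<in> atlas M" "(U', \<psi>) \<in> atlas N"
  shows "(U \<times> U', map_prod \<phi> \<psi>) \<in> atlas (prod_mfd M N)"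
    "mchart (prod_mfd M N) (U \<times> U') (map_prod \<phi> \<psi>) = prodc (mchart M U \<phi>) (mchart N U' \<psi>)"
  using assms by (auto simp: prod_mfd_def mchart_def prodc_def)

section \<open>Tangent vectors in a chart\<close>

text \<open>
  The definition of smoothness near a point asks for every chart of the atlas.  One chart suffices:
  shrink the neighbourhood to its domain and use the smooth transition maps.
\<close>

lemma smooth_near_chart:
  assumes M: "smooth_manifold M" and U: "(U, \<phi>) \<in> atlas M" and p: "p \<in> U"
  shows "smooth_near M p f \<longleftrightarrow> smooth_at (model M) (\<phi> p) (\<lambda>z. f (inv_into U \<phi> z))"
proof
  let ?C = "mchart M U \<phi>"
  have C: "is_chart ?C" using is_chart_mchart[OF M U] .
  {
    assume "smooth_near M p f"
    then obtain W where W: "p \<in> W" "smooth_map_on M real_line W f" by (auto simp: smooth_near_def)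
    have at: "(UNIV, id) \<in> atlas real_line" by (simp add: real_line_def)
    show "smooth_at (model M) (\<phi> p) (\<lambda>z. f (inv_into U \<phi> z))"
      using smooth_germD(6)[OF smooth_map_on_germ[OF W(2) U at C is_chart_real_line p W(1)]] by simp
  next
    assume "smooth_at (model M) (\<phi> p) (\<lambda>z. f (inv_into U \<phi> z))"
    then obtain V where V: "openin (top_of_set (model M)) V" "\<phi> p \<in> V"
       "smooth_on (model M) V (\<lambda>z. f (inv_into U \<phi> z))" by (auto simp: smooth_at_def)
    define W where "W = {x \<in> U. \<phi> x \<in> V}"
    have W: "openin (mtop M) W" using C V(1) by (simp add: is_chart_def W_def)
    have inj: "inj_on \<phi> U" using C by (simp add: is_chart_def)
    have "continuous_map (subtopology (mtop M) W) euclideanreal f"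
    proof (rule continuous_map_eq)
      have 1: "continuous_map (subtopology (mtop M) W) (top_of_set V) \<phi>"
        unfolding continuous_map_in_subtopology
      proof
        show "continuous_map (subtopology (mtop M) W) euclidean \<phi>"
          unfolding continuous_map_def
        proof (intro conjI allI impI)
          fix O' :: "'b set" assume "openin euclidean O'"
          then have "openin (top_of_set (model M)) (V \<inter> O')" using V(1)
            by (metis inf_commute open_openin openin_Int_open)
          then have "openin (mtop M) {x \<in> U. \<phi> x \<in> V \<inter> O'}"
            using C unfolding is_chart_def mchart_simps by blast
          moreover have "{x \<in> topspace (subtopology (mtop M) W). \<phi> x \<in> O'} = {x \<in> U. \<phi> x \<in> V \<inter> O'}"
            using openin_subset[OF W] by (auto simp: W_def)
          ultimately show "openin (subtopology (mtop M) W) {x \<in> topspace (subtopology (mtop M) W). \<phi> x \<in> O'}"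
            using W by (simp add: openin_open_subtopology) (auto simp: W_def)
        qed simp
      qed (auto simp: W_def)
      have 2: "continuous_map (top_of_set V) euclideanreal (\<lambda>z. f (inv_into U \<phi> z))"
        using smooth_on_continuous[OF V(3)] by simp
      show "continuous_map (subtopology (mtop M) W) euclideanreal ((\<lambda>z. f (inv_into U \<phi> z)) \<circ> \<phi>)"
        by (rule continuous_map_compose[OF 1 2])
    qed (use inj in \<open>auto simp: W_def\<close>)
    moreover have "smooth_on (model M) (\<phi>' ` (U' \<inter> W \<inter> f -` UNIV)) (id \<circ> f \<circ> inv_into U' \<phi>')"
      if U': "(U', \<phi>') \<in> atlas M" for U' \<phi>'
    proof -
      have C': "is_chart (mchart M U' \<phi>')" using is_chart_mchart[OF M U'] .
      have inj': "inj_on \<phi>' U'" using C' by (simp add: is_chart_def)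
      have op: "openin (top_of_set (model M)) (\<phi>' ` (U' \<inter> W))"
        using C' W by (auto simp: is_chart_def)
      have tr: "smooth_on (model M) (\<phi>' ` (U' \<inter> W)) (\<phi> \<circ> inv_into U' \<phi>')"
      proof (rule smooth_on_subset)
        show "smooth_on (model M) (\<phi>' ` (U' \<inter> U)) (\<phi> \<circ> inv_into U' \<phi>')"
          using M U U' unfolding smooth_manifold_def by auto
      qed (auto simp: W_def)
      have "smooth_on (model M) (\<phi>' ` (U' \<inter> W)) (\<lambda>z. f (inv_into U \<phi> ((\<phi> \<circ> inv_into U' \<phi>') z)))"
        by (rule smooth_on_compose[OF chart_subspace[OF C, simplified] op chart_subspace[OF C, simplified] _ _ V(3) tr])
          (use inj' openin_imp_subset[OF V(1)] in \<open>auto simp: W_def\<close>)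
      then show ?thesis
        by (rule smooth_on_subset[OF smooth_on_cong]) (use inj inj' in \<open>auto simp: W_def\<close>)
    qed
    ultimately have sm: "smooth_map_on M real_line W f"
      using W unfolding smooth_map_on_def by (auto simp: real_line_def)
    have "p \<in> W" using p V(2) by (simp add: W_def)
    with sm show "smooth_near M p f" unfolding smooth_near_def by (intro exI[of _ W] conjI)
  }
qed

lemma has_derivative_along_curve:
  assumes k: "(k has_vector_derivative w) (at (0::real))" and ev: "\<forall>\<^sub>F t in nhds 0. k t \<in> V"
    and h: "(h has_derivative h') (at (k 0) within V)"
  shows "((\<lambda>t. h (k t)) has_vector_derivative h' w) (at 0)"
proof -
  obtain T where T: "open T" "0 \<in> T" "\<And>t. t \<in> T \<Longrightarrow> k t \<in> V"
    using ev by (auto simp: eventually_nhds)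
  have 1: "(k has_derivative (\<lambda>t. t *\<^sub>R w)) (at 0 within T)"
    using k unfolding has_vector_derivative_def by (rule has_derivative_at_withinI)
  have "((\<lambda>t. h (k t)) has_derivative (\<lambda>t. h' (t *\<^sub>R w))) (at 0 within T)"
    by (rule has_derivative_in_compose[OF 1 has_derivative_subset[OF h]]) (use T(3) in auto)
  then have "((\<lambda>t. h (k t)) has_derivative (\<lambda>t. h' (t *\<^sub>R w))) (at 0)"
    using at_within_open[OF T(2,1)] by simp
  then show ?thesis
    unfolding has_vector_derivative_def
    using linear_scale[OF has_derivative_linear[OF h]] by (simp add: fun_eq_iff)
qed

text \<open>The coordinate vector of a tangent vector \<open>v\<close>: its values on the coordinates of \<open>\<phi>\<close>.\<close>

definition chart_vec :: "('p \<Rightarrow> 'e::euclidean_space) \<Rightarrow> (('p \<Rightarrow> real) \<Rightarrow> real) \<Rightarrow> 'e" where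
  "chart_vec \<phi> v = (\<Sum>e\<in>Basis. v (\<lambda>g. \<phi> g \<bullet> e) *\<^sub>R e)"

lemma chart_vec_inner: "e \<in> Basis \<Longrightarrow> chart_vec \<phi> v \<bullet> e = v (\<lambda>g. \<phi> g \<bullet> e)"
  by (simp add: chart_vec_def)

lemma chart_vec_eqI: "(\<And>e. e \<in> Basis \<Longrightarrow> v (\<lambda>g. \<phi> g \<bullet> e) = w \<bullet> e) \<Longrightarrow> chart_vec \<phi> v = w"
  by (simp add: euclidean_eq_iff[of _ w] chart_vec_inner)

context
  fixes M :: "('p, 'e::euclidean_space) mfd" and U :: "'p set" and \<phi> :: "'p \<Rightarrow> 'e" and p :: 'p
  assumes M: "smooth_manifold M" and U: "(U, \<phi>) \<in> atlas M" and p: "p \<in> U"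
begin

lemma smooth_near_coordinate: "smooth_near M p (\<lambda>g. \<phi> g \<bullet> e)"
  unfolding smooth_near_chart[OF M U p]
proof (rule smooth_at_cong)
  note C = is_chart_mchart[OF M U]
  show "smooth_at (model M) (\<phi> p) (\<lambda>z. z \<bullet> e)"
    using cmap_in[OF C] p by (intro smooth_at_linear bounded_linear_inner_left) simp
  show "\<forall>\<^sub>F z in nhdsin (top_of_set (model M)) (\<phi> p). \<phi> (inv_into U \<phi> z) \<bullet> e = z \<bullet> e"
    using eventually_chart_image[OF C, unfolded mchart_simps, OF p]
    by (rule eventually_mono) (use p in \<open>auto simp: f_inv_into_f\<close>)
qed

text \<open>
  The coordinate vector is the velocity, in the chart, of a curve representing the tangent vector, so
  that the chain rule gives the derivative of any smooth function along that curve.  The value \<open>0\<close> on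
  all other functions is the convention by which equal tangent vectors are equal functions.
\<close>

lemma tangent_vector_is_directional_derivative:
  assumes v: "v \<in> tangent_space M p"
  shows "chart_vec \<phi> v \<in> model M"
    and "\<And>f V f'. smooth_near M p f \<Longrightarrow> openin (top_of_set (model M)) V \<Longrightarrow> \<phi> p \<in> V \<Longrightarrow>
          ((\<lambda>z. f (inv_into U \<phi> z)) has_derivative f') (at (\<phi> p) within V) \<Longrightarrow> v f = f' (chart_vec \<phi> v)"
    and "\<And>f. \<not> smooth_near M p f \<Longrightarrow> v f = 0"
proof -
  note C = is_chart_mchart[OF M U]
  have inj: "inj_on \<phi> U" using C by (simp add: is_chart_def)
  obtain c \<epsilon> where c: "v = velocity M c" "c 0 = p" "0 < (\<epsilon>::real)"
      and sm: "smooth_map_on real_line M {-\<epsilon><..<\<epsilon>} c"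
    using v unfolding tangent_space_def by blast
  have at: "(UNIV, id) \<in> atlas real_line" by (simp add: real_line_def)
  have g: "smooth_germ (mchart real_line UNIV id) (mchart M U \<phi>) 0 c"
    using smooth_map_on_germ[OF sm at U is_chart_real_line C] c p by simp
  have rl: "mtop real_line = euclideanreal" "model real_line = UNIV" by (simp_all add: real_line_def)
  have nh: "nhdsin euclideanreal x = nhds x" for x
    unfolding filter_eq_iff eventually_nhdsin eventually_nhds by auto
  have cU: "\<forall>\<^sub>F t in nhds 0. c t \<in> U"
    using smooth_germD(7)[OF g] by (simp add: rl nh)
  have cM: "\<forall>\<^sub>F t in nhds 0. \<phi> (c t) \<in> model M"
    using smooth_germD(9)[OF g] by (simp add: rl nh)
  define k where "k t = \<phi> (c t)" for t
  have "smooth_at UNIV 0 k" using smooth_germD(6)[OF g] by (simp add: rl k_def[abs_def])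
  then obtain T where T: "openin (top_of_set UNIV) T" "0 \<in> T" "smooth_on UNIV T k"
    unfolding smooth_at_def by blast
  obtain k' where "(k has_derivative k') (at 0 within T)"
    using smooth_on_derivative[OF subspace_UNIV T(1,3)] T(2) by metis
  then have "(k has_derivative k') (at 0)" using T at_within_open[of 0 T] by simp
  then obtain w where w: "(k has_vector_derivative w) (at 0)"
    using derivative_along_line[of UNIV UNIV 0 1 k k'] by auto
  have wM: "w \<in> model M"
    using vector_derivative_in_subspace[OF _ w] cM chart_subspace[OF C] by (simp add: k_def)
  show 0: "v f = 0" if "\<not> smooth_near M p f" for f
    using that c by (simp add: velocity_def)
  have 1: "v f = f' w" if f: "smooth_near M p f" and V: "openin (top_of_set (model M)) V" "\<phi> p \<in> V"
     and f': "((\<lambda>z. f (inv_into U \<phi> z)) has_derivative f') (at (\<phi> p) within V)" for f V f'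
  proof -
    have "openin (mtop M) {x \<in> U. \<phi> x \<in> V}" using C V(1) by (simp add: is_chart_def)
    then have "\<forall>\<^sub>F x in nhdsin (mtop M) p. \<phi> x \<in> V"
      unfolding eventually_nhdsin using p V(2) by (intro disjI2 exI) auto
    then have "\<forall>\<^sub>F t in nhds 0. k t \<in> V"
      using smooth_germD(5)[OF g, of "\<lambda>x. \<phi> x \<in> V"] c(2) by (simp add: rl nh k_def)
    then have "((\<lambda>t. f (inv_into U \<phi> (k t))) has_vector_derivative f' w) (at 0)"
      using has_derivative_along_curve[OF w, of V "\<lambda>z. f (inv_into U \<phi> z)" f'] f' c(2) by (simp add: k_def)
    moreover have "\<forall>\<^sub>F t in nhds 0. f (inv_into U \<phi> (k t)) = f (c t)"
      using cU by (rule eventually_mono) (use inj in \<open>simp add: k_def\<close>)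
    ultimately have "((\<lambda>t. f (c t)) has_vector_derivative f' w) (at 0)"
      by (subst (asm) has_vector_derivative_cong_ev[where g="\<lambda>t. f (c t)"])
        (auto dest: eventually_nhds_x_imp_x elim: eventually_mono)
    then have "deriv (\<lambda>t. f (c t)) 0 = f' w"
      by (intro DERIV_imp_deriv) (simp add: has_real_derivative_iff_has_vector_derivative)
    then show ?thesis using f c by (simp add: velocity_def)
  qed
  have "chart_vec \<phi> v = w"
  proof (rule chart_vec_eqI)
    fix e :: 'e
    have "((\<lambda>z. \<phi> (inv_into U \<phi> z) \<bullet> e) has_derivative (\<lambda>z. z \<bullet> e)) (at (\<phi> p) within \<phi> ` U)"
      by (rule has_derivative_transform[where f="\<lambda>z. z \<bullet> e"])
        (use p in \<open>auto intro!: derivative_eq_intros simp: f_inv_into_f\<close>)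
    then show "v (\<lambda>g. \<phi> g \<bullet> e) = w \<bullet> e"
      using 1[OF smooth_near_coordinate, of "\<phi> ` U" e "\<lambda>z. z \<bullet> e"] chart_image_open[OF C] p by simp
  qed
  then show "chart_vec \<phi> v \<in> model M"
    "\<And>f V f'. smooth_near M p f \<Longrightarrow> openin (top_of_set (model M)) V \<Longrightarrow> \<phi> p \<in> V \<Longrightarrow>
          ((\<lambda>z. f (inv_into U \<phi> z)) has_derivative f') (at (\<phi> p) within V) \<Longrightarrow> v f = f' (chart_vec \<phi> v)"
    using wM 1 by auto
qed

lemma tangent_vector_eqI:
  assumes v: "v \<in> tangent_space M p" and v': "v' \<in> tangent_space M p"
    and eq: "chart_vec \<phi> v = chart_vec \<phi> v'"
  shows "v = v'"
proof
  fix f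
  show "v f = v' f"
  proof (cases "smooth_near M p f")
    case True
    then obtain V where V: "openin (top_of_set (model M)) V" "\<phi> p \<in> V"
        "smooth_on (model M) V (\<lambda>z. f (inv_into U \<phi> z))"
      using smooth_near_chart[OF M U p, of f] smooth_at_def by blast
    then obtain f' where "((\<lambda>z. f (inv_into U \<phi> z)) has_derivative f') (at (\<phi> p) within V)"
      using smooth_on_derivative[OF _ V(1,3)] chart_subspace[OF is_chart_mchart[OF M U]] by (metis mchart_simps(2))
    then show ?thesis
      using tangent_vector_is_directional_derivative(2)[OF v True V(1,2)]
        tangent_vector_is_directional_derivative(2)[OF v' True V(1,2)] eq by simp
  next
    case False
    then show ?thesis
      using tangent_vector_is_directional_derivative(3)[OF v] tangent_vector_is_directional_derivative(3)[OF v'] by simp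
  qed
qed

text \<open>
  A straight line in the chart, with direction \<open>w\<close>, is a curve with coordinate vector \<open>w\<close>.
\<close>

lemma tangent_vector_exists:
  assumes w: "w \<in> model M"
  shows "\<exists>v\<in>tangent_space M p. chart_vec \<phi> v = w"
proof -
  note C = is_chart_mchart[OF M U]
  have E: "subspace (model M)" using chart_subspace[OF C] by simp
  have inj: "inj_on \<phi> U" using C by (simp add: is_chart_def)
  have op: "openin (top_of_set (model M)) (\<phi> ` U)" using chart_image_open[OF C] by simp
  define k where "k t = \<phi> p + t *\<^sub>R w" for t :: real
  have kE: "k t \<in> model M" for t
    using cmap_in[OF C] p w E by (simp add: k_def subspace_add subspace_scale)
  have kc: "continuous_on A k" for A
    unfolding k_def by (intro continuous_intros)
  have "\<forall>\<^sub>F t in nhds 0. k t \<in> \<phi> ` U"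
    using line_in_openin[OF E op _ w, of "\<phi> p"] p by (simp add: k_def)
  then obtain \<epsilon> where \<epsilon>: "0 < \<epsilon>" "\<And>t. t \<in> {-\<epsilon><..<\<epsilon>} \<Longrightarrow> k t \<in> \<phi> ` U"
    unfolding eventually_nhds_metric by (auto simp: dist_real_def abs_less_iff)
  define I where "I = {-\<epsilon><..<\<epsilon>}"
  define c where "c t = inv_into U \<phi> (k t)" for t
  have cU: "c t \<in> U" "\<phi> (c t) = k t" if "t \<in> I" for t
    using \<epsilon>(2) that by (auto simp: c_def I_def inv_into_into f_inv_into_f)
  have pre: "open {t \<in> I. c t \<in> W}" if W: "openin (mtop M) W" for W
  proof -
    have "openin (mtop M) (U \<inter> W)" using C W by (auto simp: is_chart_def)
    then have "openin (top_of_set (model M)) (\<phi> ` (U \<inter> W))" using C by (simp add: is_chart_def)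
    then obtain O' where O': "open O'" "\<phi> ` (U \<inter> W) = model M \<inter> O'" using openin_open by blast
    have "{t \<in> I. c t \<in> W} = I \<inter> k -` O'"
    proof (intro equalityI subsetI)
      fix t assume "t \<in> {t \<in> I. c t \<in> W}"
      then show "t \<in> I \<inter> k -` O'" using cU[of t] O'(2) by force
    next
      fix t assume t: "t \<in> I \<inter> k -` O'"
      then have "k t \<in> \<phi> ` (U \<inter> W)" using kE O'(2) by blast
      then obtain x where "x \<in> U \<inter> W" "k t = \<phi> x" by blast
      then show "t \<in> {t \<in> I. c t \<in> W}" using t inj by (simp add: c_def)
    qed
    moreover have "open (k -` O')" using kc O'(1) by (simp add: open_vimage)
    ultimately show ?thesis by (simp add: I_def open_Int)
  qed
  have "openin (mtop real_line) I" by (simp add: real_line_def I_def)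
  moreover have "continuous_map (subtopology (mtop real_line) I) (mtop M) c"
    unfolding continuous_map_def
  proof (intro conjI allI impI)
    show "c \<in> topspace (subtopology (mtop real_line) I) \<rightarrow> topspace (mtop M)"
      using cU chart_dom_top[OF C] by auto
    fix W assume "openin (mtop M) W"
    then show "openin (subtopology (mtop real_line) I) {x \<in> topspace (subtopology (mtop real_line) I). c x \<in> W}"
      using pre[of W] by (simp add: real_line_def openin_open_subtopology I_def) auto
  qed
  moreover have "smooth_on UNIV {t \<in> I. c t \<in> U'} (\<psi> \<circ> c)" if U': "(U', \<psi>) \<in> atlas M" for U' \<psi>
  proof -
    define J where "J = {t \<in> I. c t \<in> U'}"
    have U'o: "openin (mtop M) U'" using is_chart_mchart[OF M U'] by (simp add: is_chart_def)
    then have J: "open J" unfolding J_def by (rule pre)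
    have tr: "smooth_on (model M) (\<phi> ` (U \<inter> U')) (\<psi> \<circ> inv_into U \<phi>)"
      using M U U' unfolding smooth_manifold_def by auto
    have tro: "openin (top_of_set (model M)) (\<phi> ` (U \<inter> U'))"
      using C U'o by (auto simp: is_chart_def)
    have ks: "smooth_on UNIV J k"
      unfolding smooth_on_def k_def
      by (intro allI Ck_on_add Ck_on_const Ck_on_linear_after[OF bounded_linear_scaleR_left Ck_on_id])
    have "k ` J \<subseteq> \<phi> ` (U \<inter> U')" using cU by (force simp: J_def)
    then have "smooth_on UNIV J (\<lambda>t. (\<psi> \<circ> inv_into U \<phi>) (k t))"
      using smooth_on_compose[OF subspace_UNIV _ E openin_imp_subset[OF tro] _ tr ks] J by simp
    then show ?thesis by (simp add: J_def c_def o_def)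
  qed
  moreover have "UNIV \<inter> I \<inter> c -` U' = {t \<in> I. c t \<in> U'}" for U' by auto
  ultimately have "smooth_map_on real_line M I c"
    unfolding smooth_map_on_def by (auto simp: real_line_def)
  then have v: "velocity M c \<in> tangent_space M p"
    unfolding tangent_space_def using \<epsilon>(1) inj p by (auto simp: I_def c_def k_def)
  have "chart_vec \<phi> (velocity M c) = w"
  proof (rule chart_vec_eqI)
    fix e :: 'e
    have c0: "c 0 = p" using inj p by (simp add: c_def k_def)
    have "((\<lambda>t. k t \<bullet> e) has_real_derivative w \<bullet> e) (at 0)"
      unfolding k_def by (auto simp: inner_add_left intro!: derivative_eq_intros)
    moreover have "\<forall>\<^sub>F t in nhds 0. k t \<bullet> e = \<phi> (c t) \<bullet> e"
      using eventually_nhds_in_open[of I "0::real"] \<epsilon>(1) cU(2)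
      by (auto simp: I_def elim!: eventually_mono)
    ultimately have "((\<lambda>t. \<phi> (c t) \<bullet> e) has_real_derivative w \<bullet> e) (at 0)"
      by (simp cong: DERIV_cong_ev)
    then show "velocity M c (\<lambda>g. \<phi> g \<bullet> e) = w \<bullet> e"
      using smooth_near_coordinate[of e] c0 by (simp add: velocity_def DERIV_imp_deriv)
  qed
  then show ?thesis using v by blast
qed

end

text \<open>
  The coordinates of \<open>M\<close> restrict to smooth functions on \<open>N\<close>, whose coordinate expressions are the components
  of the inclusion in charts; a tangent vector of \<open>N\<close> differentiates them through \<open>J\<close>.
\<close>

lemma chart_vec_pushforward_inclusion:
  assumes M: "smooth_manifold M" "(U, \<phi>) \<in> atlas M" "p \<in> U"
    and N: "smooth_manifold N" "(U', \<psi>) \<in> atlas N" "p \<in> U'"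
    and inc: "smooth_map N M (\<lambda>x. x)"
    and J: "((\<lambda>y. \<phi> (inv_into U' \<psi> y)) has_derivative J) (at (\<psi> p) within V)"
      "openin (top_of_set (model N)) V" "\<psi> p \<in> V"
    and v: "v \<in> tangent_space N p"
  shows "chart_vec \<phi> (pushforward M (\<lambda>x. x) p v) = J (chart_vec \<psi> v)"
proof (rule chart_vec_eqI)
  fix e :: 'b
  note C = is_chart_mchart[OF M(1,2)] is_chart_mchart[OF N(1,2)]
  have "p \<in> topspace (mtop N)" using chart_dom_top[OF C(2)] N(3) by auto
  then have g: "smooth_germ (mchart N U' \<psi>) (mchart M U \<phi>) p (\<lambda>x. x)"
    using smooth_map_on_germ[OF inc N(2) M(2) C(2,1) N(3) _ M(3)] by blast
  have "smooth_at (model N) (\<psi> p) (\<lambda>y. \<phi> (inv_into U' \<psi> y) \<bullet> e)"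
    using smooth_at_linear_after[OF smooth_germD(6)[OF g] bounded_linear_inner_left] by simp
  then have "smooth_near N p (\<lambda>g. \<phi> g \<bullet> e)" using smooth_near_chart[OF N] by simp
  then have "v (\<lambda>g. \<phi> g \<bullet> e) = J (chart_vec \<psi> v) \<bullet> e"
    using tangent_vector_is_directional_derivative(2)[OF N v _ J(2,3), of "\<lambda>g. \<phi> g \<bullet> e"] 
      bounded_linear.has_derivative[OF bounded_linear_inner_left J(1)] by blast
  then show "pushforward M (\<lambda>x. x) p v (\<lambda>g. \<phi> g \<bullet> e) = J (chart_vec \<psi> v) \<bullet> e"
    using smooth_near_coordinate[OF M] by (simp add: pushforward_def o_def)
qed

section \<open>Fields of a Lie algebra action that vanish at a point\<close>

text \<open>
  Gronwall's inequality for a finite system: the sum \<open>g\<close> of the squared norms satisfies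
  \<open>g' \<le> K g\<close>, so that \<open>exp (- K t) g t\<close> decreases from its initial value \<open>0\<close>.
\<close>

lemma gronwall_system_zero:
  fixes w :: "'i \<Rightarrow> real \<Rightarrow> 'e::real_inner"
  assumes fin: "finite I"
    and der: "\<And>i t. i \<in> I \<Longrightarrow> t \<in> {0..1} \<Longrightarrow> (w i has_vector_derivative w' i t) (at t)"
    and bound: "\<And>i t. i \<in> I \<Longrightarrow> t \<in> {0..1} \<Longrightarrow> norm (w' i t) \<le> C * (\<Sum>j\<in>I. norm (w j t))"
    and init: "\<And>i. i \<in> I \<Longrightarrow> w i 0 = 0"
    and i: "i \<in> I" and t: "t \<in> {0..1}"
  shows "w i t = 0"
proof -
  define n where "n t = (\<Sum>j\<in>I. norm (w j t))" for t
  define g where "g t = (\<Sum>j\<in>I. w j t \<bullet> w j t)" for t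
  define g' where "g' t = (\<Sum>j\<in>I. w j t \<bullet> w' j t + w' j t \<bullet> w j t)" for t
  define K where "K = 2 * \<bar>C\<bar> * real (card I)"
  have dg: "(g has_real_derivative g' t) (at t)" if "t \<in> {0..1}" for t
  proof -
    have "(w j has_derivative (\<lambda>h. h *\<^sub>R w' j t)) (at t)" if "j \<in> I" for j
      using der[OF that \<open>t \<in> {0..1}\<close>] by (simp add: has_vector_derivative_def)
    then have "((\<lambda>t. \<Sum>j\<in>I. w j t \<bullet> w j t) has_derivative
        (\<lambda>h. \<Sum>j\<in>I. w j t \<bullet> (h *\<^sub>R w' j t) + (h *\<^sub>R w' j t) \<bullet> w j t)) (at t)"
      by (intro has_derivative_sum has_derivative_inner)
    moreover have "(\<lambda>h. \<Sum>j\<in>I. w j t \<bullet> (h *\<^sub>R w' j t) + (h *\<^sub>R w' j t) \<bullet> w j t) = (*) (g' t)"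
      by (simp add: g'_def fun_eq_iff sum_distrib_left sum_distrib_right algebra_simps)
    ultimately show ?thesis
      unfolding has_field_derivative_def g_def[abs_def] by simp
  qed
  have g'_le: "g' t \<le> K * g t" if t: "t \<in> {0..1}" for t
  proof -
    have n0: "0 \<le> n t" unfolding n_def by (simp add: sum_nonneg)
    have "g' t \<le> (\<Sum>j\<in>I. 2 * (norm (w j t) * (\<bar>C\<bar> * n t)))"
      unfolding g'_def
    proof (rule sum_mono)
      fix j assume j: "j \<in> I"
      have "norm (w' j t) \<le> C * n t" using bound[OF j t] by (simp add: n_def)
      also have "\<dots> \<le> \<bar>C\<bar> * n t" using n0 by (intro mult_right_mono) auto
      finally have "norm (w j t) * norm (w' j t) \<le> norm (w j t) * (\<bar>C\<bar> * n t)"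
        by (intro mult_left_mono) auto
      moreover have "w j t \<bullet> w' j t \<le> norm (w j t) * norm (w' j t)" by (rule norm_cauchy_schwarz)
      ultimately show "w j t \<bullet> w' j t + w' j t \<bullet> w j t \<le> 2 * (norm (w j t) * (\<bar>C\<bar> * n t))"
        by (simp add: inner_commute)
    qed
    also have "\<dots> = 2 * \<bar>C\<bar> * (n t)\<^sup>2"
      by (simp add: n_def power2_eq_square sum_distrib_left sum_distrib_right mult_ac)
    also have "\<dots> \<le> 2 * \<bar>C\<bar> * (real (card I) * g t)"
    proof (rule mult_left_mono)
      have "(n t)\<^sup>2 \<le> (\<Sum>j\<in>I. (norm (w j t))\<^sup>2) * real (card I)"
        unfolding n_def by (rule sum_squared_le_sum_of_squares)
      then show "(n t)\<^sup>2 \<le> real (card I) * g t"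
        by (simp add: g_def power2_norm_eq_inner mult.commute)
    qed simp
    finally show ?thesis by (simp add: K_def mult_ac)
  qed
  have "exp (- K * t) * g t \<le> exp (- K * 0) * g 0"
  proof (rule DERIV_nonpos_imp_nonincreasing[where f="\<lambda>x. exp (- K * x) * g x"])
    fix x assume x: "0 \<le> x" "x \<le> t"
    then have x': "x \<in> {0..1}" using t by auto
    have "((\<lambda>x. exp (- K * x) * g x) has_real_derivative
        exp (- K * x) * g' x + (exp (- K * x) * - K) * g x) (at x)"
      using dg[OF x'] by (auto intro!: derivative_eq_intros)
    moreover have "exp (- K * x) * g' x + (exp (- K * x) * - K) * g x = exp (- K * x) * (g' x - K * g x)"
      by (simp add: algebra_simps)
    moreover have "exp (- K * x) * (g' x - K * g x) \<le> 0"
      using g'_le[OF x'] by (simp add: mult_le_0_iff)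
    ultimately show "\<exists>y. ((\<lambda>x. exp (- K * x) * g x) has_real_derivative y) (at x) \<and> y \<le> 0"
      by metis
  qed (use t in auto)
  moreover have "g 0 = 0" using init by (simp add: g_def)
  ultimately have "g t \<le> 0" by (simp add: mult_le_0_iff)
  moreover have "w i t \<bullet> w i t \<le> g t"
    unfolding g_def using fin i by (intro member_le_sum) auto
  ultimately show ?thesis by (metis inner_ge_zero inner_eq_zero_iff order_antisym order_trans)
qed

lemma linear_within_0: "linear_within V f \<Longrightarrow> subspace V \<Longrightarrow> f 0 = 0"
  unfolding linear_within_def using subspace_0 by (metis scaleR_zero_left)

lemma linear_within_sum:
  assumes f: "linear_within V f" and V: "subspace V" and "finite A" "A \<subseteq> V"
  shows "f (\<Sum>a\<in>A. c a *\<^sub>R a) = (\<Sum>a\<in>A. c a *\<^sub>R f a)"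
  using assms(3,4)
proof (induction A rule: finite_induct)
  case empty
  then show ?case using linear_within_0[OF f V] by simp
next
  case (insert x F)
  have "(\<Sum>a\<in>F. c a *\<^sub>R a) \<in> V" using V insert.prems by (intro subspace_sum) (auto intro: subspace_scale)
  moreover have "c x *\<^sub>R x \<in> V" using V insert.prems by (auto intro: subspace_scale)
  ultimately have "f (c x *\<^sub>R x + (\<Sum>a\<in>F. c a *\<^sub>R a)) = f (c x *\<^sub>R x) + f (\<Sum>a\<in>F. c a *\<^sub>R a)"
    using f unfolding linear_within_def by blast
  moreover have "f (c x *\<^sub>R x) = c x *\<^sub>R f x" using f insert.prems unfolding linear_within_def by blast
  ultimately show ?case using insert by simp
qed

lemma norm_orthonormal_sum_le:
  fixes f :: "'a::real_inner \<Rightarrow> 'b::real_normed_vector"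
  assumes "\<And>b. b \<in> B \<Longrightarrow> norm b = 1"
  shows "norm (\<Sum>b\<in>B. (x \<bullet> b) *\<^sub>R f b) \<le> norm x * (\<Sum>b\<in>B. norm (f b))"
proof -
  have "norm (\<Sum>b\<in>B. (x \<bullet> b) *\<^sub>R f b) \<le> (\<Sum>b\<in>B. norm ((x \<bullet> b) *\<^sub>R f b))" by (rule norm_sum)
  also have "\<dots> \<le> (\<Sum>b\<in>B. norm x * norm (f b))"
  proof (rule sum_mono)
    fix b assume "b \<in> B"
    then have "\<bar>x \<bullet> b\<bar> \<le> norm x" using Cauchy_Schwarz_ineq2[of x b] assms by simp
    then show "norm ((x \<bullet> b) *\<^sub>R f b) \<le> norm x * norm (f b)" by (simp add: mult_right_mono)
  qed
  finally show ?thesis by (simp add: sum_distrib_left)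
qed

text \<open>
  The vanishing at \<open>y0\<close> of the fields of an ideal \<open>\<qq>\<close> propagates along a segment of velocity \<open>v\<close>, provided that
  at each point of the segment \<open>v\<close> is the value of some field \<open>V Y\<close>, with \<open>Y\<close> bounded.  By the bracket formula,
  the derivative of \<open>V X\<close> in the direction \<open>v = V Y\<close> is \<open>V (br Y X) + DV\<^sub>Y (V X)\<close>.  As \<open>br Y X \<in> \<qq>\<close>, the fields
  of an orthonormal basis of \<open>\<qq>\<close>, restricted to the segment, solve a homogeneous linear differential system,
  whose coefficients are bounded because \<open>Y\<close> is and the segment is compact.
\<close>

lemma action_fields_vanish_on_segment:
  fixes V :: "'a::euclidean_space \<Rightarrow> 'e::euclidean_space \<Rightarrow> 'e"
  assumes E: "subspace E" and U: "openin (top_of_set E) U" and v: "v \<in> E"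
    and seg: "\<And>t. t \<in> {0..1} \<Longrightarrow> y0 + t *\<^sub>R v \<in> U"
    and \<gg>: "lie_algebra br \<gg>" and \<qq>: "lie_ideal br \<gg> \<qq>"
    and lin: "\<And>y. y \<in> U \<Longrightarrow> linear_within \<gg> (\<lambda>X. V X y)"
    and VE: "\<And>X y. X \<in> \<gg> \<Longrightarrow> y \<in> U \<Longrightarrow> V X y \<in> E"
    and sm: "\<And>X. X \<in> \<gg> \<Longrightarrow> smooth_on E U (V X)"
    and brk: "\<And>X Y y D D'. X \<in> \<gg> \<Longrightarrow> Y \<in> \<gg> \<Longrightarrow> y \<in> U \<Longrightarrow>
        (V X has_derivative D) (at y within U) \<Longrightarrow> (V Y has_derivative D') (at y within U) \<Longrightarrow>
        V (br Y X) y = D (V Y y) - D' (V X y)"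
    and zero: "\<And>X. X \<in> \<qq> \<Longrightarrow> V X y0 = 0"
    and sp: "\<And>t. t \<in> {0..1} \<Longrightarrow> \<exists>Y\<in>\<gg>. norm Y \<le> R \<and> V Y (y0 + t *\<^sub>R v) = v"
    and X: "X \<in> \<qq>" and t: "t \<in> {0..1}"
  shows "V X (y0 + t *\<^sub>R v) = 0"
proof -
  define y where "y t = y0 + t *\<^sub>R v" for t
  have yU: "y t \<in> U" if "t \<in> {0..1}" for t using seg[OF that] by (simp add: y_def)
  have g: "subspace \<gg>" and q: "subspace \<qq>" "\<qq> \<subseteq> \<gg>" and qi: "\<And>x z. x \<in> \<gg> \<Longrightarrow> z \<in> \<qq> \<Longrightarrow> br x z \<in> \<qq>"
    and brl: "\<And>z. z \<in> \<gg> \<Longrightarrow> linear_within \<gg> (\<lambda>x. br x z)"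
    using \<gg> \<qq> unfolding lie_algebra_def lie_ideal_def bilinear_within_def by blast+
  obtain A where A: "finite A" "A \<subseteq> \<gg>" "\<And>b. b \<in> A \<Longrightarrow> norm b = 1"
      "\<And>x. x \<in> \<gg> \<Longrightarrow> (\<Sum>b\<in>A. (x \<bullet> b) *\<^sub>R b) = x"
    using subspace_orthonormal_expansion[OF g] by metis
  obtain B where B: "finite B" "B \<subseteq> \<qq>" "\<And>b. b \<in> B \<Longrightarrow> norm b = 1"
      "\<And>x. x \<in> \<qq> \<Longrightarrow> (\<Sum>b\<in>B. (x \<bullet> b) *\<^sub>R b) = x"
    using subspace_orthonormal_expansion[OF q(1)] by metis
  obtain F where F: "finite F" "F \<subseteq> E" "\<And>b. b \<in> F \<Longrightarrow> norm b = 1"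
      "\<And>x. x \<in> E \<Longrightarrow> (\<Sum>b\<in>F. (x \<bullet> b) *\<^sub>R b) = x"
    using subspace_orthonormal_expansion[OF E] by metis
  have "\<exists>D. (\<forall>y\<in>U. (V X has_derivative D y) (at y within U)) \<and> (\<forall>u\<in>E. smooth_on E U (\<lambda>y. D y u))"
    if "X \<in> \<gg>" for X
    using smooth_on_derivative[OF E U sm[OF that]] by metis
  then obtain D where D: "\<And>X y. X \<in> \<gg> \<Longrightarrow> y \<in> U \<Longrightarrow> (V X has_derivative D X y) (at y within U)"
      "\<And>X u. X \<in> \<gg> \<Longrightarrow> u \<in> E \<Longrightarrow> smooth_on E U (\<lambda>y. D X y u)"
    by metis
  have VA: "V X y = (\<Sum>a\<in>A. (X \<bullet> a) *\<^sub>R V a y)" if "X \<in> \<gg>" "y \<in> U" for X y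
    using linear_within_sum[OF lin[OF that(2)] g A(1,2), of "\<lambda>a. X \<bullet> a"] A(4)[OF that(1)] by simp
  have VB: "V X y = (\<Sum>b\<in>B. (X \<bullet> b) *\<^sub>R V b y)" if "X \<in> \<qq>" "y \<in> U" for X y
    using linear_within_sum[OF lin[OF that(2)] g B(1), of "\<lambda>a. X \<bullet> a"] B(2) q(2) B(4)[OF that(1)] by auto
  have DA: "(V Y has_derivative (\<lambda>u. \<Sum>a\<in>A. (Y \<bullet> a) *\<^sub>R D a y u)) (at y within U)"
    if "Y \<in> \<gg>" "y \<in> U" for Y y
  proof (rule has_derivative_transform)
    show "((\<lambda>y. \<Sum>a\<in>A. (Y \<bullet> a) *\<^sub>R V a y) has_derivative (\<lambda>u. \<Sum>a\<in>A. (Y \<bullet> a) *\<^sub>R D a y u)) (at y within U)"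
      using D(1) A(2) that(2) by (intro has_derivative_sum has_derivative_scaleR_right) auto
  qed (use VA that in auto)
  have DF: "D a y u = (\<Sum>f\<in>F. (u \<bullet> f) *\<^sub>R D a y f)" if "a \<in> \<gg>" "y \<in> U" "u \<in> E" for a y u
  proof -
    have l: "linear (D a y)" using D(1)[OF that(1,2)] by (rule has_derivative_linear)
    have "D a y (\<Sum>f\<in>F. (u \<bullet> f) *\<^sub>R f) = (\<Sum>f\<in>F. (u \<bullet> f) *\<^sub>R D a y f)"
      by (simp add: linear_sum[OF l] linear_scale[OF l])
    then show ?thesis using F(4)[OF that(3)] by simp
  qed
  \<comment> \<open>\<open>M\<close> bounds the derivatives of the fields along the segment and \<open>K\<close> the brackets of basis vectors;
    with \<open>norm Y \<le> R\<close> they bound the coefficients of the linear system by \<open>R * K + R * M\<close>\<close>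
  define H where "H t = (\<Sum>a\<in>A. \<Sum>f\<in>F. norm (D a (y t) f))" for t
  have "continuous_on {0..1} (\<lambda>t. D a (y t) f)" if "a \<in> A" "f \<in> F" for a f
  proof -
    have "continuous_on U (\<lambda>y. D a y f)"
      using smooth_on_continuous[OF D(2)] that A(2) F(2) by auto
    moreover have "continuous_on {0..1} y" unfolding y_def by (intro continuous_intros)
    ultimately show ?thesis
      by (rule continuous_on_compose2) (use yU in auto)
  qed
  then have "continuous_on {0..1} H"
    unfolding H_def by (intro continuous_intros) auto
  then have "bounded (H ` {0..1})"
    by (intro compact_imp_bounded compact_continuous_image) auto
  then obtain M where M: "\<And>t. t \<in> {0..1} \<Longrightarrow> H t \<le> M"
    unfolding bounded_iff by (metis abs_le_D1 imageI real_norm_def)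
  define K where "K = (\<Sum>b\<in>B. \<Sum>a\<in>A. norm (br a b))"
  define N where "N t = (\<Sum>b\<in>B. norm (V b (y t)))" for t
  have N0: "0 \<le> N t" for t unfolding N_def by (simp add: sum_nonneg)
  have R0: "0 \<le> R" using sp[of 0] norm_ge_zero order_trans by (metis atLeastAtMost_iff order_refl zero_le_one)
  have "V b (y t) = 0" if b: "b \<in> B" and t: "t \<in> {0..1}" for b t
  proof (rule gronwall_system_zero[of B "\<lambda>b t. V b (y t)" "\<lambda>b t. D b (y t) v" "R * K + R * M"])
    fix b t assume b: "b \<in> B" and t: "t \<in> {0..1::real}"
    have bg: "b \<in> \<gg>" "b \<in> \<qq>" using b B(2) q(2) by auto
    have "((\<lambda>h. V b (y t + h *\<^sub>R v)) has_vector_derivative D b (y t) v) (at 0)"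
      using derivative_along_line[OF E U yU[OF t] v D(1)[OF bg(1) yU[OF t]]] .
    then have "((\<lambda>h. V b (y (t + h))) has_vector_derivative D b (y t) v) (at 0)"
      by (simp add: y_def scaleR_add_left add.assoc)
    then have "((\<lambda>h. V b (y (h - (-t)))) has_vector_derivative D b (y t) v) (at (0::real))"
      by (simp add: add.commute)
    then show "((\<lambda>t. V b (y t)) has_vector_derivative D b (y t) v) (at t)"
      unfolding has_vector_derivative_def has_derivative_at
      by (simp add: add.commute)
    obtain Y where Y: "Y \<in> \<gg>" "norm Y \<le> R" "V Y (y t) = v" using sp[OF t] y_def by auto
    let ?DY = "\<lambda>u. \<Sum>a\<in>A. (Y \<bullet> a) *\<^sub>R D a (y t) u"
    have eq: "D b (y t) v = V (br Y b) (y t) + ?DY (V b (y t))"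
      using brk[OF bg(1) Y(1) yU[OF t] D(1)[OF bg(1) yU[OF t]] DA[OF Y(1) yU[OF t]]] Y(3) by simp
    have "norm (V (br Y b) (y t)) \<le> norm (br Y b) * N t"
      unfolding VB[OF qi[OF Y(1) bg(2)] yU[OF t]] N_def
      by (rule norm_orthonormal_sum_le[OF B(3)])
    also have "norm (br Y b) \<le> R * K"
    proof -
      have "br Y b = (\<Sum>a\<in>A. (Y \<bullet> a) *\<^sub>R br a b)"
        using linear_within_sum[OF brl[OF bg(1)] g A(1,2), of "\<lambda>a. Y \<bullet> a"] A(4)[OF Y(1)] by simp
      then have "norm (br Y b) \<le> norm Y * (\<Sum>a\<in>A. norm (br a b))"
        using norm_orthonormal_sum_le[OF A(3)] by metis
      also have "\<dots> \<le> R * K"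
      proof (rule mult_mono)
        show "(\<Sum>a\<in>A. norm (br a b)) \<le> K"
          unfolding K_def using B(1) b by (intro member_le_sum) (auto intro: sum_nonneg)
      qed (use Y R0 in \<open>auto intro: sum_nonneg\<close>)
      finally show ?thesis .
    qed
    finally have 1: "norm (V (br Y b) (y t)) \<le> R * K * N t"
      using N0[of t] by (simp add: mult_right_mono)
    have "norm (?DY (V b (y t))) \<le> norm Y * (\<Sum>a\<in>A. norm (D a (y t) (V b (y t))))"
      by (rule norm_orthonormal_sum_le[OF A(3)])
    also have "\<dots> \<le> R * (\<Sum>a\<in>A. norm (V b (y t)) * (\<Sum>f\<in>F. norm (D a (y t) f)))"
    proof (rule mult_mono)
      show "(\<Sum>a\<in>A. norm (D a (y t) (V b (y t)))) \<le> (\<Sum>a\<in>A. norm (V b (y t)) * (\<Sum>f\<in>F. norm (D a (y t) f)))"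
      proof (rule sum_mono)
        fix a assume "a \<in> A"
        then show "norm (D a (y t) (V b (y t))) \<le> norm (V b (y t)) * (\<Sum>f\<in>F. norm (D a (y t) f))"
          using DF[of a "y t" "V b (y t)"] A(2) yU[OF t] VE[OF bg(1) yU[OF t]]
            norm_orthonormal_sum_le[of F "V b (y t)" "D a (y t)"] F(3) by auto
      qed
    qed (use Y R0 in \<open>auto intro: sum_nonneg\<close>)
    also have "\<dots> = R * (norm (V b (y t)) * H t)"
      by (simp add: H_def sum_distrib_left)
    also have "\<dots> \<le> R * (N t * M)"
    proof (intro mult_left_mono mult_mono)
      show "norm (V b (y t)) \<le> N t"
        unfolding N_def using B(1) b by (intro member_le_sum) auto
      show "0 \<le> H t" unfolding H_def by (intro sum_nonneg) simp
    qed (use M[OF t] N0[of t] R0 in auto)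
    finally have 2: "norm (?DY (V b (y t))) \<le> R * M * N t" by (simp add: mult_ac)
    have "norm (D b (y t) v) \<le> R * K * N t + R * M * N t"
      unfolding eq using norm_triangle_ineq[of "V (br Y b) (y t)" "?DY (V b (y t))"] 1 2 by linarith
    then show "norm (D b (y t) v) \<le> (R * K + R * M) * (\<Sum>b\<in>B. norm (V b (y t)))"
      by (simp add: N_def distrib_right)
  next
    fix b assume "b \<in> B"
    then show "V b (y 0) = 0" using zero B(2) by (auto simp: y_def)
  qed (use b t B in auto)
  then show ?thesis using VB[OF X yU[OF t]] t by (simp add: y_def)
qed

section \<open>Connected groups and neighbourhoods of the identity\<close>

lemma (in group) inv_mult_cancel_left:
  "x \<in> carrier G \<Longrightarrow> y \<in> carrier G \<Longrightarrow> inv x \<otimes> (x \<otimes> y) = y"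
  by (simp add: m_assoc[symmetric])

text \<open>
  A subgroup that contains a neighbourhood of the identity is open, and so is its complement, as both
  are unions of translates of that neighbourhood.
\<close>

lemma connected_group_generated_by_neighbourhood:
  fixes G :: "'g monoid" (structure)
  assumes G: "group G" and T: "topspace T = carrier G" "connected_space T"
    and cont: "\<And>g. g \<in> carrier G \<Longrightarrow> continuous_map T T (\<lambda>x. g \<otimes>\<^bsub>G\<^esub> x)"
    and H: "subgroup H G" and W: "openin T W" "\<one>\<^bsub>G\<^esub> \<in> W" "W \<subseteq> H"
  shows "H = carrier G"
proof -
  interpret group G by (rule G)
  interpret H: subgroup H G by (rule H)
  have Wc: "W \<subseteq> carrier G" using W(3) H.subset by blast
  define N where "N g = {x \<in> carrier G. inv g \<otimes> x \<in> W}" for g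
  have oN: "openin T (N g)" if "g \<in> carrier G" for g
    using openin_continuous_map_preimage[OF cont[of "inv g"] W(1)] that T(1) by (simp add: N_def)
  have mem: "g \<in> N g" if "g \<in> carrier G" for g using that W(2) by (simp add: N_def)
  have NH: "x \<in> H \<longleftrightarrow> g \<in> H" if g: "g \<in> carrier G" and x: "x \<in> N g" for g x
  proof -
    have xc: "x \<in> carrier G" and w: "inv g \<otimes> x \<in> H" using x W(3) by (auto simp: N_def)
    have "x = g \<otimes> (inv g \<otimes> x)" using g xc by (simp add: m_assoc[symmetric])
    moreover have "g = x \<otimes> inv (inv g \<otimes> x)" using g xc by (simp add: inv_mult_group m_assoc[symmetric])
    ultimately show ?thesis using w H.m_closed H.m_inv_closed by metis
  qed
  have "openin T H"
  proof (subst openin_subopen, intro ballI exI conjI)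
    fix h assume h: "h \<in> H"
    then have hc: "h \<in> carrier G" by (rule H.mem_carrier)
    show "openin T (N h)" "h \<in> N h" using oN[OF hc] mem[OF hc] by simp_all
    show "N h \<subseteq> H" using NH[OF hc] h by blast
  qed
  moreover have "openin T (carrier G - H)"
  proof (subst openin_subopen, intro ballI exI conjI)
    fix h assume h: "h \<in> carrier G - H"
    then have hc: "h \<in> carrier G" by simp
    show "openin T (N h)" "h \<in> N h" using oN[OF hc] mem[OF hc] by simp_all
    show "N h \<subseteq> carrier G - H"
    proof
      fix x assume x: "x \<in> N h"
      then have "x \<in> carrier G" by (simp add: N_def)
      then show "x \<in> carrier G - H" using NH[OF hc x] h by simp
    qed
  qed
  then have "closedin T H" using H.subset T(1) by (simp add: closedin_def)
  ultimately have "H = {} \<or> H = carrier G"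
    using T(1) T(2)[unfolded connected_space_clopen_in] by auto
  then show ?thesis using H.one_closed by blast
qed

text \<open>
  For fixed \<open>s\<close> near the identity, the \<open>q \<in> Q\<close> that \<open>s\<close> conjugates into \<open>Q\<close> form a subgroup containing a
  neighbourhood, hence all of \<open>Q\<close>.  Then the \<open>s \<in> S\<close> that conjugate \<open>Q\<close> into itself, together with
  their inverses, form a subgroup containing a neighbourhood, hence all of \<open>S\<close>.
\<close>

lemma conjugation_invariant_from_neighbourhoods:
  fixes G :: "'g monoid" (structure)
  assumes G: "group G" and Q: "subgroup Q G" and S: "subgroup S G"
    and TQ: "topspace TQ = Q" "connected_space TQ" "\<And>g. g \<in> Q \<Longrightarrow> continuous_map TQ TQ (\<lambda>x. g \<otimes>\<^bsub>G\<^esub> x)"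
    and TS: "topspace TS = S" "connected_space TS" "\<And>g. g \<in> S \<Longrightarrow> continuous_map TS TS (\<lambda>x. g \<otimes>\<^bsub>G\<^esub> x)"
      "continuous_map TS TS (\<lambda>x. inv\<^bsub>G\<^esub> x)"
    and WQ: "openin TQ WQ" "\<one>\<^bsub>G\<^esub> \<in> WQ" and WS: "openin TS WS" "\<one>\<^bsub>G\<^esub> \<in> WS"
    and loc: "\<And>s q. s \<in> WS \<Longrightarrow> q \<in> WQ \<Longrightarrow> s \<otimes>\<^bsub>G\<^esub> q \<otimes>\<^bsub>G\<^esub> inv\<^bsub>G\<^esub> s \<in> Q"
    and s: "s \<in> S" and q: "q \<in> Q"
  shows "s \<otimes>\<^bsub>G\<^esub> q \<otimes>\<^bsub>G\<^esub> inv\<^bsub>G\<^esub> s \<in> Q"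
proof -
  interpret group G by (rule G)
  interpret Q: subgroup Q G by (rule Q)
  interpret S: subgroup S G by (rule S)
  define c where "c s q = s \<otimes> q \<otimes> inv s" for s q
  have c1: "c s \<one> = \<one>" if "s \<in> carrier G" for s using that by (simp add: c_def)
  have cm: "c s (q \<otimes> q') = c s q \<otimes> c s q'" if "s \<in> carrier G" "q \<in> carrier G" "q' \<in> carrier G" for s q q'
    using that by (simp add: c_def m_assoc inv_mult_cancel_left)
  have ci: "c s (inv q) = inv (c s q)" if "s \<in> carrier G" "q \<in> carrier G" for s q
    using that by (simp add: c_def inv_mult_group m_assoc)
  have cc: "c (s \<otimes> s') q = c s (c s' q)" if "s \<in> carrier G" "s' \<in> carrier G" "q \<in> carrier G" for s s' q
    using that by (simp add: c_def inv_mult_group m_assoc)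
  have full: "c s q \<in> Q" if s: "s \<in> WS" and q: "q \<in> Q" for s q
  proof -
    have sc: "s \<in> carrier G" using s openin_subset[OF WS(1)] TS(1) S.subset by blast
    let ?H = "{q \<in> Q. c s q \<in> Q}"
    have "?H = carrier (G\<lparr>carrier := Q\<rparr>)"
    proof (rule connected_group_generated_by_neighbourhood)
      show "group (G\<lparr>carrier := Q\<rparr>)" by (rule subgroup_imp_group[OF Q])
      show "topspace TQ = carrier (G\<lparr>carrier := Q\<rparr>)" "connected_space TQ" using TQ by simp_all
      show "continuous_map TQ TQ (\<lambda>x. g \<otimes>\<^bsub>G\<lparr>carrier := Q\<rparr>\<^esub> x)" if "g \<in> carrier (G\<lparr>carrier := Q\<rparr>)" for g
        using TQ(3) that by simp
      have "subgroup ?H G"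
      proof (rule subgroupI)
        show "?H \<subseteq> carrier G" using Q.subset by blast
        have "\<one> \<in> ?H" using c1[OF sc] by simp
        then show "?H \<noteq> {}" by blast
        show "inv a \<in> ?H" if "a \<in> ?H" for a using that ci[OF sc] by auto
        show "a \<otimes> b \<in> ?H" if "a \<in> ?H" "b \<in> ?H" for a b using that cm[OF sc] by auto
      qed
      then show "subgroup ?H (G\<lparr>carrier := Q\<rparr>)"
        using subgroup_incl[OF _ Q] by simp
      show "openin TQ WQ" "\<one>\<^bsub>G\<lparr>carrier := Q\<rparr>\<^esub> \<in> WQ" using WQ by simp_all
      show "WQ \<subseteq> ?H" using loc[OF s] openin_subset[OF WQ(1)] TQ(1) by (auto simp: c_def)
    qed
    then show ?thesis using q by auto
  qed
  let ?K = "{s \<in> S. \<forall>q\<in>Q. c s q \<in> Q \<and> c (inv s) q \<in> Q}"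
  have "?K = carrier (G\<lparr>carrier := S\<rparr>)"
  proof (rule connected_group_generated_by_neighbourhood)
    show "group (G\<lparr>carrier := S\<rparr>)" by (rule subgroup_imp_group[OF S])
    show "topspace TS = carrier (G\<lparr>carrier := S\<rparr>)" "connected_space TS" using TS by simp_all
    show "continuous_map TS TS (\<lambda>x. g \<otimes>\<^bsub>G\<lparr>carrier := S\<rparr>\<^esub> x)" if "g \<in> carrier (G\<lparr>carrier := S\<rparr>)" for g
      using TS(3) that by simp
    have "subgroup ?K G"
    proof (rule subgroupI)
      show "?K \<subseteq> carrier G" using S.subset by blast
      have "\<one> \<in> ?K" by (simp add: c_def)
      then show "?K \<noteq> {}" by blast
      show "inv a \<in> ?K" if "a \<in> ?K" for a using that S.subset by auto
      show "a \<otimes> b \<in> ?K" if "a \<in> ?K" "b \<in> ?K" for a b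
      proof -
        have ab: "a \<in> carrier G" "b \<in> carrier G" using that by auto
        have "c (a \<otimes> b) q = c a (c b q)" "c (inv (a \<otimes> b)) q = c (inv b) (c (inv a) q)" if "q \<in> Q" for q
          using ab that by (simp_all add: cc inv_mult_group)
        then show ?thesis using that by simp
      qed
    qed
    then show "subgroup ?K (G\<lparr>carrier := S\<rparr>)"
      using subgroup_incl[OF _ S] by simp
    \<comment> \<open>symmetric, so that it controls conjugation by \<open>s\<close> and by its inverse alike\<close>
    let ?W = "WS \<inter> {x \<in> S. inv x \<in> WS}"
    show "openin TS ?W"
      using openin_continuous_map_preimage[OF TS(4) WS(1)] TS(1) WS(1) by auto
    show "\<one>\<^bsub>G\<lparr>carrier := S\<rparr>\<^esub> \<in> ?W" using WS(2) by simp
    show "?W \<subseteq> ?K" using full by auto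
  qed
  then show ?thesis using s q unfolding c_def by auto
qed

lemma lie_group_continuous:
  assumes "lie_group G M"
  shows "topspace (mtop M) = carrier G"
    and "\<And>g. g \<in> carrier G \<Longrightarrow> continuous_map (mtop M) (mtop M) (\<lambda>x. g \<otimes>\<^bsub>G\<^esub> x)"
    and "continuous_map (mtop M) (mtop M) (\<lambda>x. inv\<^bsub>G\<^esub> x)"
proof -
  show T: "topspace (mtop M) = carrier G" using assms by (simp add: lie_group_def)
  have "continuous_map (mtop (prod_mfd M M)) (mtop M) (\<lambda>(x, y). x \<otimes>\<^bsub>G\<^esub> y)"
    using assms unfolding lie_group_def smooth_map_on_def by simp
  then have m: "continuous_map (prod_topology (mtop M) (mtop M)) (mtop M) (\<lambda>(x, y). x \<otimes>\<^bsub>G\<^esub> y)"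
    by (simp add: prod_mfd_def)
  show "continuous_map (mtop M) (mtop M) (\<lambda>x. inv\<^bsub>G\<^esub> x)"
    using assms by (simp add: lie_group_def smooth_map_on_def)
  show "continuous_map (mtop M) (mtop M) (\<lambda>x. g \<otimes>\<^bsub>G\<^esub> x)" if g: "g \<in> carrier G" for g
  proof -
    have "continuous_map (mtop M) (prod_topology (mtop M) (mtop M)) (\<lambda>x. (g, x))"
      using g T by (simp add: continuous_map_pairwise o_def)
    from continuous_map_compose[OF this m] show ?thesis by (simp add: o_def)
  qed
qed

section \<open>Smooth maps of two variables and curves in charts\<close>

lemma linear_within_extend:
  fixes f :: "'a::euclidean_space \<Rightarrow> 'b::euclidean_space"
  assumes f: "linear_within V f" and V: "subspace V"
  shows "\<exists>L. bounded_linear L \<and> (\<forall>x\<in>V. L x = f x)"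
proof -
  obtain B where B: "finite B" "B \<subseteq> V" "\<And>x. x \<in> V \<Longrightarrow> (\<Sum>b\<in>B. (x \<bullet> b) *\<^sub>R b) = x"
    using subspace_orthonormal_expansion[OF V] by metis
  have "bounded_linear (\<lambda>x. \<Sum>b\<in>B. (x \<bullet> b) *\<^sub>R f b)"
    by (intro bounded_linear_sum bounded_linear_compose[OF bounded_linear_scaleR_left bounded_linear_inner_left])
  moreover have "(\<Sum>b\<in>B. (x \<bullet> b) *\<^sub>R f b) = f x" if "x \<in> V" for x
    using linear_within_sum[OF f V B(1,2), of "\<lambda>b. x \<bullet> b"] B(3)[OF that] by simp
  ultimately show ?thesis by blast
qed

text \<open>
  Products of neighbourhoods form a basis of the product topology, so a germ in two variables has a
  representative on such a product.  The property \<open>P\<close> serves to confine its values to a given neighbourhood.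
\<close>

lemma smooth_germ_box:
  assumes A: "is_chart A" and B: "is_chart B" and g: "smooth_germ (prodc A B) C (p, q) f"
    and P: "eventually P (nhdsin (ctop C) (f (p, q)))"
  obtains V W where "openin (top_of_set (cmodel A)) V" "cmap A p \<in> V" "V \<subseteq> cmap A ` cdom A"
    "openin (top_of_set (cmodel B)) W" "cmap B q \<in> W" "W \<subseteq> cmap B ` cdom B"
    "smooth_on (cmodel A \<times> cmodel B) (V \<times> W) (\<lambda>(y, z). cmap C (f (cinv A y, cinv B z)))"
    "\<And>y z. y \<in> V \<Longrightarrow> z \<in> W \<Longrightarrow> f (cinv A y, cinv B z) \<in> cdom C \<and> P (f (cinv A y, cinv B z))"
proof -
  note g' = smooth_germD[OF g]
  let ?E = "cmodel A \<times> cmodel B" and ?p = "(cmap A p, cmap B q)"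
  have "\<forall>\<^sub>F z in nhdsin (top_of_set ?E) ?p. z \<in> cmap (prodc A B) ` cdom (prodc A B) \<and> P (f (cinv (prodc A B) z))"
    using g'(5)[OF P] unfolding eventually_chart[OF g'(1,3)] by simp
  moreover have "\<forall>\<^sub>F z in nhdsin (top_of_set ?E) ?p. f (cinv (prodc A B) z) \<in> cdom C"
    using g'(8) by (simp add: eventually_conj_iff)
  ultimately have ev: "\<forall>\<^sub>F z in nhdsin (top_of_set ?E) ?p. z \<in> cmap (prodc A B) ` cdom (prodc A B) \<and>
      f (cinv (prodc A B) z) \<in> cdom C \<and> P (f (cinv (prodc A B) z))"
    by eventually_elim simp
  have sm: "smooth_at ?E ?p (\<lambda>z. cmap C (f (cinv (prodc A B) z)))" using g'(6) by simp
  obtain O' where O: "openin (top_of_set ?E) O'" "?p \<in> O'"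
      "smooth_on ?E O' (\<lambda>z. cmap C (f (cinv (prodc A B) z)))"
      "\<And>z. z \<in> O' \<Longrightarrow> z \<in> cmap (prodc A B) ` cdom (prodc A B) \<and>
         f (cinv (prodc A B) z) \<in> cdom C \<and> P (f (cinv (prodc A B) z))"
    using smooth_at_obtain_open[OF sm ev] by metis
  obtain V W where VW: "openin (top_of_set (cmodel A)) V" "openin (top_of_set (cmodel B)) W"
      "cmap A p \<in> V" "cmap B q \<in> W" "V \<times> W \<subseteq> O'"
    using O(1,2) unfolding top_of_set_Times openin_prod_topology_alt by metis
  have im: "y \<in> cmap A ` cdom A" "z \<in> cmap B ` cdom B" if "y \<in> V" "z \<in> W" for y z
    using O(4)[of "(y, z)"] VW(5) that by auto
  have eq: "cinv (prodc A B) (y, z) = (cinv A y, cinv B z)" if "y \<in> V" "z \<in> W" for y z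
    using cinv_prodc[OF A B im[OF that]] .
  show ?thesis
  proof (rule that[OF VW(1,3) _ VW(2,4)])
    show "V \<subseteq> cmap A ` cdom A" "W \<subseteq> cmap B ` cdom B" using im VW(3,4) by blast+
    show "smooth_on ?E (V \<times> W) (\<lambda>(y, z). cmap C (f (cinv A y, cinv B z)))"
      by (rule smooth_on_cong[OF smooth_on_subset[OF O(3) VW(5)]]) (use eq in auto)
    fix y z assume yz: "y \<in> V" "z \<in> W"
    then have "(y, z) \<in> O'" using VW(5) by blast
    from O(4)[OF this] show "f (cinv A y, cinv B z) \<in> cdom C \<and> P (f (cinv A y, cinv B z))"
      by (simp add: eq[OF yz])
  qed
qed

lemma smooth_germ_cong:
  assumes f: "smooth_germ A B p f" and eq: "\<And>x. x \<in> cdom A \<Longrightarrow> g x = f x"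
  shows "smooth_germ A B p g"
  unfolding smooth_germ_def
proof (intro conjI allI impI)
  note f' = smooth_germD[OF f]
  show "is_chart A" "is_chart B" "p \<in> cdom A" "g p \<in> cdom B" using f'(1-4) eq by simp_all
  have ev: "\<forall>\<^sub>F x in nhdsin (ctop A) p. x \<in> cdom A"
    unfolding eventually_chart[OF f'(1,3)]
    using eventually_chart_image[OF f'(1,3)] by (rule eventually_mono) (simp add: cinv_in)
  show "\<forall>\<^sub>F x in nhdsin (ctop A) p. P (g x)" if P: "eventually P (nhdsin (ctop B) (g p))" for P
  proof -
    have "eventually P (nhdsin (ctop B) (f p))" using P eq[OF f'(3)] by simp
    from f'(5)[OF this] ev show ?thesis by eventually_elim (simp add: eq)
  qed
  show "smooth_at (cmodel A) (cmap A p) (\<lambda>z. cmap B (g (cinv A z)))"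
    by (rule smooth_at_cong[OF f'(6)], rule eventually_mono[OF eventually_chart_image[OF f'(1,3)]])
      (simp add: eq cinv_in)
qed

lemma eventually_in_openin:
  assumes k: "(k has_vector_derivative d) (at (0::real))" and E: "\<forall>\<^sub>F t in nhds 0. k t \<in> E"
    and U: "openin (top_of_set E) U" "k 0 \<in> U"
  shows "\<forall>\<^sub>F t in nhds 0. k t \<in> U"
proof -
  obtain T where T: "open T" "U = E \<inter> T" using U(1) openin_open by blast
  have "isCont k 0" using k by (rule has_vector_derivative_continuous)
  then have "(k \<longlongrightarrow> k 0) (nhds 0)" by (simp add: continuous_at tendsto_at_iff_tendsto_nhds)
  then have "\<forall>\<^sub>F t in nhds 0. k t \<in> T" using T U(2) by (auto dest: topological_tendstoD)
  with E show ?thesis by eventually_elim (simp add: T(2))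
qed

section \<open>A Lie group near the identity\<close>

locale lie_group_chart = 
  fixes br :: "'a::euclidean_space \<Rightarrow> 'a \<Rightarrow> 'a" and \<gg> :: "'a set"
    and G :: "'g monoid" (structure) and M :: "('g, 'e::euclidean_space) mfd"
    and \<theta> :: "'a \<Rightarrow> ('g \<Rightarrow> real) \<Rightarrow> real" and U :: "'g set" and \<phi> :: "'g \<Rightarrow> 'e"
  assumes alg: "lie_algebra br \<gg>" and LG: "lie_group G M"
    and \<theta>: "lie_algebra_of_group br \<gg> G M \<theta>"
    and U: "(U, \<phi>) \<in> atlas M" and one_U: "\<one> \<in> U"
begin

sublocale group G using LG by (simp add: lie_group_def)

abbreviation \<gamma> where "\<gamma> \<equiv> inv_into U \<phi>"

definition \<xi> :: "'a \<Rightarrow> 'e" where "\<xi> X = chart_vec \<phi> (\<theta> X)"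

lemma manifold_M: "smooth_manifold M" and topspace_M: "topspace (mtop M) = carrier G"
  using LG by (auto simp: lie_group_def)

lemmas chart_M = is_chart_mchart[OF manifold_M U]

lemma subspace_model: "subspace (model M)" using chart_subspace[OF chart_M] by simp

lemma subspace_g: "subspace \<gg>" using alg by (simp add: lie_algebra_def)

lemma U_carrier: "U \<subseteq> carrier G" using chart_dom_top[OF chart_M] topspace_M by simp

lemma \<gamma>_\<phi> [simp]: "x \<in> U \<Longrightarrow> \<gamma> (\<phi> x) = x" using cinv_cmap[OF chart_M] by simp

lemma \<theta>_tangent: "X \<in> \<gg> \<Longrightarrow> \<theta> X \<in> tangent_space M \<one>"
  using \<theta> by (auto simp: lie_algebra_of_group_def bij_betw_def)

lemma \<xi>_in: "X \<in> \<gg> \<Longrightarrow> \<xi> X \<in> model M"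
  unfolding \<xi>_def by (rule tangent_vector_is_directional_derivative(1)[OF manifold_M U one_U \<theta>_tangent])

lemma \<xi>_linear: "linear_within \<gg> \<xi>"
proof -
  have "linear_within \<gg> (\<lambda>X. \<theta> X f)" for f using \<theta> by (simp add: lie_algebra_of_group_def)
  then show ?thesis
    unfolding linear_within_def \<xi>_def chart_vec_def
    by (simp add: scaleR_add_left sum.distrib scaleR_sum_right)
qed

lemma \<xi>_inj: "X \<in> \<gg> \<Longrightarrow> \<xi> X = 0 \<Longrightarrow> X = 0"
proof -
  assume X: "X \<in> \<gg>" "\<xi> X = 0"
  have z: "0 \<in> \<gg>" using subspace_0[OF subspace_g] .
  have "\<xi> 0 = 0" using linear_within_0[OF \<xi>_linear subspace_g] .
  then have "\<theta> X = \<theta> 0"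
    using tangent_vector_eqI[OF manifold_M U one_U \<theta>_tangent[OF X(1)] \<theta>_tangent[OF z]] X(2) by (simp add: \<xi>_def)
  then show "X = 0" using \<theta> X(1) z by (auto simp: lie_algebra_of_group_def bij_betw_def inj_on_def)
qed

text \<open>
  A tangent vector is determined by its coordinates, so \<open>\<xi>\<close> is injective on \<open>\<gg>\<close>; as \<open>\<gg>\<close> has finite dimension,
  bounds on coordinate vectors are bounds on Lie algebra elements.
\<close>

lemma \<xi>_bounded_below: "\<exists>e>0. \<forall>X\<in>\<gg>. e * norm X \<le> norm (\<xi> X)"
proof -
  obtain L where L: "bounded_linear L" "\<And>x. x \<in> \<gg> \<Longrightarrow> L x = \<xi> x"
    using linear_within_extend[OF \<xi>_linear subspace_g] by blast
  have "\<forall>x\<in>\<gg>. L x = 0 \<longrightarrow> x = 0" using L(2) \<xi>_inj by simp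
  then obtain e where "e > 0" "\<forall>x\<in>\<gg>. norm (L x) \<ge> e * norm x"
    using injective_imp_isometric[OF closed_subspace[OF subspace_g] subspace_g L(1)] by blast
  then show ?thesis using L(2) by auto
qed

text \<open>
  Tangent vectors are local, so it is enough to know the coordinate expression \<open>h\<close> of \<open>f\<close> near the identity.
  This matters for left-invariant fields, which are computed only there.
\<close>

lemma \<theta>_apply:
  assumes "X \<in> \<gg>" and V: "openin (top_of_set (model M)) V" "\<phi> \<one> \<in> V"
    and sm: "smooth_on (model M) V h" and h: "(h has_derivative h') (at (\<phi> \<one>) within V)"
    and f: "\<And>z. z \<in> V \<Longrightarrow> f (\<gamma> z) = h z"
  shows "smooth_near M \<one> f" "\<theta> X f = h' (\<xi> X)"
proof -
  have "smooth_on (model M) V (\<lambda>z. f (\<gamma> z))" using sm f by (rule smooth_on_cong)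
  then show 1: "smooth_near M \<one> f"
    unfolding smooth_near_chart[OF manifold_M U one_U] smooth_at_def using V by blast
  have "((\<lambda>z. f (\<gamma> z)) has_derivative h') (at (\<phi> \<one>) within V)"
    by (rule has_derivative_transform[OF V(2) _ h]) (use f in auto)
  then show "\<theta> X f = h' (\<xi> X)"
    unfolding \<xi>_def
    using tangent_vector_is_directional_derivative(2)[OF manifold_M U one_U \<theta>_tangent[OF assms(1)] 1 V] by blast
qed

lemma subgroup_chart_data:
  fixes N :: "('g, 'f::euclidean_space) mfd"
  assumes sub: "lie_subgroup G M H N" and W: "(W, \<psi>) \<in> atlas N" "\<one> \<in> W"
  shows "is_chart (mchart N W \<psi>)" "topspace (mtop N) = H" "W \<subseteq> H" "H \<subseteq> carrier G" "smooth_manifold N"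
    "smooth_germ (mchart N W \<psi>) (mchart M U \<phi>) \<one> (\<lambda>x. x)"
    "smooth_germ (prodc (mchart N W \<psi>) (mchart N W \<psi>)) (mchart N W \<psi>) (\<one>, \<one>) (\<lambda>p. inv (fst p) \<otimes> snd p)"
proof -
  have lg: "lie_group (G\<lparr>carrier := H\<rparr>) N" and H: "subgroup H G" and im: "smooth_map N M (\<lambda>x. x)"
    using sub by (auto simp: lie_subgroup_def immersion_def)
  show N: "smooth_manifold N" and T: "topspace (mtop N) = H" using lg by (auto simp: lie_group_def)
  show CN: "is_chart (mchart N W \<psi>)" using is_chart_mchart[OF N W(1)] .
  show WH: "W \<subseteq> H" using chart_dom_top[OF CN] T by simp
  show Hc: "H \<subseteq> carrier G" using subgroup.subset[OF H] .
  have oneH: "\<one> \<in> H" using subgroup.one_closed[OF H] .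
  show "smooth_germ (mchart N W \<psi>) (mchart M U \<phi>) \<one> (\<lambda>x. x)"
    by (rule smooth_map_on_germ[OF im W(1) U CN chart_M]) (use W one_U T oneH in auto)
  have mul: "smooth_map (prod_mfd N N) N (\<lambda>(x, y). x \<otimes> y)"
    and inv': "smooth_map N N (\<lambda>x. inv\<^bsub>G\<lparr>carrier := H\<rparr>\<^esub> x)"
    using lg by (auto simp: lie_group_def)
  let ?C = "mchart N W \<psi>"
  have mg: "smooth_germ (prodc ?C ?C) ?C (\<one>, \<one>) (\<lambda>(x, y). x \<otimes> y)"
    using smooth_map_on_germ[OF mul prod_mfd_chart(1)[OF W(1) W(1)] W(1), unfolded prod_mfd_chart(2)[OF W(1) W(1)],
        OF is_chart_prodc[OF CN CN] CN, of "(\<one>, \<one>)"] W T oneH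
    by (simp add: prod_mfd_def)
  have one_inv: "inv\<^bsub>G\<lparr>carrier := H\<rparr>\<^esub> \<one> = \<one>"
    using m_inv_consistent[OF H oneH] by simp
  have ig: "smooth_germ ?C ?C \<one> (\<lambda>x. inv\<^bsub>G\<lparr>carrier := H\<rparr>\<^esub> x)"
    by (rule smooth_map_on_germ[OF inv' W(1) W(1) CN CN]) (use W T oneH one_inv in auto)
  have f: "smooth_germ (prodc ?C ?C) ?C (\<one>, \<one>) fst" and s: "smooth_germ (prodc ?C ?C) ?C (\<one>, \<one>) snd"
    using smooth_germ_fst[OF CN CN] smooth_germ_snd[OF CN CN] W(2) by auto
  have i: "smooth_germ (prodc ?C ?C) ?C (\<one>, \<one>) (\<lambda>p. inv\<^bsub>G\<lparr>carrier := H\<rparr>\<^esub> (fst p))"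
    using smooth_germ_compose[OF f, of ?C "\<lambda>x. inv\<^bsub>G\<lparr>carrier := H\<rparr>\<^esub> x"] ig by simp
  have r: "smooth_germ (prodc ?C ?C) ?C (\<one>, \<one>) (\<lambda>p. inv\<^bsub>G\<lparr>carrier := H\<rparr>\<^esub> (fst p) \<otimes> snd p)"
    using smooth_germ_compose[OF smooth_germ_Pair[OF i s], of ?C "\<lambda>(x, y). x \<otimes> y"] mg one_inv by simp
  show "smooth_germ (prodc ?C ?C) ?C (\<one>, \<one>) (\<lambda>p. inv (fst p) \<otimes> snd p)"
    by (rule smooth_germ_cong[OF r]) (use WH m_inv_consistent[OF H] in auto)
qed

text \<open>
  The tangent space of a Lie subgroup at the identity is \<open>\<hh>\<close>, and left translation carries it to every
  other point: for \<open>x\<close> near the identity the curve \<open>\<sigma> (x)\<^sup>-\<^sup>1 \<sigma> (x + t v)\<close> starts at the identity with a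
  velocity in \<open>\<hh>\<close>.  The velocity \<open>\<Xi> v x\<close> depends continuously on \<open>x\<close>, which later bounds the Lie algebra elements
  that are needed along a segment.  Conversely, every element of \<open>\<hh>\<close> is the velocity of a curve in the subgroup.
\<close>

lemma subgroup_curves:
  fixes N :: "('g, 'f::euclidean_space) mfd"
  assumes sub: "lie_subgroup G M H N" and hN: "has_lie_algebra G M \<theta> N \<hh>" and h: "\<hh> \<subseteq> \<gg>"
    and W: "(W, \<psi>) \<in> atlas N" "\<one> \<in> W"
  defines "\<sigma> \<equiv> inv_into W \<psi>"
  obtains P \<Xi> where "openin (top_of_set (model N)) P" "\<psi> \<one> \<in> P" "P \<subseteq> \<psi> ` W"
    "\<And>v. v \<in> model N \<Longrightarrow> continuous_on P (\<Xi> v)"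
    "\<And>v x. v \<in> model N \<Longrightarrow> x \<in> P \<Longrightarrow> \<Xi> v x \<in> \<xi> ` \<hh>"
    "\<And>v x. v \<in> model N \<Longrightarrow> x \<in> P \<Longrightarrow>
       ((\<lambda>t. \<phi> (inv (\<sigma> x) \<otimes> \<sigma> (x + t *\<^sub>R v))) has_vector_derivative \<Xi> v x) (at 0)"
    "\<And>v x. v \<in> model N \<Longrightarrow> x \<in> P \<Longrightarrow> \<forall>\<^sub>F t in nhds 0. inv (\<sigma> x) \<otimes> \<sigma> (x + t *\<^sub>R v) \<in> U"
    "\<And>X. X \<in> \<hh> \<Longrightarrow> \<exists>v\<in>model N. ((\<lambda>t. \<phi> (\<sigma> (\<psi> \<one> + t *\<^sub>R v))) has_vector_derivative \<xi> X) (at 0) \<and>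
        (\<forall>\<^sub>F t in nhds 0. \<sigma> (\<psi> \<one> + t *\<^sub>R v) \<in> U \<inter> H)"
proof -
  let ?E = "model N" and ?y0 = "\<psi> \<one>"
  note d = subgroup_chart_data[OF sub W]
  have subspace_model: "subspace ?E" using chart_subspace[OF d(1)] by simp
  have y0: "?y0 \<in> ?E" using cmap_in[OF d(1)] W(2) by simp
  have \<sigma>\<psi>: "\<sigma> (\<psi> x) = x" if "x \<in> W" for x using cinv_cmap[OF d(1)] that by (simp add: \<sigma>_def)
  have \<psi>\<sigma>: "\<psi> (\<sigma> y) = y" "\<sigma> y \<in> W" if "y \<in> \<psi> ` W" for y
    using that by (auto simp: \<sigma>_def f_inv_into_f inv_into_into)
  \<comment> \<open>\<open>J\<close> is the differential of the inclusion at the identity, in charts; it maps the model space onto \<open>\<xi> ` \<hh>\<close>\<close>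
  obtain V where V: "openin (top_of_set ?E) V" "?y0 \<in> V" "smooth_on ?E V (\<lambda>y. \<phi> (\<sigma> y))"
      "\<And>y. y \<in> V \<Longrightarrow> y \<in> \<psi> ` W \<and> \<sigma> y \<in> U"
    using smooth_at_obtain_open[OF smooth_germD(6)[OF d(6)] smooth_germD(8)[OF d(6)]]
    unfolding mchart_simps \<sigma>_def by metis
  obtain j' where j': "\<And>y. y \<in> V \<Longrightarrow> ((\<lambda>y. \<phi> (\<sigma> y)) has_derivative j' y) (at y within V)"
    using smooth_on_derivative[OF subspace_model V(1,3)] by metis
  define J where "J = j' ?y0"
  have J: "((\<lambda>y. \<phi> (\<sigma> y)) has_derivative J) (at ?y0 within V)" using j'[OF V(2)] by (simp add: J_def)
  have im: "smooth_map N M (\<lambda>x. x)" using sub by (auto simp: lie_subgroup_def immersion_def)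
  have push: "chart_vec \<phi> (pushforward M (\<lambda>x. x) \<one> v) = J (chart_vec \<psi> v)" if "v \<in> tangent_space N \<one>" for v
    using chart_vec_pushforward_inclusion[OF manifold_M U one_U d(5) W im J[unfolded \<sigma>_def] V(1,2) that] .
  have J1: "J w \<in> \<xi> ` \<hh>" if w: "w \<in> ?E" for w
  proof -
    obtain v where v: "v \<in> tangent_space N \<one>" "chart_vec \<psi> v = w"
      using tangent_vector_exists[OF d(5) W w] by blast
    then have "pushforward M (\<lambda>x. x) \<one> v \<in> \<theta> ` \<hh>" using hN by (auto simp: has_lie_algebra_def)
    then obtain X where X: "X \<in> \<hh>" "pushforward M (\<lambda>x. x) \<one> v = \<theta> X" by blast
    have "J w = \<xi> X" using push[OF v(1)] v(2) X(2) by (simp add: \<xi>_def)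
    then show ?thesis using X(1) by (rule image_eqI)
  qed
  have J2: "\<exists>w\<in>?E. \<xi> X = J w" if X: "X \<in> \<hh>" for X
  proof -
    have "\<theta> X \<in> pushforward M (\<lambda>x. x) \<one> ` tangent_space N \<one>" using hN X by (simp add: has_lie_algebra_def)
    then obtain v where v: "v \<in> tangent_space N \<one>" "\<theta> X = pushforward M (\<lambda>x. x) \<one> v" by blast
    then show ?thesis
      using push[OF v(1)] tangent_vector_is_directional_derivative(1)[OF d(5) W v(1)] by (auto simp: \<xi>_def)
  qed
  \<comment> \<open>the curves take values in the subgroup, so in its own chart they are given by \<open>\<Lambda>\<close>, and \<open>J\<close> carries their velocities to \<open>\<xi> ` \<hh>\<close>\<close>
  define \<Lambda> where "\<Lambda> = (\<lambda>(x, y). \<psi> (inv (\<sigma> x) \<otimes> \<sigma> y))"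
  obtain P1 P2 where P1: "openin (top_of_set ?E) P1" "?y0 \<in> P1" "P1 \<subseteq> \<psi> ` W"
      and P2: "openin (top_of_set ?E) P2" "?y0 \<in> P2" "P2 \<subseteq> \<psi> ` W"
      and sm: "smooth_on (?E \<times> ?E) (P1 \<times> P2) \<Lambda>"
      and inW: "\<And>y z. y \<in> P1 \<Longrightarrow> z \<in> P2 \<Longrightarrow> inv (\<sigma> y) \<otimes> \<sigma> z \<in> W"
    using smooth_germ_box[OF d(1) d(1) d(7), of "\<lambda>_. True"] unfolding mchart_simps \<Lambda>_def \<sigma>_def fst_conv snd_conv
    by (simp del: split_paired_All split_paired_Ex) metis
  define P where "P = P1 \<inter> P2"
  have P: "openin (top_of_set ?E) P" "?y0 \<in> P" "P \<subseteq> \<psi> ` W"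
    using P1 P2 by (auto simp: P_def)
  have PP: "P \<times> P \<subseteq> P1 \<times> P2" by (auto simp: P_def)
  have smP: "smooth_on (?E \<times> ?E) (P \<times> P) \<Lambda>" by (rule smooth_on_subset[OF sm PP])
  have EE: "subspace (?E \<times> ?E)" using subspace_model by (simp add: subspace_Times)
  have oPP: "openin (top_of_set (?E \<times> ?E)) (P \<times> P)" using P(1) by (simp add: openin_Times)
  obtain \<Lambda>' where \<Lambda>': "\<And>p. p \<in> P \<times> P \<Longrightarrow> (\<Lambda> has_derivative \<Lambda>' p) (at p within P \<times> P)"
      "\<And>v. v \<in> ?E \<times> ?E \<Longrightarrow> smooth_on (?E \<times> ?E) (P \<times> P) (\<lambda>p. \<Lambda>' p v)"
    using smooth_on_derivative[OF EE oPP smP] by metis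
  define w where "w v x = \<Lambda>' (x, x) (0, v)" for v x
  have \<Lambda>E: "\<Lambda> ` (P \<times> P) \<subseteq> ?E"
    using inW cmap_in[OF d(1)] by (auto simp: \<Lambda>_def P_def)
  have wE: "w v x \<in> ?E" if "v \<in> ?E" "x \<in> P" for v x
    unfolding w_def
    by (rule derivative_in_subspace[OF EE oPP _ _ \<Lambda>'(1) subspace_model \<Lambda>E]) (use that subspace_0[OF subspace_model] in auto)
  have lam: "((\<lambda>t. \<Lambda> (x, x + t *\<^sub>R v)) has_vector_derivative w v x) (at 0)" if "v \<in> ?E" "x \<in> P" for v x
    using derivative_along_line[OF EE oPP _ _ \<Lambda>'(1), of "(x, x)" "(0, v)"] that subspace_0[OF subspace_model]
    by (simp add: w_def)
  have line: "\<forall>\<^sub>F t in nhds 0. x + t *\<^sub>R v \<in> P" if "v \<in> ?E" "x \<in> P" for v x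
    using line_in_openin[OF subspace_model P(1) that(2,1)] .
  have lam0: "\<Lambda> (x, x) = ?y0" if "x \<in> P" for x
  proof -
    have "\<sigma> x \<in> carrier G" using \<psi>\<sigma>(2)[of x] P(3) that d(3,4) by blast
    then show ?thesis by (simp add: \<Lambda>_def)
  qed
  have lamV: "\<forall>\<^sub>F t in nhds 0. \<Lambda> (x, x + t *\<^sub>R v) \<in> V" if "v \<in> ?E" "x \<in> P" for v x
  proof (rule eventually_in_openin[OF lam[OF that] _ V(1)])
    show "\<forall>\<^sub>F t in nhds 0. \<Lambda> (x, x + t *\<^sub>R v) \<in> ?E"
      using line[OF that] by (rule eventually_mono) (use \<Lambda>E that in blast)
  qed (use lam0 V(2) that in simp)
  have \<sigma>lam: "\<sigma> (\<Lambda> (x, y)) = inv (\<sigma> x) \<otimes> \<sigma> y" if "x \<in> P" "y \<in> P" for x y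
    using inW that by (simp add: \<Lambda>_def P_def \<sigma>\<psi>)
  show ?thesis
  proof (rule that[of P "\<lambda>v x. J (w v x)"])
    show "openin (top_of_set ?E) P" "?y0 \<in> P" "P \<subseteq> \<psi> ` W" by fact+
  next
    fix v assume v: "v \<in> ?E"
    have "continuous_on (P \<times> P) (\<lambda>p. \<Lambda>' p (0, v))"
      using smooth_on_continuous[OF \<Lambda>'(2)] v subspace_0[OF subspace_model] by simp
    then have "continuous_on P (w v)"
      unfolding w_def by (rule continuous_on_compose2) (auto intro!: continuous_intros)
    then show "continuous_on P (\<lambda>x. J (w v x))"
      by (rule bounded_linear.continuous_on[OF has_derivative_bounded_linear[OF J]])
  next
    fix v x assume v: "v \<in> ?E" and x: "x \<in> P"
    show "J (w v x) \<in> \<xi> ` \<hh>" by (rule J1[OF wE[OF v x]])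
    have "((\<lambda>t. \<phi> (\<sigma> (\<Lambda> (x, x + t *\<^sub>R v)))) has_vector_derivative J (w v x)) (at 0)"
      using has_derivative_along_curve[OF lam[OF v x] lamV[OF v x], of "\<lambda>y. \<phi> (\<sigma> y)" J] J lam0[OF x] by simp
    moreover have ev: "\<forall>\<^sub>F t in nhds 0. \<sigma> (\<Lambda> (x, x + t *\<^sub>R v)) = inv (\<sigma> x) \<otimes> \<sigma> (x + t *\<^sub>R v)"
      using line[OF v x] by (rule eventually_mono) (rule \<sigma>lam[OF x])
    ultimately show "((\<lambda>t. \<phi> (inv (\<sigma> x) \<otimes> \<sigma> (x + t *\<^sub>R v))) has_vector_derivative J (w v x)) (at 0)"
      by (subst (asm) has_vector_derivative_cong_ev[where g="\<lambda>t. \<phi> (inv (\<sigma> x) \<otimes> \<sigma> (x + t *\<^sub>R v))"])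
        (auto dest: eventually_nhds_x_imp_x elim: eventually_mono)
    show "\<forall>\<^sub>F t in nhds 0. inv (\<sigma> x) \<otimes> \<sigma> (x + t *\<^sub>R v) \<in> U"
      using ev lamV[OF v x] by eventually_elim (metis V(4))
  next
    fix X assume "X \<in> \<hh>"
    then obtain v where v: "v \<in> ?E" "\<xi> X = J v" using J2 by blast
    have "((\<lambda>t. \<phi> (\<sigma> (?y0 + t *\<^sub>R v))) has_vector_derivative \<xi> X) (at 0)"
      using derivative_along_line[OF subspace_model V(1,2) v(1) J] v(2) by simp
    moreover have "\<forall>\<^sub>F t in nhds 0. \<sigma> (?y0 + t *\<^sub>R v) \<in> U \<inter> H"
      using line_in_openin[OF subspace_model V(1,2) v(1)]
    proof (rule eventually_mono)
      fix t :: real assume "?y0 + t *\<^sub>R v \<in> V"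
      then show "\<sigma> (?y0 + t *\<^sub>R v) \<in> U \<inter> H" using V(4) \<psi>\<sigma>(2) d(3) by blast
    qed
    ultimately show "\<exists>v\<in>?E. ((\<lambda>t. \<phi> (\<sigma> (?y0 + t *\<^sub>R v))) has_vector_derivative \<xi> X) (at 0) \<and>
        (\<forall>\<^sub>F t in nhds 0. \<sigma> (?y0 + t *\<^sub>R v) \<in> U \<inter> H)" using v(1) by blast
  qed
qed

end

lemma star_shaped_neighbourhood:
  fixes E :: "'e::euclidean_space set"
  assumes E: "subspace E" and U: "openin (top_of_set E) U" "x0 \<in> U"
  obtains B where "openin (top_of_set E) B" "x0 \<in> B" "B \<subseteq> U"
    "\<And>x. x \<in> B \<Longrightarrow> x - x0 \<in> E" "\<And>x t. x \<in> B \<Longrightarrow> t \<in> {0..1} \<Longrightarrow> x0 + t *\<^sub>R (x - x0) \<in> B"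
proof -
  obtain T where T: "open T" "U = E \<inter> T" using U(1) openin_open by blast
  then obtain r where r: "0 < r" "ball x0 r \<subseteq> T" using U(2) by (auto simp: open_contains_ball)
  have x0: "x0 \<in> E" using U(2) T(2) by simp
  show ?thesis
  proof (rule that[of "E \<inter> ball x0 r"])
    show "openin (top_of_set E) (E \<inter> ball x0 r)" by (simp add: openin_open_Int)
    show "x0 \<in> E \<inter> ball x0 r" using x0 r(1) by simp
    show "E \<inter> ball x0 r \<subseteq> U" using r(2) T(2) by blast
    fix x assume x: "x \<in> E \<inter> ball x0 r"
    show d: "x - x0 \<in> E" using x x0 E by (auto intro: subspace_diff)
    fix t :: real assume t: "t \<in> {0..1}"
    have "norm (t *\<^sub>R (x - x0)) \<le> norm (x - x0)" using t by (simp add: mult_left_le_one_le)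
    also have "\<dots> < r" using x by (simp add: dist_norm norm_minus_commute)
    finally have "x0 + t *\<^sub>R (x - x0) \<in> ball x0 r" by (simp add: dist_norm)
    moreover have "x0 + t *\<^sub>R (x - x0) \<in> E" using d x0 E by (auto intro: subspace_add subspace_scale)
    ultimately show "x0 + t *\<^sub>R (x - x0) \<in> E \<inter> ball x0 r" by blast
  qed
qed

lemma chart_preimage:
  assumes C: "is_chart C" and V: "openin (top_of_set (cmodel C)) V" "cmap C p \<in> V" and p: "p \<in> cdom C"
  shows "\<forall>\<^sub>F x in nhdsin (ctop C) p. x \<in> cdom C \<and> cmap C x \<in> V"
proof -
  have "openin (ctop C) {x \<in> cdom C. cmap C x \<in> V}" using C V(1) by (simp add: is_chart_def)
  then show ?thesis unfolding eventually_nhdsin using V(2) p by (intro disjI2 exI) auto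
qed

section \<open>The action of the group on its quotient by the ideal subgroup\<close>

text \<open>
  The charts \<open>\<phi>\<close>, \<open>\<eta>\<close> and \<open>\<psi>\<close> of \<open>G\<close>, \<open>Q\<close> and \<open>S\<close> at the identity are fixed; the inverses of the last two are
  \<open>\<kappa>\<close> and \<open>\<sigma>\<close>.
\<close>

locale lie_semidirect = lie_group_chart br \<gg> G M \<theta> U \<phi>
  for br :: "'a::euclidean_space \<Rightarrow> 'a \<Rightarrow> 'a" and \<gg> :: "'a set"
    and G :: "'g monoid" (structure) and M :: "('g, 'e::euclidean_space) mfd"
    and \<theta> :: "'a \<Rightarrow> ('g \<Rightarrow> real) \<Rightarrow> real" and U :: "'g set" and \<phi> :: "'g \<Rightarrow> 'e" +
  fixes \<qq> \<ss> :: "'a set" and Q S :: "'g set"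
    and MQ :: "('g, 'eq::euclidean_space) mfd" and MS :: "('g, 'es::euclidean_space) mfd"
    and UQ US :: "'g set" and \<eta> :: "'g \<Rightarrow> 'eq" and \<psi> :: "'g \<Rightarrow> 'es"
  assumes ideal: "lie_ideal br \<gg> \<qq>" and ss: "\<ss> \<subseteq> \<gg>"
    and LQ: "lie_subgroup G M Q MQ" and hQ: "has_lie_algebra G M \<theta> MQ \<qq>"
    and LS: "lie_subgroup G M S MS" and hS: "has_lie_algebra G M \<theta> MS \<ss>"
    and diffeo: "diffeomorphism (prod_mfd MQ MS) M (\<lambda>(q, s). q \<otimes> s)"
    and UQ: "(UQ, \<eta>) \<in> atlas MQ" "\<one> \<in> UQ" and US: "(US, \<psi>) \<in> atlas MS" "\<one> \<in> US"
begin

abbreviation \<kappa> where "\<kappa> \<equiv> inv_into UQ \<eta>"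
abbreviation \<sigma> where "\<sigma> \<equiv> inv_into US \<psi>"
abbreviation "CG \<equiv> mchart M U \<phi>"
abbreviation "CQ \<equiv> mchart MQ UQ \<eta>"
abbreviation "CS \<equiv> mchart MS US \<psi>"

lemmas Q_chart = subgroup_chart_data[OF LQ UQ]
lemmas S_chart = subgroup_chart_data[OF LS US]

lemma qq: "\<qq> \<subseteq> \<gg>" using ideal by (simp add: lie_ideal_def)

lemma subspace_model_S: "subspace (model MS)" using chart_subspace[OF S_chart(1)] by simp
lemma subspace_model_Q: "subspace (model MQ)" using chart_subspace[OF Q_chart(1)] by simp

lemma sub_Q: "subgroup Q G" and sub_S: "subgroup S G"
  using LQ LS by (auto simp: lie_subgroup_def)

sublocale Q: subgroup Q G by (rule sub_Q)
sublocale S: subgroup S G by (rule sub_S)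

lemma \<sigma>_\<psi> [simp]: "s \<in> US \<Longrightarrow> \<sigma> (\<psi> s) = s" using cinv_cmap[OF S_chart(1)] by simp
lemma \<kappa>_\<eta> [simp]: "q \<in> UQ \<Longrightarrow> \<kappa> (\<eta> q) = q" using cinv_cmap[OF Q_chart(1)] by simp
lemma \<sigma>_in: "y \<in> \<psi> ` US \<Longrightarrow> \<sigma> y \<in> US" by (rule inv_into_into)
lemma \<kappa>_in: "y \<in> \<eta> ` UQ \<Longrightarrow> \<kappa> y \<in> UQ" by (rule inv_into_into)
lemma \<psi>_\<sigma>: "y \<in> \<psi> ` US \<Longrightarrow> \<psi> (\<sigma> y) = y" by (rule f_inv_into_f)
lemma \<psi>_in: "s \<in> US \<Longrightarrow> \<psi> s \<in> model MS" using cmap_in[OF S_chart(1)] by simp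

lemma \<sigma>_carrier: "y \<in> \<psi> ` US \<Longrightarrow> \<sigma> y \<in> S" using \<sigma>_in S_chart(3) by blast
lemma \<kappa>_carrier: "y \<in> \<eta> ` UQ \<Longrightarrow> \<kappa> y \<in> Q" using \<kappa>_in Q_chart(3) by blast

lemma bij: "bij_betw (\<lambda>(q, s). q \<otimes> s) (Q \<times> S) (carrier G)"
proof -
  have "topspace (mtop (prod_mfd MQ MS)) = Q \<times> S" using Q_chart(2) S_chart(2) by (simp add: prod_mfd_def)
  then show ?thesis using diffeo topspace_M by (simp add: diffeomorphism_def)
qed

text \<open>
  The projection \<open>q s \<mapsto> s\<close>, which identifies \<open>S\<close> with the space of cosets \<open>Q g\<close>.
\<close>

definition \<pi> :: "'g \<Rightarrow> 'g" where
  "\<pi> x = snd (inv_into (Q \<times> S) (\<lambda>(q, s). q \<otimes> s) x)"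

lemma inv_mult_map: "q \<in> Q \<Longrightarrow> s \<in> S \<Longrightarrow> inv_into (Q \<times> S) (\<lambda>(q, s). q \<otimes> s) (q \<otimes> s) = (q, s)"
  using inv_into_f_f[OF bij_betw_imp_inj_on[OF bij], of "(q, s)"] by simp

lemma \<pi>_mult [simp]: "q \<in> Q \<Longrightarrow> s \<in> S \<Longrightarrow> \<pi> (q \<otimes> s) = s"
  by (simp add: \<pi>_def inv_mult_map)

lemma \<pi>_S [simp]: "s \<in> S \<Longrightarrow> \<pi> s = s"
  using \<pi>_mult[of \<one> s] by simp

lemma \<pi>_Q: "q \<in> Q \<Longrightarrow> \<pi> q = \<one>"
  using \<pi>_mult[of q \<one>] by simp

lemma decomp:
  assumes "x \<in> carrier G"
  obtains q where "q \<in> Q" "\<pi> x \<in> S" "x = q \<otimes> \<pi> x"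
proof -
  have "x \<in> (\<lambda>(q, s). q \<otimes> s) ` (Q \<times> S)" using assms bij_betw_imp_surj_on[OF bij] by simp
  then obtain q s where "q \<in> Q" "s \<in> S" "x = q \<otimes> s" by auto
  then show ?thesis using that[of q] by simp
qed

text \<open>
  Left multiplication by an element of \<open>Q\<close> does not change \<open>\<pi>\<close>, and \<open>x\<close> differs from \<open>\<pi> x\<close> by such an element.
  This is the law of a right action for \<open>(s, g) \<mapsto> \<pi> (s g)\<close>.
\<close>

lemma \<pi>_action: 
  assumes x: "x \<in> carrier G" and y: "y \<in> carrier G"
  shows "\<pi> (\<pi> x \<otimes> y) = \<pi> (x \<otimes> y)"
proof -
  obtain q where q: "q \<in> Q" "\<pi> x \<in> S" "x = q \<otimes> \<pi> x" using decomp[OF x] .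
  obtain q' where q': "q' \<in> Q" "\<pi> (\<pi> x \<otimes> y) \<in> S" "\<pi> x \<otimes> y = q' \<otimes> \<pi> (\<pi> x \<otimes> y)"
    using decomp[of "\<pi> x \<otimes> y"] q(2) y by auto
  have "x \<otimes> y = q \<otimes> (\<pi> x \<otimes> y)"
    using q y by (metis Q.mem_carrier S.mem_carrier m_assoc)
  also have "\<dots> = (q \<otimes> q') \<otimes> \<pi> (\<pi> x \<otimes> y)"
    using q' q(1) by (metis Q.mem_carrier S.mem_carrier m_assoc)
  finally show ?thesis using q(1) q'(1,2) by simp
qed

lemma germ_\<pi>: "smooth_germ CG CS \<one> \<pi>"
proof -
  let ?i = "inv_into (Q \<times> S) (\<lambda>(q, s). q \<otimes> s)"
  have ts: "topspace (mtop (prod_mfd MQ MS)) = Q \<times> S" using Q_chart(2) S_chart(2) by (simp add: prod_mfd_def)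
  have sm: "smooth_map M (prod_mfd MQ MS) ?i"
    using diffeo unfolding diffeomorphism_def ts by blast
  have i1: "?i \<one> = (\<one>, \<one>)" using inv_mult_map[of \<one> \<one>] by simp
  have "smooth_germ CG (prodc CQ CS) \<one> ?i"
    using smooth_map_on_germ[OF sm U prod_mfd_chart(1)[OF UQ(1) US(1)] chart_M,
        unfolded prod_mfd_chart(2)[OF UQ(1) US(1)], OF is_chart_prodc[OF Q_chart(1) S_chart(1)] one_U]
      i1 UQ(2) US(2) topspace_M by simp
  from smooth_germ_compose[OF this, of CS snd] smooth_germ_snd[OF Q_chart(1) S_chart(1), of \<one> \<one>] i1 UQ(2) US(2)
  show ?thesis by (simp add: \<pi>_def[abs_def])
qed

lemma germ_action:
  assumes a: "smooth_germ A CG p a" "a p = \<one>" and b: "smooth_germ A CG p b" "b p = \<one>"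
  shows "smooth_germ A CS p (\<lambda>x. \<pi> (a x \<otimes> b x))"
proof -
  have mul: "smooth_map (prod_mfd M M) M (\<lambda>(x, y). x \<otimes> y)"
    using LG by (auto simp: lie_group_def)
  have mg: "smooth_germ (prodc CG CG) CG (\<one>, \<one>) (\<lambda>(x, y). x \<otimes> y)"
    using smooth_map_on_germ[OF mul prod_mfd_chart(1)[OF U U] U, unfolded prod_mfd_chart(2)[OF U U],
        OF is_chart_prodc[OF chart_M chart_M] chart_M, of "(\<one>, \<one>)"] one_U topspace_M
    by (simp add: prod_mfd_def)
  have "smooth_germ A CG p (\<lambda>x. a x \<otimes> b x)"
    using smooth_germ_compose[OF smooth_germ_Pair[OF a(1) b(1)], of CG "\<lambda>(x, y). x \<otimes> y"] mg a(2) b(2) by simp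
  from smooth_germ_compose[OF this, of CS \<pi>] germ_\<pi> a(2) b(2) show ?thesis by simp
qed

lemma germ_SG: "smooth_germ (prodc CS CG) CS (\<one>, \<one>) (\<lambda>p. \<pi> (fst p \<otimes> snd p))"
proof (rule germ_action)
  have f: "smooth_germ (prodc CS CG) CS (\<one>, \<one>) fst" and s: "smooth_germ (prodc CS CG) CG (\<one>, \<one>) snd"
    using smooth_germ_fst[OF S_chart(1) chart_M] smooth_germ_snd[OF S_chart(1) chart_M] US(2) one_U by auto
  show "smooth_germ (prodc CS CG) CG (\<one>, \<one>) snd" by (rule s)
  show "smooth_germ (prodc CS CG) CG (\<one>, \<one>) fst"
    using smooth_germ_compose[OF f, of CG "\<lambda>x. x"] S_chart(6) by simp
qed simp_all

lemma germ_SQ: "smooth_germ (prodc CS CQ) CS (\<one>, \<one>) (\<lambda>p. \<pi> (fst p \<otimes> snd p))"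
proof (rule germ_action)
  have f: "smooth_germ (prodc CS CQ) CS (\<one>, \<one>) fst" and s: "smooth_germ (prodc CS CQ) CQ (\<one>, \<one>) snd"
    using smooth_germ_fst[OF S_chart(1) Q_chart(1)] smooth_germ_snd[OF S_chart(1) Q_chart(1)] US(2) UQ(2) by auto
  show "smooth_germ (prodc CS CQ) CG (\<one>, \<one>) snd"
    using smooth_germ_compose[OF s, of CG "\<lambda>x. x"] Q_chart(6) by simp
  show "smooth_germ (prodc CS CQ) CG (\<one>, \<one>) fst"
    using smooth_germ_compose[OF f, of CG "\<lambda>x. x"] S_chart(6) by simp
qed simp_all

text \<open>
  The right action of \<open>G\<close> on \<open>S\<close>, in charts.
\<close>

definition act :: "'es \<times> 'e \<Rightarrow> 'es" where
  "act = (\<lambda>(y, z). \<psi> (\<pi> (\<sigma> y \<otimes> \<gamma> z)))"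

definition act_box :: "'es set \<Rightarrow> 'e set \<Rightarrow> bool" where
  "act_box V W \<longleftrightarrow> openin (top_of_set (model MS)) V \<and> \<psi> \<one> \<in> V \<and> V \<subseteq> \<psi> ` US \<and>
     openin (top_of_set (model M)) W \<and> \<phi> \<one> \<in> W \<and> W \<subseteq> \<phi> ` U \<and>
     smooth_on (model MS \<times> model M) (V \<times> W) act \<and>
     (\<forall>y\<in>V. \<forall>z\<in>W. \<pi> (\<sigma> y \<otimes> \<gamma> z) \<in> US)"

lemma act_box_exists: "\<exists>V W. act_box V W"
proof -
  obtain V W where "openin (top_of_set (model MS)) V" "\<psi> \<one> \<in> V" "V \<subseteq> \<psi> ` US"
     "openin (top_of_set (model M)) W" "\<phi> \<one> \<in> W" "W \<subseteq> \<phi> ` U"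
     "smooth_on (model MS \<times> model M) (V \<times> W) act"
     and in_US: "\<And>y z. y \<in> V \<Longrightarrow> z \<in> W \<Longrightarrow> \<pi> (\<sigma> y \<otimes> \<gamma> z) \<in> US \<and> True"
    using smooth_germ_box[OF S_chart(1) chart_M germ_SG, of "\<lambda>_. True"] unfolding mchart_simps act_def fst_conv snd_conv
    by (simp del: split_paired_All split_paired_Ex) metis
  then have "act_box V W" unfolding act_box_def by simp
  then show ?thesis by blast
qed

context
  fixes V :: "'es set" and W :: "'e set"
  assumes box: "act_box V W"
begin

lemma V: "openin (top_of_set (model MS)) V" "\<psi> \<one> \<in> V" "V \<subseteq> \<psi> ` US"
  and W: "openin (top_of_set (model M)) W" "\<phi> \<one> \<in> W" "W \<subseteq> \<phi> ` U"
  and act_smooth: "smooth_on (model MS \<times> model M) (V \<times> W) act"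
  and act_US: "\<And>y z. y \<in> V \<Longrightarrow> z \<in> W \<Longrightarrow> \<pi> (\<sigma> y \<otimes> \<gamma> z) \<in> US"
  using box by (simp_all add: act_box_def)

lemma ESG: "subspace (model MS \<times> model M)" using subspace_model_S subspace_model by (rule subspace_Times)

lemma VW: "openin (top_of_set (model MS \<times> model M)) (V \<times> W)"
  using V(1) W(1) by (simp add: openin_Times)

lemma act_in: "y \<in> V \<Longrightarrow> z \<in> W \<Longrightarrow> act (y, z) \<in> model MS"
  using act_US \<psi>_in by (simp add: act_def)

lemma \<sigma>_V:
  assumes "y \<in> V"
  shows "\<sigma> y \<in> S" "\<sigma> y \<in> carrier G" "\<psi> (\<sigma> y) = y"
proof -
  have y: "y \<in> \<psi> ` US" using assms V(3) by (rule rev_subsetD)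
  show S: "\<sigma> y \<in> S" by (rule \<sigma>_carrier[OF y])
  show "\<sigma> y \<in> carrier G" by (rule S.mem_carrier[OF S])
  show "\<psi> (\<sigma> y) = y" by (rule \<psi>_\<sigma>[OF y])
qed

lemma \<gamma>_W:
  assumes "z \<in> W"
  shows "\<gamma> z \<in> carrier G"
  using subsetD[OF U_carrier inv_into_into[OF subsetD[OF W(3) assms]]] .

lemma act_base:
  assumes "y \<in> V"
  shows "act (y, \<phi> \<one>) = y"
proof -
  have "act (y, \<phi> \<one>) = \<psi> (\<pi> (\<sigma> y \<otimes> \<one>))" using one_U by (simp add: act_def)
  then show ?thesis using \<sigma>_V[OF assms] by simp
qed

text \<open>
  The derivative is determined only in the directions of the model spaces, so one derivative with smooth
  values is chosen once and for all.
\<close>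

definition act' :: "'es \<times> 'e \<Rightarrow> 'es \<times> 'e \<Rightarrow> 'es" where
  "act' = (SOME D. (\<forall>p\<in>V \<times> W. (act has_derivative D p) (at p within V \<times> W)) \<and>
     (\<forall>w\<in>model MS \<times> model M. smooth_on (model MS \<times> model M) (V \<times> W) (\<lambda>p. D p w)))"

lemma act': "\<And>p. p \<in> V \<times> W \<Longrightarrow> (act has_derivative act' p) (at p within V \<times> W)"
  "\<And>w. w \<in> model MS \<times> model M \<Longrightarrow> smooth_on (model MS \<times> model M) (V \<times> W) (\<lambda>p. act' p w)"
proof -
  have "\<exists>D. (\<forall>p\<in>V \<times> W. (act has_derivative D p) (at p within V \<times> W)) \<and>
     (\<forall>w\<in>model MS \<times> model M. smooth_on (model MS \<times> model M) (V \<times> W) (\<lambda>p. D p w))"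
    using smooth_on_derivative[OF ESG VW act_smooth] by metis
  from someI_ex[OF this, folded act'_def]
  show "\<And>p. p \<in> V \<times> W \<Longrightarrow> (act has_derivative act' p) (at p within V \<times> W)"
    "\<And>w. w \<in> model MS \<times> model M \<Longrightarrow> smooth_on (model MS \<times> model M) (V \<times> W) (\<lambda>p. act' p w)"
    by blast+
qed

text \<open>
  The vector field on \<open>S\<close>, in the chart, by which \<open>X\<close> acts.
\<close>

definition field :: "'a \<Rightarrow> 'es \<Rightarrow> 'es" where
  "field X y = act' (y, \<phi> \<one>) (0, \<xi> X)"

lemma act_partial:
  assumes y: "y \<in> V"
  shows "((\<lambda>z. act (y, z)) has_derivative (\<lambda>w. act' (y, \<phi> \<one>) (0, w))) (at (\<phi> \<one>) within W)"
proof -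
  have 1: "((\<lambda>z. (y, z)) has_derivative (\<lambda>w. (0, w))) (at (\<phi> \<one>) within W)"
    by (auto intro!: derivative_eq_intros)
  show ?thesis
    by (rule has_derivative_in_compose[OF 1 has_derivative_subset[OF act'(1)]]) (use y W(2) in auto)
qed

lemma act_partial_smooth:
  assumes y: "y \<in> V"
  shows "smooth_on (model M) W (\<lambda>z. act (y, z))"
proof (rule smooth_on_compose[OF subspace_model W(1) ESG openin_imp_subset[OF VW] _ act_smooth])
  show "smooth_on (model M) W (\<lambda>z. (y, z))"
    unfolding smooth_on_def by (intro allI Ck_on_Pair Ck_on_const Ck_on_id)
qed (use y in auto)

text \<open>
  The field of \<open>X\<close> is the velocity of the orbit of \<open>y\<close> under any curve in \<open>G\<close> that leaves the identity
  with velocity \<open>X\<close>.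
\<close>

lemma action_derivative:
  assumes y: "y \<in> V" and c: "c 0 = \<one>" "\<forall>\<^sub>F t in nhds (0::real). c t \<in> U"
    and d: "((\<lambda>t. \<phi> (c t)) has_vector_derivative \<xi> X) (at 0)"
  shows "((\<lambda>t. \<psi> (\<pi> (\<sigma> y \<otimes> c t))) has_vector_derivative field X y) (at 0)"
proof -
  have ev: "\<forall>\<^sub>F t in nhds 0. \<phi> (c t) \<in> model M"
    using c(2) by (rule eventually_mono) (use cmap_in[OF chart_M] in simp)
  have "\<forall>\<^sub>F t in nhds 0. \<phi> (c t) \<in> W"
    by (rule eventually_in_openin[OF d ev W(1)]) (use c(1) W(2) in simp)
  then have "((\<lambda>t. act (y, \<phi> (c t))) has_vector_derivative act' (y, \<phi> \<one>) (0, \<xi> X)) (at 0)"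
    using has_derivative_along_curve[OF d, of W "\<lambda>z. act (y, z)"] act_partial[OF y] c(1) by simp
  moreover have eq: "\<forall>\<^sub>F t in nhds 0. act (y, \<phi> (c t)) = \<psi> (\<pi> (\<sigma> y \<otimes> c t))"
    using c(2) by (rule eventually_mono) (simp add: act_def)
  ultimately show ?thesis
    unfolding field_def
    by (subst (asm) has_vector_derivative_cong_ev[where g="\<lambda>t. \<psi> (\<pi> (\<sigma> y \<otimes> c t))"])
      (auto dest: eventually_nhds_x_imp_x elim: eventually_mono)
qed

lemma field_in:
  assumes X: "X \<in> \<gg>" and y: "y \<in> V"
  shows "field X y \<in> model MS"
  unfolding field_def
  by (rule derivative_in_subspace[OF subspace_model W(1,2) \<xi>_in[OF X] act_partial[OF y] subspace_model_S]) (use act_in[OF y] in auto)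

lemma field_linear: "y \<in> V \<Longrightarrow> linear_within \<gg> (\<lambda>X. field X y)"
proof -
  assume y: "y \<in> V"
  have l: "linear (\<lambda>w. act' (y, \<phi> \<one>) (0, w))" using act_partial[OF y] by (rule has_derivative_linear)
  show ?thesis
    using \<xi>_linear linear_add[OF l] linear_scale[OF l] unfolding linear_within_def field_def by simp
qed

lemma field_smooth: "X \<in> \<gg> \<Longrightarrow> smooth_on (model MS) V (field X)"
  unfolding field_def[abs_def]
proof (rule smooth_on_compose[OF subspace_model_S V(1) ESG openin_imp_subset[OF VW] _ act'(2)])
  show "smooth_on (model MS) V (\<lambda>y. (y, \<phi> \<one>))"
    unfolding smooth_on_def by (intro allI Ck_on_Pair Ck_on_const Ck_on_id)
qed (use W(2) \<xi>_in subspace_0[OF subspace_model_S] in auto)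

text \<open>
  The components of the field of \<open>X\<close> arise by applying \<open>X\<close> to the coordinates of the orbit map \<open>g \<mapsto> y \<cdot> g\<close>.
  Prescribing \<open>f\<close> on \<open>W\<close> only makes the result applicable to left translates of such coordinates.
\<close>

lemma \<theta>_orbit_function:
  assumes X: "X \<in> \<gg>" and y: "y \<in> V" and f: "\<And>z. z \<in> W \<Longrightarrow> f (\<gamma> z) = act (y, z) \<bullet> e"
  shows "smooth_near M \<one> f" "\<theta> X f = field X y \<bullet> e"
proof -
  have "smooth_on (model M) W (\<lambda>z. act (y, z) \<bullet> e)"
    using act_partial_smooth[OF y] Ck_on_linear_after[OF bounded_linear_inner_left]
    unfolding smooth_on_def by fast
  from \<theta>_apply[OF X W(1,2) this bounded_linear.has_derivative[OF bounded_linear_inner_left act_partial[OF y]] f]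
  show "smooth_near M \<one> f" "\<theta> X f = field X y \<bullet> e" by (simp_all add: field_def)
qed

text \<open>
  By the action law, the orbit map of \<open>y\<close> composed with left translation by \<open>g\<close> is the orbit map of
  the point \<open>y \<cdot> g\<close>.  Hence the left-invariant field of \<open>X\<close> turns the coordinates of the orbit map into the function
  \<open>g \<mapsto> V\<^sub>X (y \<cdot> g)\<close>, to which \<open>Y\<close> is applied by the chain rule.
\<close>

lemma \<theta>_left_inv_field:
  assumes X: "X \<in> \<gg>" and Y: "Y \<in> \<gg>" and y: "y \<in> V"
    and D: "(field X has_derivative D) (at y within V)"
  shows "\<theta> Y (left_inv_field G (\<theta> X) (\<lambda>h. \<psi> (\<pi> (\<sigma> y \<otimes> h)) \<bullet> e)) = D (field Y y) \<bullet> e"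
proof -
  \<comment> \<open>the field of \<open>X\<close> is evaluated at the moved point \<open>y \<cdot> g\<close>, which must stay in \<open>V\<close>\<close>
  define W' where "W' = W \<inter> (\<lambda>z. act (y, z)) -` V"
  have "openin (top_of_set W) W'"
    unfolding W'_def
    by (rule continuous_openin_preimage[OF smooth_on_continuous[OF act_partial_smooth[OF y]] _ V(1)])
      (use act_in[OF y] in auto)
  then have oW': "openin (top_of_set (model M)) W'" using W(1) openin_trans by blast
  have 1: "\<phi> \<one> \<in> W'" using W(2) act_base[OF y] y by (simp add: W'_def)
  have "smooth_on (model M) W' (\<lambda>z. field X (act (y, z)))"
    by (rule smooth_on_compose[OF subspace_model oW' subspace_model_S openin_imp_subset[OF V(1)] _ field_smooth[OF X]
          smooth_on_subset[OF act_partial_smooth[OF y]]]) (auto simp: W'_def)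
  then have sm: "smooth_on (model M) W' (\<lambda>z. field X (act (y, z)) \<bullet> e)"
    using Ck_on_linear_after[OF bounded_linear_inner_left] unfolding smooth_on_def by fast
  have p: "((\<lambda>z. act (y, z)) has_derivative (\<lambda>w. act' (y, \<phi> \<one>) (0, w))) (at (\<phi> \<one>) within W')"
    by (rule has_derivative_subset[OF act_partial[OF y]]) (simp add: W'_def)
  have "(field X has_derivative D) (at (act (y, \<phi> \<one>)) within (\<lambda>z. act (y, z)) ` W')"
    unfolding act_base[OF y] by (rule has_derivative_subset[OF D]) (auto simp: W'_def)
  then have der: "((\<lambda>z. field X (act (y, z)) \<bullet> e) has_derivative (\<lambda>w. D (act' (y, \<phi> \<one>) (0, w)) \<bullet> e)) (at (\<phi> \<one>) within W')"
    by (intro bounded_linear.has_derivative[OF bounded_linear_inner_left] has_derivative_in_compose[OF p])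
  have eq: "left_inv_field G (\<theta> X) (\<lambda>h. \<psi> (\<pi> (\<sigma> y \<otimes> h)) \<bullet> e) (\<gamma> z) = field X (act (y, z)) \<bullet> e"
    if z: "z \<in> W'" for z
    unfolding left_inv_field_def
  proof (rule \<theta>_orbit_function(2)[OF X])
    have zW: "z \<in> W" using z by (simp add: W'_def)
    show "act (y, z) \<in> V" using z by (simp add: W'_def)
    fix z' assume z': "z' \<in> W"
    have "\<sigma> (act (y, z)) = \<pi> (\<sigma> y \<otimes> \<gamma> z)" using act_US[OF y zW] by (simp add: act_def)
    then have "\<pi> (\<sigma> (act (y, z)) \<otimes> \<gamma> z') = \<pi> (\<sigma> y \<otimes> (\<gamma> z \<otimes> \<gamma> z'))"
      using \<pi>_action[of "\<sigma> y \<otimes> \<gamma> z" "\<gamma> z'"] \<sigma>_V(2)[OF y] \<gamma>_W[OF zW] \<gamma>_W[OF z'] by (simp add: m_assoc)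
    then show "\<psi> (\<pi> (\<sigma> y \<otimes> (\<gamma> z \<otimes> \<gamma> z'))) \<bullet> e = act (act (y, z), z') \<bullet> e"
      by (simp add: act_def)
  qed
  show ?thesis
    using \<theta>_apply(2)[OF Y oW' 1 sm der eq] by (simp add: field_def)
qed

text \<open>
  The bracket of \<open>\<gg>\<close> is the commutator of left-invariant fields at the identity.  Applied to the coordinates of the
  orbit map of \<open>y\<close>, its two terms are the directional derivatives of one field along the other, and second
  derivatives of the action do not appear.
\<close>

lemma field_bracket:
  assumes X: "X \<in> \<gg>" and Y: "Y \<in> \<gg>" and y: "y \<in> V"
    and D: "(field X has_derivative D) (at y within V)" and D': "(field Y has_derivative D') (at y within V)"
  shows "field (br Y X) y = D (field Y y) - D' (field X y)"
proof (rule euclidean_eqI)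
  fix e :: 'es
  define f where "f h = \<psi> (\<pi> (\<sigma> y \<otimes> h)) \<bullet> e" for h
  have br: "br Y X \<in> \<gg>" using alg X Y unfolding lie_algebra_def by blast
  have f: "f (\<gamma> z) = act (y, z) \<bullet> e" for z by (simp add: f_def act_def)
  have "field (br Y X) y \<bullet> e = \<theta> (br Y X) f"
    using \<theta>_orbit_function(2)[OF br y f] by simp
  also have "\<theta> (br Y X) = lie_group_bracket G M (\<theta> Y) (\<theta> X)"
    using \<theta> X Y unfolding lie_algebra_of_group_def by blast
  also have "lie_group_bracket G M (\<theta> Y) (\<theta> X) f = \<theta> Y (left_inv_field G (\<theta> X) f) - \<theta> X (left_inv_field G (\<theta> Y) f)"
    using \<theta>_orbit_function(1)[OF X y f] by (simp add: lie_group_bracket_def)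
  also have "\<dots> = D (field Y y) \<bullet> e - D' (field X y) \<bullet> e"
    using \<theta>_left_inv_field[OF X Y y D] \<theta>_left_inv_field[OF Y X y D'] unfolding f_def[abs_def] by simp
  finally show "field (br Y X) y \<bullet> e = (D (field Y y) - D' (field X y)) \<bullet> e" by (simp add: inner_diff_left)
qed

text \<open>
  The curves in \<open>Q\<close> do not move the trivial coset.
\<close>

lemma field_zero_at_base:
  assumes X: "X \<in> \<qq>"
  shows "field X (\<psi> \<one>) = 0"
proof -
  obtain v where v: "v \<in> model MQ"
      "((\<lambda>t. \<phi> (\<kappa> (\<eta> \<one> + t *\<^sub>R v))) has_vector_derivative \<xi> X) (at 0)"
      "\<forall>\<^sub>F t in nhds 0. \<kappa> (\<eta> \<one> + t *\<^sub>R v) \<in> U \<inter> Q"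
    using subgroup_curves[OF LQ hQ qq UQ] X by metis
  have "((\<lambda>t. \<psi> (\<pi> (\<sigma> (\<psi> \<one>) \<otimes> \<kappa> (\<eta> \<one> + t *\<^sub>R v)))) has_vector_derivative field X (\<psi> \<one>)) (at 0)"
    by (rule action_derivative[OF V(2) _ _ v(2)]) (use UQ(2) v(3) in \<open>auto elim: eventually_mono\<close>)
  moreover have ev: "\<forall>\<^sub>F t in nhds 0. \<psi> (\<pi> (\<sigma> (\<psi> \<one>) \<otimes> \<kappa> (\<eta> \<one> + t *\<^sub>R v))) = \<psi> \<one>"
    using v(3) by (rule eventually_mono) (simp add: US(2) \<pi>_Q)
  ultimately have "((\<lambda>t. \<psi> \<one>) has_vector_derivative field X (\<psi> \<one>)) (at (0::real))"
    by (subst (asm) has_vector_derivative_cong_ev[where g="\<lambda>t. \<psi> \<one>"])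
      (auto dest: eventually_nhds_x_imp_x elim: eventually_mono)
  then show ?thesis using vector_derivative_unique_at[OF _ has_vector_derivative_const] by blast
qed

text \<open>
  The points near the identity are joined to it by segments in the chart.  At a point \<open>x\<close> of such a segment, the curve
  \<open>\<sigma> (x)\<^sup>-\<^sup>1 \<sigma> (x + t v)\<close> in \<open>S\<close> moves \<open>x\<close> to \<open>x + t v\<close>, so its velocity \<open>Y \<in> \<ss>\<close> satisfies \<open>V\<^sub>Y x = v\<close>.
\<close>

lemma field_vanishes_near_base:
  obtains B where "openin (top_of_set (model MS)) B" "\<psi> \<one> \<in> B" "B \<subseteq> V"
    "\<And>X y. X \<in> \<qq> \<Longrightarrow> y \<in> B \<Longrightarrow> field X y = 0"
proof -
  obtain P \<Xi> where P: "openin (top_of_set (model MS)) P" "\<psi> \<one> \<in> P" "P \<subseteq> \<psi> ` US"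
    and \<Xi>: "\<And>v. v \<in> model MS \<Longrightarrow> continuous_on P (\<Xi> v)"
    "\<And>v x. v \<in> model MS \<Longrightarrow> x \<in> P \<Longrightarrow> \<Xi> v x \<in> \<xi> ` \<ss>"
    "\<And>v x. v \<in> model MS \<Longrightarrow> x \<in> P \<Longrightarrow>
       ((\<lambda>t. \<phi> (inv (\<sigma> x) \<otimes> \<sigma> (x + t *\<^sub>R v))) has_vector_derivative \<Xi> v x) (at 0)"
    "\<And>v x. v \<in> model MS \<Longrightarrow> x \<in> P \<Longrightarrow> \<forall>\<^sub>F t in nhds 0. inv (\<sigma> x) \<otimes> \<sigma> (x + t *\<^sub>R v) \<in> U"
    by (rule subgroup_curves[OF LS hS ss US]) (rule that)
  have PV: "openin (top_of_set (model MS)) (P \<inter> V)" using P(1) V(1) by (rule openin_Int)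
  obtain B where B: "openin (top_of_set (model MS)) B" "\<psi> \<one> \<in> B" "B \<subseteq> P \<inter> V"
    "\<And>x. x \<in> B \<Longrightarrow> x - \<psi> \<one> \<in> model MS"
    "\<And>x t. x \<in> B \<Longrightarrow> t \<in> {0..1} \<Longrightarrow> \<psi> \<one> + t *\<^sub>R (x - \<psi> \<one>) \<in> B"
    using star_shaped_neighbourhood[OF subspace_model_S PV] P(2) V(2) by blast
  have span: "field Y x = v" if "v \<in> model MS" "x \<in> P" "x \<in> V" "\<xi> Y = \<Xi> v x" for v x Y
  proof -
    have xc: "\<sigma> x \<in> S" using \<sigma>_V that(3) by blast
    have "((\<lambda>t. \<psi> (\<pi> (\<sigma> x \<otimes> (inv (\<sigma> x) \<otimes> \<sigma> (x + t *\<^sub>R v))))) has_vector_derivative field Y x) (at 0)"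
      by (rule action_derivative[OF that(3) _ \<Xi>(4)[OF that(1,2)]]) (use \<Xi>(3)[OF that(1,2)] that(4) xc in simp_all)
    moreover have ev: "\<forall>\<^sub>F t in nhds 0. \<psi> (\<pi> (\<sigma> x \<otimes> (inv (\<sigma> x) \<otimes> \<sigma> (x + t *\<^sub>R v)))) = x + t *\<^sub>R v"
      using line_in_openin[OF subspace_model_S P(1) that(2,1)]
    proof (rule eventually_mono)
      fix t :: real assume "x + t *\<^sub>R v \<in> P"
      then have im: "x + t *\<^sub>R v \<in> \<psi> ` US" using P(3) by blast
      have sS: "\<sigma> (x + t *\<^sub>R v) \<in> S" using \<sigma>_carrier[OF im] .
      have "\<sigma> x \<otimes> (inv (\<sigma> x) \<otimes> \<sigma> (x + t *\<^sub>R v)) = \<sigma> (x + t *\<^sub>R v)"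
        using xc sS by (simp add: m_assoc[symmetric])
      then show "\<psi> (\<pi> (\<sigma> x \<otimes> (inv (\<sigma> x) \<otimes> \<sigma> (x + t *\<^sub>R v)))) = x + t *\<^sub>R v"
        using sS \<psi>_\<sigma>[OF im] by simp
    qed
    ultimately have "((\<lambda>t. x + t *\<^sub>R v) has_vector_derivative field Y x) (at 0)"
      by (subst (asm) has_vector_derivative_cong_ev[where g="\<lambda>t. x + t *\<^sub>R v"])
        (auto dest: eventually_nhds_x_imp_x elim: eventually_mono)
    moreover have "((\<lambda>t. x + t *\<^sub>R v) has_vector_derivative v) (at 0)"
      by (auto intro!: derivative_eq_intros simp: has_vector_derivative_def)
    ultimately show ?thesis by (rule vector_derivative_unique_at)
  qed
  have "field X y = 0" if X: "X \<in> \<qq>" and y: "y \<in> B" for X y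
  proof -
    define v where "v = y - \<psi> \<one>"
    have v: "v \<in> model MS" using B(4)[OF y] by (simp add: v_def)
    have seg: "\<psi> \<one> + t *\<^sub>R v \<in> P" "\<psi> \<one> + t *\<^sub>R v \<in> V" if "t \<in> {0..1}" for t
      using B(5)[OF y that] B(3) by (auto simp: v_def)
    have "continuous_on {0..1} (\<lambda>t. \<Xi> v (\<psi> \<one> + t *\<^sub>R v))"
      by (rule continuous_on_compose2[OF \<Xi>(1)[OF v]]) (use seg(1) in \<open>auto intro!: continuous_intros\<close>)
    then have "bounded ((\<lambda>t. \<Xi> v (\<psi> \<one> + t *\<^sub>R v)) ` {0..1})"
      by (intro compact_imp_bounded compact_continuous_image) auto
    then obtain R where R: "\<And>t. t \<in> {0..1} \<Longrightarrow> norm (\<Xi> v (\<psi> \<one> + t *\<^sub>R v)) \<le> R"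
      unfolding bounded_iff by blast
    obtain k where k: "k > 0" "\<And>X. X \<in> \<gg> \<Longrightarrow> k * norm X \<le> norm (\<xi> X)"
      using \<xi>_bounded_below by blast
    have "field X (\<psi> \<one> + 1 *\<^sub>R v) = 0"
    proof (rule action_fields_vanish_on_segment[where V = field and ?y0.0 = "\<psi> \<one>" and R = "R / k"
          and U = V and \<gg> = \<gg> and br = br])
      show "subspace (model MS)" "openin (top_of_set (model MS)) V" "v \<in> model MS"
        "lie_algebra br \<gg>" "lie_ideal br \<gg> \<qq>" "X \<in> \<qq>"
        by (rule subspace_model_S V(1) v alg ideal X)+
      show "\<And>t. t \<in> {0..1} \<Longrightarrow> \<psi> \<one> + t *\<^sub>R v \<in> V" by (rule seg(2))
      show "\<And>y. y \<in> V \<Longrightarrow> linear_within \<gg> (\<lambda>X. field X y)" by (rule field_linear)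
      show "\<And>X y. X \<in> \<gg> \<Longrightarrow> y \<in> V \<Longrightarrow> field X y \<in> model MS" by (rule field_in)
      show "\<And>X. X \<in> \<gg> \<Longrightarrow> smooth_on (model MS) V (field X)" by (rule field_smooth)
      show "\<And>X. X \<in> \<qq> \<Longrightarrow> field X (\<psi> \<one>) = 0" by (rule field_zero_at_base)
      show "field (br Y X) y = D (field Y y) - D' (field X y)"
        if "X \<in> \<gg>" "Y \<in> \<gg>" "y \<in> V" "(field X has_derivative D) (at y within V)"
          "(field Y has_derivative D') (at y within V)" for X Y y D D'
        using that by (rule field_bracket)
      fix t :: real assume t: "t \<in> {0..1}"
      obtain Y where Y: "Y \<in> \<ss>" "\<Xi> v (\<psi> \<one> + t *\<^sub>R v) = \<xi> Y" using \<Xi>(2)[OF v seg(1)[OF t]] by blast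
      have "k * norm Y \<le> R" using k(2)[of Y] Y ss R[OF t] by auto
      then have "norm Y \<le> R / k" using k(1) by (simp add: field_simps)
      moreover have "field Y (\<psi> \<one> + t *\<^sub>R v) = v"
        using span[OF v seg(1)[OF t] seg(2)[OF t]] Y(2) by simp
      ultimately show "\<exists>Y\<in>\<gg>. norm Y \<le> R / k \<and> field Y (\<psi> \<one> + t *\<^sub>R v) = v"
        using Y(1) ss by blast
    qed auto
    then show ?thesis by (simp add: v_def)
  qed
  then show ?thesis using that B(1,2,3) by blast
qed

text \<open>
  Follow a segment in the chart of \<open>Q\<close>, and move a point \<open>y\<close> of \<open>S\<close> by it.  The velocity of the moving point at each
  time is the value there of a field of \<open>\<qq>\<close>, hence \<open>0\<close>.  So the point stays at \<open>y\<close>: \<open>\<pi> (s q) = s\<close>, which says that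
  \<open>s q s\<^sup>-\<^sup>1 \<in> Q\<close>.
\<close>

lemma conjugation_near_identity:
  obtains WQ WS where "openin (mtop MQ) WQ" "\<one> \<in> WQ" "openin (mtop MS) WS" "\<one> \<in> WS"
    "\<And>s q. s \<in> WS \<Longrightarrow> q \<in> WQ \<Longrightarrow> s \<otimes> q \<otimes> inv s \<in> Q"
proof -
  obtain B where B: "openin (top_of_set (model MS)) B" "\<psi> \<one> \<in> B" "B \<subseteq> V"
    "\<And>X y. X \<in> \<qq> \<Longrightarrow> y \<in> B \<Longrightarrow> field X y = 0"
    using field_vanishes_near_base by blast
  obtain P \<Xi> where P: "openin (top_of_set (model MQ)) P" "\<eta> \<one> \<in> P" "P \<subseteq> \<eta> ` UQ"
    and \<Xi>: "\<And>v x. v \<in> model MQ \<Longrightarrow> x \<in> P \<Longrightarrow> \<Xi> v x \<in> \<xi> ` \<qq>"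
    "\<And>v x. v \<in> model MQ \<Longrightarrow> x \<in> P \<Longrightarrow>
       ((\<lambda>t. \<phi> (inv (\<kappa> x) \<otimes> \<kappa> (x + t *\<^sub>R v))) has_vector_derivative \<Xi> v x) (at 0)"
    "\<And>v x. v \<in> model MQ \<Longrightarrow> x \<in> P \<Longrightarrow> \<forall>\<^sub>F t in nhds 0. inv (\<kappa> x) \<otimes> \<kappa> (x + t *\<^sub>R v) \<in> U"
    using subgroup_curves[OF LQ hQ qq UQ] by metis
  have evB: "\<forall>\<^sub>F x in nhdsin (ctop CS) (\<pi> (fst (\<one>, \<one>) \<otimes> snd (\<one>, \<one>))). x \<in> US \<and> \<psi> x \<in> B"
    using chart_preimage[OF S_chart(1), of B \<one>] B(1,2) US(2) by simp
  obtain O1 O2 where O1: "openin (top_of_set (model MS)) O1" "\<psi> \<one> \<in> O1" "O1 \<subseteq> \<psi> ` US"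
    and O2: "openin (top_of_set (model MQ)) O2" "\<eta> \<one> \<in> O2" "O2 \<subseteq> \<eta> ` UQ"
    and O12: "\<And>y z. y \<in> O1 \<Longrightarrow> z \<in> O2 \<Longrightarrow> \<pi> (\<sigma> y \<otimes> \<kappa> z) \<in> US \<and> \<psi> (\<pi> (\<sigma> y \<otimes> \<kappa> z)) \<in> B"
    using smooth_germ_box[OF S_chart(1) Q_chart(1) germ_SQ evB] unfolding mchart_simps fst_conv snd_conv
    by (simp del: split_paired_All split_paired_Ex) metis
  have O2P: "openin (top_of_set (model MQ)) (O2 \<inter> P)" using O2(1) P(1) by (rule openin_Int)
  obtain A where A: "openin (top_of_set (model MQ)) A" "\<eta> \<one> \<in> A" "A \<subseteq> O2 \<inter> P"
    "\<And>x. x \<in> A \<Longrightarrow> x - \<eta> \<one> \<in> model MQ"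
    "\<And>x t. x \<in> A \<Longrightarrow> t \<in> {0..1} \<Longrightarrow> \<eta> \<one> + t *\<^sub>R (x - \<eta> \<one>) \<in> A"
    using star_shaped_neighbourhood[OF subspace_model_Q O2P] O2(2) P(2) by blast
  have fixed: "\<pi> (\<sigma> y \<otimes> \<kappa> x) = \<sigma> y" if y: "y \<in> O1" and x: "x \<in> A" for y x
  proof -
    define v where "v = x - \<eta> \<one>"
    define c where "c t = \<eta> \<one> + t *\<^sub>R v" for t
    define h where "h t = \<psi> (\<pi> (\<sigma> y \<otimes> \<kappa> (c t)))" for t
    have v: "v \<in> model MQ" using A(4)[OF x] by (simp add: v_def)
    have cA: "c t \<in> A" if "t \<in> {0..1}" for t using A(5)[OF x that] by (simp add: c_def v_def)
    have yS: "\<sigma> y \<in> S" using \<sigma>_carrier y O1(3) by blast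
    have yc: "\<sigma> y \<in> carrier G" using yS by simp
    have der: "(h has_vector_derivative 0) (at t)" if t: "t \<in> {0..1}" for t
    proof -
      have ct: "c t \<in> O2" "c t \<in> P" using cA[OF t] A(3) by auto
      have hB: "h t \<in> B" and hU: "\<pi> (\<sigma> y \<otimes> \<kappa> (c t)) \<in> US"
        using O12[OF y ct(1)] by (simp_all add: h_def)
      have hV: "h t \<in> V" using hB B(3) by blast
      obtain X where X: "X \<in> \<qq>" "\<Xi> v (c t) = \<xi> X" using \<Xi>(1)[OF v ct(2)] by blast
      have kQ: "\<kappa> (c t) \<in> Q" using \<kappa>_carrier P(3) ct(2) by blast
      have kc: "\<kappa> (c t) \<in> carrier G" using kQ by simp
      have "((\<lambda>u. \<psi> (\<pi> (\<sigma> (h t) \<otimes> (inv (\<kappa> (c t)) \<otimes> \<kappa> (c t + u *\<^sub>R v))))) has_vector_derivative field X (h t)) (at 0)"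
        by (rule action_derivative[OF hV _ \<Xi>(3)[OF v ct(2)]]) (use \<Xi>(2)[OF v ct(2)] X(2) kc in simp_all)
      moreover have "\<forall>\<^sub>F u in nhds 0. \<psi> (\<pi> (\<sigma> (h t) \<otimes> (inv (\<kappa> (c t)) \<otimes> \<kappa> (c t + u *\<^sub>R v)))) = h (t + u)"
        using line_in_openin[OF subspace_model_Q P(1) ct(2) v]
      proof (rule eventually_mono)
        fix u :: real assume u: "c t + u *\<^sub>R v \<in> P"
        have k2: "\<kappa> (c t + u *\<^sub>R v) \<in> carrier G" using \<kappa>_carrier P(3) u Q.mem_carrier by blast
        have "\<sigma> (h t) = \<pi> (\<sigma> y \<otimes> \<kappa> (c t))" using hU by (simp add: h_def)
        then have "\<pi> (\<sigma> (h t) \<otimes> (inv (\<kappa> (c t)) \<otimes> \<kappa> (c t + u *\<^sub>R v))) =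
            \<pi> (\<sigma> y \<otimes> \<kappa> (c t) \<otimes> (inv (\<kappa> (c t)) \<otimes> \<kappa> (c t + u *\<^sub>R v)))"
          using \<pi>_action[of "\<sigma> y \<otimes> \<kappa> (c t)"] yc kc k2 by simp
        also have "\<sigma> y \<otimes> \<kappa> (c t) \<otimes> (inv (\<kappa> (c t)) \<otimes> \<kappa> (c t + u *\<^sub>R v)) = \<sigma> y \<otimes> \<kappa> (c t + u *\<^sub>R v)"
          using yc kc k2 inv_mult_cancel_left[of "inv (\<kappa> (c t))"] by (simp add: m_assoc)
        also have "c t + u *\<^sub>R v = c (t + u)" by (simp add: c_def scaleR_add_left)
        finally show "\<psi> (\<pi> (\<sigma> (h t) \<otimes> (inv (\<kappa> (c t)) \<otimes> \<kappa> (c t + u *\<^sub>R v)))) = h (t + u)"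
          by (simp add: h_def c_def scaleR_add_left add.assoc)
      qed
      ultimately have "((\<lambda>u. h (t + u)) has_vector_derivative field X (h t)) (at 0)"
        by (subst (asm) has_vector_derivative_cong_ev[where g="\<lambda>u. h (t + u)"])
          (auto dest: eventually_nhds_x_imp_x elim: eventually_mono)
      then have "((\<lambda>u. h (t + u)) has_vector_derivative 0) (at 0)" using B(4)[OF X(1) hB] by simp
      then show ?thesis
        unfolding has_vector_derivative_def has_derivative_at by simp
    qed
    have "h 1 = h 0"
    proof -
      have "\<exists>k. \<forall>t\<in>{0..1}. h t = k"
      proof (rule has_vector_derivative_zero_constant[of "{0..1}" h])
        show "(h has_vector_derivative 0) (at t within {0..1})" if "t \<in> {0..1}" for t
          by (rule has_vector_derivative_at_within[OF der[OF that]])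
      qed auto
      then show ?thesis by force
    qed
    moreover have "h 0 = y"
      using UQ(2) yS \<psi>_\<sigma> y O1(3) by (auto simp: h_def c_def)
    moreover have "h 1 = \<psi> (\<pi> (\<sigma> y \<otimes> \<kappa> x))" by (simp add: h_def c_def v_def)
    ultimately have "\<psi> (\<pi> (\<sigma> y \<otimes> \<kappa> x)) = y" by simp
    moreover have "\<pi> (\<sigma> y \<otimes> \<kappa> x) \<in> US" using O12[OF y] x A(3) by blast
    ultimately show ?thesis using \<sigma>_\<psi> by metis
  qed
  let ?WQ = "{q \<in> UQ. \<eta> q \<in> A}" and ?WS = "{s \<in> US. \<psi> s \<in> O1}"
  show ?thesis
  proof (rule that[of ?WQ ?WS])
    show "openin (mtop MQ) ?WQ" "openin (mtop MS) ?WS"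
      using Q_chart(1) S_chart(1) A(1) O1(1) by (auto simp: is_chart_def)
    show "\<one> \<in> ?WQ" "\<one> \<in> ?WS" using UQ(2) US(2) A(2) O1(2) by auto
    fix s q assume s: "s \<in> ?WS" and q: "q \<in> ?WQ"
    have sc: "s \<in> S" "q \<in> Q" using s q S_chart(3) Q_chart(3) by auto
    have "\<pi> (s \<otimes> q) = s" using fixed[of "\<psi> s" "\<eta> q"] s q by simp
    then obtain q' where q': "q' \<in> Q" "s \<otimes> q = q' \<otimes> s"
      using decomp[of "s \<otimes> q"] sc by auto
    then have "s \<otimes> q \<otimes> inv s = q'" using sc by (simp add: m_assoc)
    then show "s \<otimes> q \<otimes> inv s \<in> Q" using q'(1) by simp
  qed
qed

end

lemma conjugation_preserves_Q:
  assumes "connected_space (mtop MQ)" "connected_space (mtop MS)" and s: "s \<in> S" and q: "q \<in> Q"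
  shows "s \<otimes> q \<otimes> inv s \<in> Q"
proof -
  obtain V W where "act_box V W" using act_box_exists by blast
  from conjugation_near_identity[OF this]
  obtain WQ WS where W: "openin (mtop MQ) WQ" "\<one> \<in> WQ" "openin (mtop MS) WS" "\<one> \<in> WS"
    "\<And>s q. s \<in> WS \<Longrightarrow> q \<in> WQ \<Longrightarrow> s \<otimes> q \<otimes> inv s \<in> Q" by blast
  have lQ: "lie_group (G\<lparr>carrier := Q\<rparr>) MQ" and lS: "lie_group (G\<lparr>carrier := S\<rparr>) MS"
    using LQ LS by (auto simp: lie_subgroup_def)
  have "continuous_map (mtop MS) (mtop MS) (\<lambda>x. inv x)"
    by (rule continuous_map_eq[OF lie_group_continuous(3)[OF lS]])
      (use m_inv_consistent[OF sub_S] S_chart(2) in simp)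
  then show ?thesis
    using conjugation_invariant_from_neighbourhoods[OF is_group sub_Q sub_S Q_chart(2) assms(1) _ S_chart(2) assms(2) _ _ W s q]
      lie_group_continuous(2)[OF lQ] lie_group_continuous(2)[OF lS] by simp
qed

end

section \<open>Extending an algebra of functions from S to G\<close>

locale semidirect_product =
  fixes G :: "'g monoid" (structure) and Q S :: "'g set"
  assumes G: "group G" and Q: "subgroup Q G" and S: "subgroup S G"
    and bij: "bij_betw (\<lambda>(q, s). q \<otimes>\<^bsub>G\<^esub> s) (Q \<times> S) (carrier G)"
    and conj: "\<And>s q. s \<in> S \<Longrightarrow> q \<in> Q \<Longrightarrow> s \<otimes>\<^bsub>G\<^esub> q \<otimes>\<^bsub>G\<^esub> inv\<^bsub>G\<^esub> s \<in> Q"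
begin

sublocale group G by (rule G)
sublocale Q: subgroup Q G by (rule Q)
sublocale S: subgroup S G by (rule S)

lemma decompose:
  assumes "x \<in> carrier G"
  obtains q s where "q \<in> Q" "s \<in> S" "x = q \<otimes>\<^bsub>G\<^esub> s"
proof -
  have "x \<in> (\<lambda>(q, s). q \<otimes>\<^bsub>G\<^esub> s) ` (Q \<times> S)" using assms bij_betw_imp_surj_on[OF bij] by simp
  then show ?thesis using that by auto
qed

text \<open>
  A function on \<open>G\<close> is determined by its slices, so that identities between functions on \<open>G\<close> can be
  checked on \<open>S\<close>.
\<close>

lemma Fun_eqI_slice:
  assumes u: "u \<in> Fun_space (carrier G)" and v: "v \<in> Fun_space (carrier G)"
    and eq: "\<And>q. q \<in> Q \<Longrightarrow> slice G S u q = slice G S v q"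
  shows "u = v"
proof (rule extensionalityI[of _ "carrier G"])
  show "u \<in> extensional (carrier G)" "v \<in> extensional (carrier G)"
    using u v by (auto simp: Fun_space_def PiE_def)
  fix x assume "x \<in> carrier G"
  then obtain q s where "q \<in> Q" "s \<in> S" "x = q \<otimes>\<^bsub>G\<^esub> s" by (rule decompose)
  then show "u x = v x" using fun_cong[OF eq, of q s] by (simp add: slice_def)
qed

lemma slice_fadd: "q \<in> Q \<Longrightarrow> slice G S (fadd (carrier G) u v) q = fadd S (slice G S u q) (slice G S v q)"
  by (auto simp: slice_def fadd_def fun_eq_iff)

lemma slice_fscale: "q \<in> Q \<Longrightarrow> slice G S (fscale (carrier G) c u) q = fscale S c (slice G S u q)"
  by (auto simp: slice_def fscale_def fun_eq_iff)

text \<open>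
  \<open>q\<^sub>0 s\<^sub>0 q s = q\<^sub>0 (s\<^sub>0 q s\<^sub>0\<^sup>-\<^sup>1) s\<^sub>0 s\<close>.
\<close>

lemma slice_left_translate:
  assumes q0: "q0 \<in> Q" and s0: "s0 \<in> S" and q: "q \<in> Q"
  shows "slice G S (left_translate G (q0 \<otimes>\<^bsub>G\<^esub> s0) u) q =
    left_translate (G\<lparr>carrier := S\<rparr>) s0 (slice G S u (q0 \<otimes>\<^bsub>G\<^esub> (s0 \<otimes>\<^bsub>G\<^esub> q \<otimes>\<^bsub>G\<^esub> inv\<^bsub>G\<^esub> s0)))"
proof -
  have "q0 \<otimes> s0 \<otimes> (q \<otimes> s) = q0 \<otimes> (s0 \<otimes> q \<otimes> inv s0) \<otimes> (s0 \<otimes> s)" if "s \<in> S" for s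
    using assms that by (simp add: m_assoc inv_mult_cancel_left)
  then show ?thesis
    using assms by (auto simp: slice_def left_translate_def fun_eq_iff)
qed

context
  fixes HS :: "('g \<Rightarrow> complex) set" and starS
  assumes alg: "associative_algebra_on S HS starS"
    and inv: "left_regular_invariant (G\<lparr>carrier := S\<rparr>) HS"
    and invp: "left_invariant_product (G\<lparr>carrier := S\<rparr>) HS starS"
begin

abbreviation "H \<equiv> extended_space G Q S HS"
abbreviation "star \<equiv> extended_star G Q S starS"

lemma HS_space: "fun_subspace S HS" "HS \<subseteq> Fun_space S"
  using alg by (auto simp: associative_algebra_on_def fun_subspace_def)

lemma H_Fun: "u \<in> H \<Longrightarrow> u \<in> Fun_space (carrier G)"
  and H_slice: "u \<in> H \<Longrightarrow> q \<in> Q \<Longrightarrow> slice G S u q \<in> HS"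
  by (auto simp: extended_space_def)

lemma H_I: "u \<in> carrier G \<rightarrow>\<^sub>E UNIV \<Longrightarrow> (\<And>q. q \<in> Q \<Longrightarrow> slice G S u q \<in> HS) \<Longrightarrow> u \<in> H"
  by (simp add: extended_space_def Fun_space_def)

lemma extended_star_apply:
  assumes "q \<in> Q" "s \<in> S"
  shows "star u v (q \<otimes>\<^bsub>G\<^esub> s) = starS (slice G S u q) (slice G S v q) s"
proof -
  have "the_inv_into (Q \<times> S) (\<lambda>(q, s). q \<otimes>\<^bsub>G\<^esub> s) (q \<otimes>\<^bsub>G\<^esub> s) = (q, s)"
    using the_inv_into_f_f[OF bij_betw_imp_inj_on[OF bij], of "(q, s)"] assms by simp
  then show ?thesis using assms by (simp add: extended_star_def)
qed

text \<open>
  The extended product acts slice by slice.  Both sides agree outside \<open>S\<close> because \<open>starS\<close> stays in \<open>HS\<close>.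
\<close>

lemma slice_star:
  assumes "u \<in> H" "v \<in> H" "q \<in> Q"
  shows "slice G S (star u v) q = starS (slice G S u q) (slice G S v q)"
proof (rule extensionalityI[of _ S])
  have "starS (slice G S u q) (slice G S v q) \<in> HS"
    using alg H_slice assms by (simp add: associative_algebra_on_def)
  then show "starS (slice G S u q) (slice G S v q) \<in> extensional S"
    using HS_space by (auto simp: Fun_space_def PiE_def)
qed (use assms in \<open>auto simp: slice_def extended_star_apply\<close>)

lemma star_in_H:
  assumes "u \<in> H" "v \<in> H"
  shows "star u v \<in> H"
proof (rule H_I)
  show "star u v \<in> carrier G \<rightarrow>\<^sub>E UNIV" by (simp add: extended_star_def)
  show "slice G S (star u v) q \<in> HS" if "q \<in> Q" for q
    using alg H_slice assms that by (simp add: slice_star associative_algebra_on_def)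
qed

lemma extended_subspace: "fun_subspace (carrier G) H"
proof -
  have z: "(\<lambda>x\<in>carrier G. 0) \<in> H"
  proof -
    have "slice G S (\<lambda>x\<in>carrier G. 0) q = (\<lambda>x\<in>S. 0)" if "q \<in> Q" for q
      using that by (auto simp: slice_def fun_eq_iff)
    then show ?thesis using HS_space by (auto simp: extended_space_def fun_subspace_def Fun_space_def)
  qed
  have a: "fadd (carrier G) u v \<in> H" if "u \<in> H" "v \<in> H" for u v
  proof (rule H_I)
    show "fadd (carrier G) u v \<in> carrier G \<rightarrow>\<^sub>E UNIV" by (simp add: fadd_def)
    show "slice G S (fadd (carrier G) u v) q \<in> HS" if "q \<in> Q" for q
      using HS_space(1) H_slice \<open>u \<in> H\<close> \<open>v \<in> H\<close> that by (simp add: slice_fadd fun_subspace_def)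
  qed
  have c: "fscale (carrier G) c u \<in> H" if "u \<in> H" for c u
  proof (rule H_I)
    show "fscale (carrier G) c u \<in> carrier G \<rightarrow>\<^sub>E UNIV" by (simp add: fscale_def)
    show "slice G S (fscale (carrier G) c u) q \<in> HS" if "q \<in> Q" for q
      using HS_space(1) H_slice \<open>u \<in> H\<close> that by (simp add: slice_fscale fun_subspace_def)
  qed
  show ?thesis unfolding fun_subspace_def using z a c H_Fun by blast
qed

lemma left_translate_in_H:
  assumes g: "g \<in> carrier G" and u: "u \<in> H"
  shows "left_translate G g u \<in> H"
proof -
  obtain q0 s0 where g: "q0 \<in> Q" "s0 \<in> S" "g = q0 \<otimes>\<^bsub>G\<^esub> s0" using decompose[OF g] .
  have "slice G S (left_translate G g u) q \<in> HS" if q: "q \<in> Q" for q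
    unfolding g(3) slice_left_translate[OF g(1,2) q]
    using inv g H_slice[OF u] conj[OF g(2) q] by (simp add: left_regular_invariant_def)
  then show ?thesis by (simp add: extended_space_def Fun_space_def left_translate_def)
qed

lemma extended_invariant: "left_regular_invariant G H"
  using extended_subspace left_translate_in_H by (simp add: left_regular_invariant_def)

lemma extended_algebra: "associative_algebra_on (carrier G) H star"
proof -
  have sub: "fadd (carrier G) u v \<in> H" if "u \<in> H" "v \<in> H" for u v
    using extended_subspace that by (simp add: fun_subspace_def)
  have sub': "fscale (carrier G) c u \<in> H" if "u \<in> H" for u c
    using extended_subspace that by (simp add: fun_subspace_def)
  have HS: "starS (fadd S u v) w = fadd S (starS u w) (starS v w)"
      "starS w (fadd S u v) = fadd S (starS w u) (starS w v)"
      "starS (starS u v) w = starS u (starS v w)" if "u \<in> HS" "v \<in> HS" "w \<in> HS" for u v w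
    using alg that by (simp_all add: associative_algebra_on_def)
  have HS': "starS (fscale S c u) v = fscale S c (starS u v)"
      "starS u (fscale S c v) = fscale S c (starS u v)" if "u \<in> HS" "v \<in> HS" for u v c
    using alg that by (simp_all add: associative_algebra_on_def)
  note simps = slice_star slice_fadd slice_fscale star_in_H sub sub' H_slice H_Fun HS HS'
  have 1: "star (fadd (carrier G) u v) w = fadd (carrier G) (star u w) (star v w)"
    "star w (fadd (carrier G) u v) = fadd (carrier G) (star w u) (star w v)"
    if "u \<in> H" "v \<in> H" "w \<in> H" for u v w
    by (rule Fun_eqI_slice; simp add: that simps)+
  have 2: "star (fscale (carrier G) c u) v = fscale (carrier G) c (star u v)"
    "star u (fscale (carrier G) c v) = fscale (carrier G) c (star u v)"
    if "u \<in> H" "v \<in> H" for u v c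
    by (rule Fun_eqI_slice; simp add: that simps)+
  have 3: "star (star u v) w = star u (star v w)" if "u \<in> H" "v \<in> H" "w \<in> H" for u v w
    by (rule Fun_eqI_slice; simp add: that simps)
  show ?thesis
    unfolding associative_algebra_on_def using extended_subspace star_in_H 1 2 3 by simp
qed

lemma extended_star_invariant: "left_invariant_product G H star"
  unfolding left_invariant_product_def
proof (intro ballI)
  fix g u v assume g: "g \<in> carrier G" and u: "u \<in> H" and v: "v \<in> H"
  note H = left_translate_in_H[OF g u] left_translate_in_H[OF g v] left_translate_in_H[OF g star_in_H[OF u v]]
  obtain q0 s0 where qs: "q0 \<in> Q" "s0 \<in> S" "g = q0 \<otimes>\<^bsub>G\<^esub> s0" using decompose[OF g] .
  show "star (left_translate G g u) (left_translate G g v) = left_translate G g (star u v)"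
  proof (rule Fun_eqI_slice)
    fix q assume q: "q \<in> Q"
    define q' where "q' = q0 \<otimes> (s0 \<otimes> q \<otimes> inv s0)"
    have q': "q' \<in> Q" using conj[OF qs(2) q] qs by (simp add: q'_def)
    have sl: "slice G S (left_translate G g w) q = left_translate (G\<lparr>carrier := S\<rparr>) s0 (slice G S w q')" for w
      unfolding qs(3) q'_def by (rule slice_left_translate[OF qs(1,2) q])
    show "slice G S (star (left_translate G g u) (left_translate G g v)) q = slice G S (left_translate G g (star u v)) q"
      using invp H_slice[OF u q'] H_slice[OF v q'] qs(2)
      by (simp add: slice_star[OF H(1,2) q] slice_star[OF u v q'] sl left_invariant_product_def)
  qed (use H star_in_H H_Fun in auto)
qed

end

end

section \<open>The extended algebra\<close>

theorem theorem6p1: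
  fixes br :: "'a::euclidean_space \<Rightarrow> 'a \<Rightarrow> 'a"
    and \<gg> \<qq> \<ss> :: "'a set"
    and \<omega> :: "'a \<Rightarrow> 'a \<Rightarrow> real"
    and \<w> :: "('a \<Rightarrow> real) \<times> ('a \<Rightarrow> real) \<Rightarrow> ('a \<Rightarrow> real) \<times> ('a \<Rightarrow> real) \<Rightarrow> real"
    and G :: "'g monoid"
    and Q S :: "'g set"
    and MG :: "('g, 'eg::euclidean_space) mfd"
    and MQ :: "('g, 'eq::euclidean_space) mfd"
    and MS :: "('g, 'es::euclidean_space) mfd"
    and \<theta> :: "'a \<Rightarrow> ('g \<Rightarrow> real) \<Rightarrow> real"
    and HS :: "('g \<Rightarrow> complex) set"
    and starS :: "('g \<Rightarrow> complex) \<Rightarrow> ('g \<Rightarrow> complex) \<Rightarrow> 'g \<Rightarrow> complex"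
  assumes "elementary_solvable_presymplectic br \<gg> \<qq> \<ss> \<omega> \<w>"
    and "lie_group G MG" and "lie_algebra_of_group br \<gg> G MG \<theta>"
    and "connected_space (mtop MG)" and "simply_connected_space (mtop MG)"
    and "lie_subgroup G MG Q MQ" and "has_lie_algebra G MG \<theta> MQ \<qq>"
    and "connected_space (mtop MQ)" and "simply_connected_space (mtop MQ)"
    and "lie_subgroup G MG S MS" and "has_lie_algebra G MG \<theta> MS \<ss>"
    and "connected_space (mtop MS)" and "simply_connected_space (mtop MS)"
    and "diffeomorphism (prod_mfd MQ MS) MG (\<lambda>(q, s). q \<otimes>\<^bsub>G\<^esub> s)"
    and "associative_algebra_on S HS starS"
    and "left_regular_invariant (G\<lparr>carrier := S\<rparr>) HS"
    and "left_invariant_product (G\<lparr>carrier := S\<rparr>) HS starS"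
  shows "left_regular_invariant G (extended_space G Q S HS) \<and>
         (\<forall>u\<in>extended_space G Q S HS. \<forall>v\<in>extended_space G Q S HS. \<forall>q\<in>Q. \<forall>s\<in>S.
           extended_star G Q S starS u v (q \<otimes>\<^bsub>G\<^esub> s) = starS (slice G S u q) (slice G S v q) s) \<and>
         associative_algebra_on (carrier G) (extended_space G Q S HS) (extended_star G Q S starS) \<and>
         left_invariant_product G (extended_space G Q S HS) (extended_star G Q S starS)"
proof -
  have \<gg>: "lie_algebra br \<gg>" and ideal: "lie_ideal br \<gg> \<qq>" and ss: "\<ss> \<subseteq> \<gg>"
    using assms(1) unfolding elementary_solvable_presymplectic_def split_extension_def lie_subalgebra_def
    by blast+
  have lQ: "lie_group (G\<lparr>carrier := Q\<rparr>) MQ" and sQ: "subgroup Q G"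
    and lS: "lie_group (G\<lparr>carrier := S\<rparr>) MS" and sS: "subgroup S G"
    using assms(6,10) by (simp_all add: lie_subgroup_def)
  have G: "group G" using assms(2) by (simp add: lie_group_def)
  have one: "\<one>\<^bsub>G\<^esub> \<in> topspace (mtop MG)" "\<one>\<^bsub>G\<^esub> \<in> topspace (mtop MQ)" "\<one>\<^bsub>G\<^esub> \<in> topspace (mtop MS)"
    using lie_group_continuous(1)[OF assms(2)] lie_group_continuous(1)[OF lQ] lie_group_continuous(1)[OF lS]
      monoid.one_closed[OF group.is_monoid[OF G]] subgroup.one_closed[OF sQ] subgroup.one_closed[OF sS]
    by simp_all
  have man: "smooth_manifold MG" "smooth_manifold MQ" "smooth_manifold MS"
    using assms(2) lQ lS by (simp_all add: lie_group_def)
  obtain U \<phi> where U: "(U, \<phi>) \<in> atlas MG" "\<one>\<^bsub>G\<^esub> \<in> U" using manifold_chart_at[OF man(1) one(1)] .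
  obtain UQ \<eta> where UQ: "(UQ, \<eta>) \<in> atlas MQ" "\<one>\<^bsub>G\<^esub> \<in> UQ" using manifold_chart_at[OF man(2) one(2)] .
  obtain US \<psi> where US: "(US, \<psi>) \<in> atlas MS" "\<one>\<^bsub>G\<^esub> \<in> US" using manifold_chart_at[OF man(3) one(3)] .
  interpret L: lie_semidirect br \<gg> G MG \<theta> U \<phi> \<qq> \<ss> Q S MQ MS UQ US \<eta> \<psi>
    by (unfold_locales; fact \<gg> ideal ss assms U UQ US)
  interpret D: semidirect_product G Q S
    by (unfold_locales; (fact L.bij | rule L.conjugation_preserves_Q[OF assms(8) assms(12)]))
  note alg = assms(15,16,17)
  show ?thesis
    using D.extended_invariant[OF alg] D.extended_star_apply[OF alg] D.extended_algebra[OF alg]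
      D.extended_star_invariant[OF alg] by blast
qed

end
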